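(* Let $n\ge 1$ and $w\in S_n$. The Schubert polynomial $\mathfrak{S}_w$ is zero-one if and only if $w$ avoids each of the patterns $12543$, $13254$, $13524$, $13542$, $21543$, $125364$, $125634$, $215364$, $215634$, $315264$, $315624$, and $315642$.
   Context: For $w\in S_n$, the Schubert polynomial $\mathfrak{S}_w\in\mathbb{Z}[x_1,\dots,x_n]$ is defined by $\mathfrak{S}_{w_0}=x_1^{n-1}x_2^{n-2}\cdots x_{n-1}$ for $w_0=n\,(n-1)\cdots 1$, and $\mathfrak{S}_w=\partial_i\mathfrak{S}_{ws_i}$ whenever $w_i<w_{i+1}$, where $s_i$ is the transposition of $i,i+1$ and $\partial_i f=\frac{f-s_if}{x_i-x_{i+1}}$ ($s_i$ swapping $x_i,x_{i+1}$). A polynomial is zero-one if every coefficient is $0$ or $1$. A pattern of length $m$ is a permutation $\sigma\in S_m$; $w\in S_n$ contains $\sigma$ if there are indices $j_1<\dots<j_m$ with $w_{j_1},\dots,w_{j_m}$ in the same relative order as $\sigma_1,\dots,\sigma_m$, and avoids $\sigma$ otherwise. Patterns of different lengths are not identified (e.g. $154623$ contains $132$ but not $132456$). *)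

theory Defs
  imports "HOL-Library.Poly_Mapping" "HOL-Combinatorics.Transposition" "HOL-Combinatorics.Permutations"
begin

text \<open>Polynomials in variables x_1, x_2, ... with integer coefficients:
  finitely supported maps from exponent vectors (nat =>0 nat) to int.\<close>
type_synonym ipoly = "(nat \<Rightarrow>\<^sub>0 nat) \<Rightarrow>\<^sub>0 int"

definition var :: "nat \<Rightarrow> ipoly" where
  "var i = Poly_Mapping.single (Poly_Mapping.single i 1) 1"

definition swap_vars :: "nat \<Rightarrow> ipoly \<Rightarrow> ipoly" where
  "swap_vars i f = Poly_Mapping.map_key (Poly_Mapping.map_key (transpose i (Suc i))) f"

definition divdiff :: "nat \<Rightarrow> ipoly \<Rightarrow> ipoly" where
  "divdiff i f = (THE g. (var i - var (Suc i)) * g = f - swap_vars i f)"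

text \<open>Permutations w in S_n in one-line notation: w permutes {1..n}.\<close>
definition longest :: "nat \<Rightarrow> nat \<Rightarrow> nat" where
  "longest n = (\<lambda>j. if j \<in> {1..n} then Suc n - j else j)"

definition schubert_family :: "nat \<Rightarrow> ((nat \<Rightarrow> nat) \<Rightarrow> ipoly) \<Rightarrow> bool" where
  "schubert_family n S \<longleftrightarrow>
     S (longest n) = (\<Prod>i\<in>{1..n}. var i ^ (n - i)) \<and>
     (\<forall>w i. w permutes {1..n} \<longrightarrow> 1 \<le> i \<longrightarrow> i < n \<longrightarrow> w i < w (Suc i) \<longrightarrow>
        S w = divdiff i (S (w \<circ> transpose i (Suc i))))"

definition schubert :: "nat \<Rightarrow> (nat \<Rightarrow> nat) \<Rightarrow> ipoly" where
  "schubert n = (SOME S. schubert_family n S)"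

definition zero_one :: "ipoly \<Rightarrow> bool" where
  "zero_one p \<longleftrightarrow> (\<forall>m. Poly_Mapping.lookup p m \<in> {0, 1})"

definition contains_pattern :: "nat \<Rightarrow> (nat \<Rightarrow> nat) \<Rightarrow> nat list \<Rightarrow> bool" where
  "contains_pattern n w p \<longleftrightarrow>
     (\<exists>js. length js = length p \<and> sorted_wrt (<) js \<and> set js \<subseteq> {1..n} \<and>
        (\<forall>a < length p. \<forall>b < length p. w (js ! a) < w (js ! b) \<longleftrightarrow> p ! a < p ! b))"

definition bad_patterns :: "nat list list" where
  "bad_patterns = [[1,2,5,4,3], [1,3,2,5,4], [1,3,5,2,4], [1,3,5,4,2], [2,1,5,4,3],
     [1,2,5,3,6,4], [1,2,5,6,3,4], [2,1,5,3,6,4], [2,1,5,6,3,4], [3,1,5,2,6,4],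
     [3,1,5,6,2,4], [3,1,5,6,4,2]]"

end

theory Submission
  imports Defs
begin

text \<open>The Fomin--Stanley product in the nilCoxeter algebra computes a Schubert polynomial row by row:
  the first row either just deletes the first letter of \<open>w\<close>, or it exchanges in addition some
  consecutive values that exceed this letter, each exchange contributing a further factor
  \<open>x_1\<close>. Each bad pattern allows two different sequences of exchanges with the same weight and the
  same final word, so that some coefficient is at least two.

  For the converse, \<open>S_w\<close> is the divided difference of \<open>S_u\<close> with \<open>u = w s_h\<close> at an ascent \<open>h\<close>. It is
  zero-one with \<open>S_u\<close> if, within each set of monomials of \<open>S_u\<close> that differ only in \<open>x_h\<close> and
  \<open>x_{h+1}\<close> and have the same degree, at most one has a larger exponent at \<open>x_h\<close>. This holds if the
  degree in \<open>x_1, \<dots>, x_h\<close> is constant on the support of \<open>S_u\<close>, which is the case if no 132-pattern of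
  \<open>u\<close> has its 1 at a position up to \<open>h\<close> and its 3 and 2 after \<open>h\<close>, and also if the two exponents
  differ by at most two. A permutation \<open>w\<close> avoiding the twelve patterns has an ascent \<open>h\<close> of one of these
  kinds for which \<open>u\<close> avoids the patterns, too.\<close>

section \<open>Variable swaps and divided differences\<close>

text \<open>\<open>divdiff\<close> and \<open>schubert\<close> are defined by descriptions, so both
  need a witness. The nilCoxeter product \<open>Phi\<close> provides it: it satisfies the recursion,
  hence equals the Schubert polynomials, and its coefficients are visibly nonnegative. Nonnegativity
  serves both directions: lower bounds arise by keeping a few terms of a product, and in the
  converse only upper bounds on the coefficients of a divided difference remain. The obstacle in the
  first direction is that a single extra exchange in row k is possible only for two letters above
  letter k that are consecutive in value among the letters after position k. An arbitrary pattern
  occurrence lacks this property, so occurrences are chosen extremal (leftmost position, largest or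
  closest value), and letters in between at earlier positions are absorbed by the intermediate rows.
  In the converse, the first ascent always preserves avoidance, but both zero-one criteria can fail
  there at once. Analysing this failure through the Rothe diagram yields the second choice of
  ascent.\<close>

abbreviation cf :: "ipoly \<Rightarrow> (nat \<Rightarrow>\<^sub>0 nat) \<Rightarrow> int" where
  "cf \<equiv> Poly_Mapping.lookup"

abbreviation expo :: "(nat \<Rightarrow>\<^sub>0 nat) \<Rightarrow> nat \<Rightarrow> nat" where
  "expo \<equiv> Poly_Mapping.lookup"

abbreviation unit_exp :: "nat \<Rightarrow> (nat \<Rightarrow>\<^sub>0 nat)" where
  "unit_exp i \<equiv> Poly_Mapping.single i (Suc 0)"

abbreviation adj :: "nat \<Rightarrow> nat \<Rightarrow> nat" where
  "adj i \<equiv> transpose i (Suc i)"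

definition swap_exp :: "nat \<Rightarrow> (nat \<Rightarrow>\<^sub>0 nat) \<Rightarrow> (nat \<Rightarrow>\<^sub>0 nat)" where
  "swap_exp i m = Poly_Mapping.map_key (adj i) m"

lemma expo_swap_exp [simp]: "expo (swap_exp i m) j = expo m (adj i j)"
  unfolding swap_exp_def by (simp add: map_key.rep_eq inj_transpose)

lemma swap_exp_involutory [simp]: "swap_exp i (swap_exp i m) = m"
  by (rule poly_mapping_eqI) simp

lemma inj_swap_exp: "inj (swap_exp i)"
  by (metis injI swap_exp_involutory)

lemma cf_swap_vars [simp]: "cf (swap_vars i f) m = cf f (swap_exp i m)"
proof -
  have "inj (Poly_Mapping.map_key (adj i) :: (nat \<Rightarrow>\<^sub>0 nat) \<Rightarrow> _)"
    using inj_swap_exp unfolding swap_exp_def .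
  then show ?thesis
    unfolding swap_vars_def swap_exp_def by (simp add: map_key.rep_eq)
qed

lemma cf_single_mult:
  "cf (Poly_Mapping.single s 1 * f) m = (\<Sum>q. cf f q when m = s + q)"
proof -
  have "cf (Poly_Mapping.single s 1 * f) m
      = (\<Sum>l. ((\<Sum>q. cf f q when m = s + q) when l = s))"
    unfolding lookup_mult
    by (intro Sum_any.cong) (auto simp: lookup_single when_def)
  also have "\<dots> = (\<Sum>q. cf f q when m = s + q)"
    by simp
  finally show ?thesis .
qed

lemma unit_exp_le: "expo m i \<noteq> 0 \<Longrightarrow> m = unit_exp i + (m - unit_exp i)"
  by (rule poly_mapping_eqI) (auto simp: lookup_add lookup_minus lookup_single when_def)

lemma cf_var_mult:
  "cf (var i * f) m = (if expo m i = 0 then 0 else cf f (m - unit_exp i))"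
proof -
  have *: "cf (var i * f) m = (\<Sum>q. cf f q when m = unit_exp i + q)"
    unfolding var_def cf_single_mult by simp
  show ?thesis
  proof (cases "expo m i = 0")
    case True
    then have "(m = unit_exp i + q) = False" for q
      by (auto simp: lookup_add)
    then show ?thesis using True unfolding * by simp
  next
    case False
    have "m = unit_exp i + q \<longleftrightarrow> q = m - unit_exp i" for q
    proof
      assume "m = unit_exp i + q"
      then show "q = m - unit_exp i" by simp
    next
      assume "q = m - unit_exp i"
      then show "m = unit_exp i + q" using unit_exp_le[OF False] by simp
    qed
    then show ?thesis using False unfolding * by simp
  qed
qed

lemma swap_exp_diff: "swap_exp i (m - unit_exp j) = swap_exp i m - unit_exp (adj i j)"
  by (rule poly_mapping_eqI)
    (auto simp: lookup_minus lookup_single when_def transpose_eq_iff transpose_def)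

lemma swap_vars_var_mult: "swap_vars i (var j * f) = var (adj i j) * swap_vars i f"
  by (rule poly_mapping_eqI) (simp add: cf_var_mult swap_exp_diff)

lemma swap_vars_add [simp]: "swap_vars i (f + g) = swap_vars i f + swap_vars i g"
  by (rule poly_mapping_eqI) (simp add: lookup_add)

lemma swap_vars_diff [simp]: "swap_vars i (f - g) = swap_vars i f - swap_vars i g"
  by (rule poly_mapping_eqI) (simp add: lookup_minus)

lemma swap_vars_zero [simp]: "swap_vars i 0 = 0"
  by (rule poly_mapping_eqI) simp

lemma swap_exp_eq_zero_iff [simp]: "swap_exp i m = 0 \<longleftrightarrow> m = 0"
  by (metis expo_swap_exp lookup_zero poly_mapping_eqI swap_exp_involutory)

lemma swap_vars_one [simp]: "swap_vars i 1 = 1"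
  by (rule poly_mapping_eqI) (simp add: lookup_one when_def)

lemma var_neq: "i \<noteq> j \<Longrightarrow> var i \<noteq> var j"
  unfolding var_def by (metis inj_single injD lookup_single_eq lookup_single_not_eq zero_neq_one)

definition is_divdiff :: "nat \<Rightarrow> ipoly \<Rightarrow> ipoly \<Rightarrow> bool" where
  "is_divdiff i f g \<longleftrightarrow> (var i - var (Suc i)) * g = f - swap_vars i f"

lemma divdiff_eqI:
  assumes "is_divdiff i f g" shows "divdiff i f = g"
  unfolding divdiff_def
proof (rule the_equality)
  show "(var i - var (Suc i)) * g = f - swap_vars i f"
    using assms by (simp add: is_divdiff_def)
  fix h assume "(var i - var (Suc i)) * h = f - swap_vars i f"
  then have "(var i - var (Suc i)) * h = (var i - var (Suc i)) * g"
    using assms by (simp add: is_divdiff_def)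
  moreover have "var i - var (Suc i) \<noteq> 0" using var_neq[of i "Suc i"] by simp
  ultimately show "h = g" by simp
qed

lemma is_divdiff_add: "is_divdiff i f g \<Longrightarrow> is_divdiff i f' g' \<Longrightarrow> is_divdiff i (f + f') (g + g')"
  by (simp add: is_divdiff_def algebra_simps)

lemma is_divdiff_var_mult:
  assumes "is_divdiff i f g" "j \<noteq> i" "j \<noteq> Suc i"
  shows "is_divdiff i (var j * f) (var j * g)"
proof -
  have "(var i - var (Suc i)) * (var j * g) = var j * ((var i - var (Suc i)) * g)"
    by (simp add: mult.left_commute)
  also have "\<dots> = var j * f - swap_vars i (var j * f)"
    using assms by (simp add: is_divdiff_def swap_vars_var_mult right_diff_distrib)
  finally show ?thesis by (simp add: is_divdiff_def)
qed

lemma is_divdiff_zero: "swap_vars i f = f \<Longrightarrow> is_divdiff i f 0"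
  by (simp add: is_divdiff_def)

section \<open>The Fomin--Stanley product in the nilCoxeter algebra\<close>

text \<open>An element of the nilCoxeter algebra is represented by its coefficient function; \<open>lmul e\<close> and
  \<open>rmul i\<close> are the multiplications by a generator from the left and from the right.\<close>

type_synonym perm_fun = "(nat \<Rightarrow> nat) \<Rightarrow> ipoly"

definition lmul :: "nat \<Rightarrow> perm_fun \<Rightarrow> perm_fun" where
  "lmul e F = (\<lambda>w. if inv w (Suc e) < inv w e then F (adj e \<circ> w) else 0)"

definition rmul :: "nat \<Rightarrow> perm_fun \<Rightarrow> perm_fun" where
  "rmul i F = (\<lambda>w. if w (Suc i) < w i then F (w \<circ> adj i) else 0)"

lemma inv_adj_comp: "inv (adj e \<circ> w) x = inv w (adj e x)"
proof -
  have "(adj e (w y) = x) \<longleftrightarrow> (w y = adj e x)" for y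
    by (metis transpose_involutory)
  then show ?thesis by (simp add: inv_into_def)
qed

lemma bij_adj_comp: "bij w \<Longrightarrow> bij (adj e \<circ> w)"
  by (rule bij_comp) simp_all

lemma lmul_add: "lmul e (\<lambda>w. F w + G w) = (\<lambda>w. lmul e F w + lmul e G w)"
  by (rule ext) (simp add: lmul_def)

lemma lmul_smult: "lmul e (\<lambda>w. x * F w) = (\<lambda>w. x * lmul e F w)"
  by (rule ext) (simp add: lmul_def)

lemma lmul_minus: "lmul e (\<lambda>w. - F w) = (\<lambda>w. - lmul e F w)"
  by (rule ext) (simp add: lmul_def)

lemma lmul_diff: "lmul e (\<lambda>w. F w - G w) = (\<lambda>w. lmul e F w - lmul e G w)"
  by (rule ext) (simp add: lmul_def)

lemma lmul_zero: "lmul e (\<lambda>w. 0) = (\<lambda>w. 0)"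
  by (rule ext) (simp add: lmul_def)

section \<open>The nilCoxeter relations\<close>

lemma lmul_lmul: "lmul e (lmul e F) = (\<lambda>w. 0)"
  by (rule ext) (auto simp: lmul_def inv_adj_comp)

lemma lmul_commute:
  assumes "Suc d < e" shows "lmul d (lmul e F) = lmul e (lmul d F)"
proof
  fix w :: "nat \<Rightarrow> nat"
  have "adj e \<circ> (adj d \<circ> w) = adj d \<circ> (adj e \<circ> w)"
    using assms by (auto simp: fun_eq_iff transpose_def)
  moreover have "adj d e = e" "adj d (Suc e) = Suc e" "adj e d = d" "adj e (Suc d) = Suc d"
    using assms by (auto simp: transpose_def)
  ultimately show "lmul d (lmul e F) w = lmul e (lmul d F) w"
    by (simp add: lmul_def inv_adj_comp)
qed

lemma lmul_braid:
  "lmul (Suc e) (lmul e (lmul (Suc e) F)) = lmul e (lmul (Suc e) (lmul e F))"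
proof
  fix w :: "nat \<Rightarrow> nat"
  have "adj e \<circ> (adj (Suc e) \<circ> (adj e \<circ> w)) = adj (Suc e) \<circ> (adj e \<circ> (adj (Suc e) \<circ> w))"
    by (auto simp: fun_eq_iff transpose_def)
  then show "lmul (Suc e) (lmul e (lmul (Suc e) F)) w = lmul e (lmul (Suc e) (lmul e F)) w"
    by (auto simp: lmul_def inv_adj_comp)
qed

definition hfac :: "ipoly \<Rightarrow> nat \<Rightarrow> perm_fun \<Rightarrow> perm_fun" where
  "hfac x e F = (\<lambda>w. F w + x * lmul e F w)"

lemma hfac_commute:
  assumes "Suc d < e" shows "hfac x d (hfac y e F) = hfac y e (hfac x d F)"
proof -
  define G where "G = lmul d (lmul e F)"
  have "lmul e (lmul d F) = G" using lmul_commute[OF assms] by (simp add: G_def)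
  then show ?thesis
    by (simp add: hfac_def lmul_add lmul_smult G_def[symmetric] algebra_simps)
qed

lemma hfac_inverse: "hfac y e (hfac (- y) e F) = F"
  by (simp add: hfac_def lmul_add lmul_diff lmul_smult lmul_minus lmul_lmul)

lemma hfac_same_commute: "hfac x e (hfac y e F) = hfac y e (hfac x e F)"
  by (simp add: hfac_def lmul_add lmul_smult lmul_lmul algebra_simps)

text \<open>A form of the Yang--Baxter equation in the nilCoxeter algebra.\<close>

lemma yang_baxter:
  "hfac (- y) (Suc i) (hfac x i (hfac y (Suc i) (hfac y i F))) =
   (\<lambda>w. F w + (x + y) * lmul i F w + x * y * (lmul i (lmul (Suc i) F) w - lmul (Suc i) (lmul i F) w))"
proof -
  have z: "lmul (Suc i) (lmul i (lmul (Suc i) (lmul i F))) = (\<lambda>w. 0)"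
    by (simp add: lmul_braid lmul_lmul lmul_zero)
  show ?thesis
    by (rule ext)
      (simp add: hfac_def lmul_add lmul_smult lmul_minus lmul_lmul lmul_zero z lmul_braid,
        simp add: algebra_simps)
qed

text \<open>The closed form in \<open>yang_baxter\<close> is symmetric in \<open>x\<close> and
  \<open>y\<close>, although the four factors are not. This is what lets two rows trade their
  variables.\<close>

lemma yang_baxter_sym:
  "hfac (- y) (Suc i) (hfac x i (hfac y (Suc i) (hfac y i F))) =
   hfac (- x) (Suc i) (hfac y i (hfac x (Suc i) (hfac x i F)))"
  unfolding yang_baxter by (simp add: algebra_simps)

section \<open>Commuting rows\<close>

primrec row :: "ipoly \<Rightarrow> nat \<Rightarrow> nat \<Rightarrow> perm_fun \<Rightarrow> perm_fun" where
  "row x k 0 F = F"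
| "row x k (Suc t) F = hfac x (k + t) (row x k t F)"

lemma row_peel: "row x k (Suc t) F = row x (Suc k) t (hfac x k F)"
  by (induction t) simp_all

lemma hfac_row_commute: "Suc d < k \<Longrightarrow> hfac x d (row y k t F) = row y k t (hfac x d F)"
proof (induction t)
  case (Suc t)
  then show ?case using hfac_commute[of d "k + t" x y "row y k t F"] by simp
qed simp

text \<open>Peeling the first factor off each row and collecting the factors with index
  \<open>k\<close> and \<open>k + 1\<close> leaves two rows from \<open>k + 1\<close> on, which
  commute by induction, applied to the expression that \<open>yang_baxter_sym\<close> shows to be
  symmetric.\<close>

lemma row_commute: "row x k t (row y k t F) = row y k t (row x k t F)"
proof (induction t arbitrary: k F)
  case (Suc t)
  show ?case
  proof (cases t)
    case 0
    then show ?thesis by (simp add: hfac_same_commute)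
  next
    case (Suc t')
    have *: "row x k (Suc t) (row y k (Suc t) F) = row x (Suc k) t (row y (Suc k) t
        (hfac (- y) (Suc k) (hfac x k (hfac y (Suc k) (hfac y k F)))))" for x y
    proof -
      have "row x k (Suc t) (row y k (Suc t) F)
          = row x (Suc k) t (hfac x k (row y (Suc (Suc k)) t' (hfac y (Suc k) (hfac y k F))))"
        using Suc by (simp only: row_peel)
      also have "\<dots> = row x (Suc k) t (row y (Suc (Suc k)) t' (hfac x k (hfac y (Suc k) (hfac y k F))))"
        by (simp only: hfac_row_commute lessI)
      \<comment> \<open>Inserting a factor and its inverse, available because the generators square
        to zero, turns the second row into a full row from \<open>k + 1\<close> again.\<close>
      also have "\<dots> = row x (Suc k) t (row y (Suc (Suc k)) t'
          (hfac y (Suc k) (hfac (- y) (Suc k) (hfac x k (hfac y (Suc k) (hfac y k F))))))"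
        by (simp only: hfac_inverse)
      also have "\<dots> = row x (Suc k) t (row y (Suc k) t
          (hfac (- y) (Suc k) (hfac x k (hfac y (Suc k) (hfac y k F)))))"
        using Suc by (simp only: row_peel)
      finally show ?thesis .
    qed
    show ?thesis unfolding * Suc.IH yang_baxter_sym[of y] ..
  qed
qed simp

lemma row_lin: "row x k t (\<lambda>w. F w + c * G w) = (\<lambda>w. row x k t F w + c * row x k t G w)"
  by (induction t) (simp_all add: hfac_def lmul_add lmul_smult algebra_simps)

lemma swap_vars_row:
  "swap_vars i (row (var j) k t F w) = row (var (adj i j)) k t (\<lambda>w. swap_vars i (F w)) w"
  by (induction t arbitrary: w) (simp_all add: hfac_def lmul_def swap_vars_var_mult)

lemma row_cong_bij:
  assumes "\<And>w. bij w \<Longrightarrow> F w = G w" and "bij w"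
  shows "row x k t F w = row x k t G w"
  using assms(2) by (induction t arbitrary: w) (simp_all add: assms(1) hfac_def lmul_def bij_adj_comp)

text \<open>Associativity of the nilCoxeter algebra. The two length conditions influence each other
  only if \<open>w\<close> maps \<open>{i, Suc i}\<close> onto \<open>{e, Suc e}\<close>, and then
  both sides vanish.\<close>

lemma lmul_rmul:
  assumes "bij w" shows "lmul e (rmul i F) w = rmul i (lmul e F) w"
proof -
  have inj: "w a = w b \<longleftrightarrow> a = b" for a b using assms by (meson bij_is_inj injD)
  have [simp]: "inv w (w a) = a" for a using assms by (simp add: bij_is_inj)
  have [simp]: "w (inv w a) = a" for a using assms by (simp add: bij_is_surj surj_f_inv_f)
  have inv2: "inv (w \<circ> adj i) x = adj i (inv w x)" for x
    using assms by (simp add: o_inv_distrib)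
  consider "w i = e" "w (Suc i) = Suc e" | "w i = Suc e" "w (Suc i) = e"
    | "{w i, w (Suc i)} \<noteq> {e, Suc e}"
    using doubleton_eq_iff[of "w i" "w (Suc i)" e "Suc e"] by argo
  then show ?thesis
  proof cases
    case 1
    then have "inv w e = i" "inv w (Suc e) = Suc i" by (metis \<open>\<And>a. inv w (w a) = a\<close>)+
    then show ?thesis using 1 by (simp add: lmul_def rmul_def inv2)
  next
    case 2
    then have "inv w e = Suc i" "inv w (Suc e) = i" by (metis \<open>\<And>a. inv w (w a) = a\<close>)+
    then show ?thesis using 2 by (simp add: lmul_def rmul_def inv2)
  next
    case 3
    have a: "adj e (w (Suc i)) < adj e (w i) \<longleftrightarrow> w (Suc i) < w i"
      using 3 inj[of i "Suc i"] by (auto simp: transpose_def)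
    have "{inv w e, inv w (Suc e)} \<noteq> {i, Suc i}"
    proof
      assume "{inv w e, inv w (Suc e)} = {i, Suc i}"
      then have "w ` {inv w e, inv w (Suc e)} = w ` {i, Suc i}" by simp
      with 3 show False by simp
    qed
    then have b: "adj i (inv w (Suc e)) < adj i (inv w e) \<longleftrightarrow> inv w (Suc e) < inv w e"
      using \<open>\<And>a. w (inv w a) = a\<close>[of e] \<open>\<And>a. w (inv w a) = a\<close>[of "Suc e"]
      by (auto simp: transpose_def) 
    show ?thesis using a b by (simp add: lmul_def rmul_def inv2 comp_assoc)
  qed
qed

lemma rmul_hfac:
  assumes "bij w" shows "hfac x e (rmul i F) w = rmul i (hfac x e F) w"
  using lmul_rmul[OF assms, of e i F] by (simp add: hfac_def rmul_def)

lemma rmul_row: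
  assumes "bij w" shows "row x k t (rmul i F) w = rmul i (row x k t F) w"
  using assms
proof (induction t arbitrary: w)
  case (Suc t)
  have "hfac x (k + t) (row x k t (rmul i F)) w = hfac x (k + t) (rmul i (row x k t F)) w"
    unfolding hfac_def lmul_def Suc.IH[OF Suc.prems] Suc.IH[OF bij_adj_comp[OF Suc.prems]] ..
  also have "\<dots> = rmul i (hfac x (k + t) (row x k t F)) w"
    by (rule rmul_hfac[OF Suc.prems])
  finally show ?case by simp
qed simp

text \<open>The coefficients of the product of the rows \<open>k, \<dots>, k + t - 1\<close>, where row \<open>j\<close> is
  \<open>(1 + x_j u_{k+t-1}) \<dots> (1 + x_j u_j)\<close>.\<close>

fun Phi :: "nat \<Rightarrow> nat \<Rightarrow> perm_fun" where
  "Phi k 0 = (\<lambda>w. if w = id then 1 else 0)"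
| "Phi k (Suc t) = row (var k) k (Suc t) (Phi (Suc k) t)"

lemma row_support:
  assumes "\<And>w. F w \<noteq> 0 \<Longrightarrow> w permutes A" "{k..k+t} \<subseteq> A" "row x k t F w \<noteq> 0"
  shows "w permutes A"
  using assms(2,3)
proof (induction t arbitrary: w)
  case (Suc t)
  have "row x k t F w \<noteq> 0 \<or> row x k t F (adj (k + t) \<circ> w) \<noteq> 0"
    using Suc.prems(2) by (auto simp: hfac_def lmul_def split: if_splits)
  then show ?case
  proof
    assume "row x k t F w \<noteq> 0"
    moreover have "{k..k + t} \<subseteq> A" using Suc.prems(1) by auto
    ultimately show ?thesis using Suc.IH by blast
  next
    assume "row x k t F (adj (k + t) \<circ> w) \<noteq> 0"
    moreover have "{k..k + t} \<subseteq> A" using Suc.prems(1) by auto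
    ultimately have "(adj (k + t) \<circ> w) permutes A" using Suc.IH by blast
    moreover have "adj (k + t) permutes A" using Suc.prems(1) by (intro permutes_swap_id) auto
    ultimately have "(adj (k + t) \<circ> (adj (k + t) \<circ> w)) permutes A" by (rule permutes_compose)
    then show ?thesis by (simp add: comp_assoc[symmetric])
  qed
qed (use assms in auto)

lemma Phi_support: "Phi k t w \<noteq> 0 \<Longrightarrow> w permutes {k..k+t}"
proof (induction t arbitrary: k w)
  case (Suc t)
  show ?case
  proof (rule row_support)
    show "row (var k) k (Suc t) (Phi (Suc k) t) w \<noteq> 0" using Suc.prems by simp
    fix v assume "Phi (Suc k) t v \<noteq> 0"
    then have "v permutes {Suc k..Suc k + t}" by (rule Suc.IH)
    then show "v permutes {k..k + Suc t}" by (rule permutes_subset) auto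
  qed auto
qed (auto simp: permutes_id split: if_splits)

lemma Phi_swap_vars: "Suc i < k \<Longrightarrow> swap_vars i (Phi k t w) = Phi k t w"
proof (induction t arbitrary: k w)
  case (Suc t)
  then have "swap_vars i (Phi (Suc k) t w) = Phi (Suc k) t w" for w by simp
  moreover have "adj i k = k" using Suc.prems by (simp add: transpose_def)
  ultimately show ?case by (simp del: row.simps add: swap_vars_row)
qed simp

lemma row_is_divdiff:
  assumes "\<And>w. bij w \<Longrightarrow> is_divdiff i (F w) (G w)" "j \<noteq> i" "j \<noteq> Suc i" "bij w"
  shows "is_divdiff i (row (var j) k t F w) (row (var j) k t G w)"
  using assms(4)
proof (induction t arbitrary: w)
  case (Suc t)
  have "is_divdiff i (lmul e (row (var j) k t F) w) (lmul e (row (var j) k t G) w)" for e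
    using Suc.IH[OF bij_adj_comp[OF Suc.prems]] unfolding lmul_def
    by (cases "inv w (Suc e) < inv w e") (simp_all only: if_True if_False is_divdiff_zero swap_vars_zero)
  then show ?case
    using Suc assms(2,3) by (simp add: hfac_def is_divdiff_add is_divdiff_var_mult)
qed (use assms in simp)

lemma lmul_eq_rmul_aux:
  assumes "bij w" "w k = Suc k" "w (Suc k) = k"
  shows "adj k \<circ> w = w \<circ> adj k" "inv w (Suc k) < inv w k" 
proof -
  have inj: "w a = w b \<longleftrightarrow> a = b" for a b using assms by (meson bij_is_inj injD)
  show "adj k \<circ> w = w \<circ> adj k"
  proof
    fix x
    show "(adj k \<circ> w) x = (w \<circ> adj k) x"
      using assms(2,3) inj[of x k] inj[of x "Suc k"] by (auto simp: transpose_def)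
  qed
  have "inv w k = Suc k" "inv w (Suc k) = k"
    using assms by (metis bij_inv_eq_iff)+
  then show "inv w (Suc k) < inv w k" by simp
qed

text \<open>A permutation fixing \<open>k\<close> and \<open>Suc k\<close> commutes with
  \<open>adj k\<close>, so the generator can be moved from the left of \<open>F\<close> to its
  right.\<close>

lemma lmul_eq_rmul:
  assumes "\<And>w. F w \<noteq> 0 \<Longrightarrow> w k = k \<and> w (Suc k) = Suc k" "bij w"
  shows "lmul k F w = rmul k F w"
proof (cases "w k = Suc k \<and> w (Suc k) = k")
  case True
  then show ?thesis using lmul_eq_rmul_aux[OF assms(2)] by (simp add: lmul_def rmul_def)
next
  case False
  have "F (adj k \<circ> w) = 0"
  proof (rule ccontr)
    assume "F (adj k \<circ> w) \<noteq> 0"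
    then have "adj k (w k) = k" "adj k (w (Suc k)) = Suc k" using assms(1) by fastforce+
    with False show False by (metis transpose_apply_first transpose_apply_second transpose_involutory)
  qed
  moreover have "F (w \<circ> adj k) = 0"
  proof (rule ccontr)
    assume "F (w \<circ> adj k) \<noteq> 0"
    then have "w (Suc k) = k" "w k = Suc k" using assms(1)[of "w \<circ> adj k"] by simp_all
    with False show False by simp
  qed
  ultimately show ?thesis by (simp add: lmul_def rmul_def)
qed

text \<open>Completing the second row by \<open>hfac y k\<close> and its inverse gives
  \<open>A = B F - y * B (lmul k F)\<close>, where \<open>B\<close> consists of two full rows and is
  symmetric in \<open>x\<close> and \<open>y\<close> by \<open>row_commute\<close>. Hence
  \<open>A\<close> minus its swap is \<open>(x - y) * B (lmul k F)\<close>. Since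
  \<open>lmul k F\<close> absorbs \<open>hfac (- y) k\<close>, and its generator can be moved
  through \<open>F\<close> and both rows to the right end, \<open>B (lmul k F)\<close> is
  \<open>rmul k A\<close>.\<close>

lemma two_rows_divdiff:
  fixes t :: nat
  assumes inv: "\<And>w. swap_vars k (F w) = F w"
    and supp: "\<And>w. F w \<noteq> 0 \<Longrightarrow> w k = k \<and> w (Suc k) = Suc k"
    and w: "bij w"
  defines "A \<equiv> row (var k) k (Suc t) (row (var (Suc k)) (Suc k) t F)"
  shows "is_divdiff k (A w) (rmul k A w)"
proof -
  define x y where "x = var k" and "y = var (Suc k)"
  define B where "B G = row x k (Suc t) (row y k (Suc t) G)" for G
  have A: "row x k (Suc t) (row y (Suc k) t G) = B (hfac (- y) k G)" for G
    unfolding B_def row_peel[of y] hfac_inverse ..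
  have "hfac (- y) k F = (\<lambda>w. F w + (- y) * lmul k F w)"
    by (simp add: hfac_def)
  then have A1: "A = (\<lambda>w. B F w + (- y) * B (lmul k F) w)"
    unfolding A_def x_def[symmetric] y_def[symmetric] A by (simp only: B_def row_lin)
  have "hfac (- y) k (lmul k F) = lmul k F"
    by (simp add: hfac_def lmul_lmul)
  then have "B (lmul k F) w = row x k (Suc t) (row y (Suc k) t (lmul k F)) w"
    unfolding A by simp
  also have "\<dots> = row x k (Suc t) (row y (Suc k) t (rmul k F)) w"
    using w by (intro row_cong_bij) (auto intro: lmul_eq_rmul[OF supp])
  also have "\<dots> = row x k (Suc t) (rmul k (row y (Suc k) t F)) w"
    using w by (intro row_cong_bij) (auto intro: rmul_row)
  also have "\<dots> = rmul k A w"
    unfolding A_def x_def y_def by (rule rmul_row[OF w])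
  finally have 1: "B (lmul k F) w = rmul k A w" .
  have sym: "swap_vars k (B G w) = B G w" if "\<And>w. swap_vars k (G w) = G w" for G w
  proof -
    have "swap_vars k (B G w) = row y k (Suc t) (row x k (Suc t) G) w"
      unfolding B_def x_def y_def swap_vars_row by (simp only: transpose_apply_first transpose_apply_second swap_vars_row that)
    also have "\<dots> = B G w" unfolding B_def row_commute[of x] ..
    finally show ?thesis .
  qed
  have "swap_vars k (lmul k F w) = lmul k F w" for w by (simp add: lmul_def inv)
  then have "A w - swap_vars k (A w) = (x - y) * B (lmul k F) w"
    unfolding A1 
    by (simp add: sym[OF inv] sym swap_vars_var_mult y_def x_def algebra_simps)
  then show ?thesis unfolding is_divdiff_def 1 x_def y_def by simp
qed

text \<open>For \<open>i > k\<close> the row in \<open>x_k\<close> is passed over, as it involves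
  neither \<open>x_i\<close> nor \<open>x_{i+1}\<close>; for \<open>i = k\<close> the first two rows
  are treated together, the second being empty if \<open>t = 0\<close>.\<close>

lemma Phi_divdiff:
  assumes "bij w" "k \<le> i" "i < k + t"
  shows "is_divdiff i (Phi k t w) (rmul i (Phi k t) w)"
  using assms
proof (induction t arbitrary: k w)
  case (Suc t)
  show ?case
  proof (cases "i = k")
    case False
    have "is_divdiff i (row (var k) k (Suc t) (Phi (Suc k) t) w)
        (row (var k) k (Suc t) (rmul i (Phi (Suc k) t)) w)"
      by (rule row_is_divdiff) (use Suc False in auto)
    then show ?thesis by (simp del: row.simps add: rmul_row[OF Suc.prems(1)])
  next
    case True
    show ?thesis
    proof (cases t)
      case 0
      have "is_divdiff k (row (var k) k (Suc 0) (row (var (Suc k)) (Suc k) 0 (Phi (Suc k) 0)) w)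
        (rmul k (row (var k) k (Suc 0) (row (var (Suc k)) (Suc k) 0 (Phi (Suc k) 0))) w)"
        by (rule two_rows_divdiff) (use Suc.prems in \<open>auto split: if_splits\<close>)
      then show ?thesis using 0 True by simp
    next
      case (Suc t')
      let ?F = "Phi (Suc (Suc k)) t'"
      have "is_divdiff k (row (var k) k (Suc t) (row (var (Suc k)) (Suc k) t ?F) w)
        (rmul k (row (var k) k (Suc t) (row (var (Suc k)) (Suc k) t ?F)) w)"
      proof (rule two_rows_divdiff)
        fix v assume "?F v \<noteq> 0"
        then have "v permutes {Suc (Suc k)..Suc (Suc k) + t'}" by (rule Phi_support)
        then show "v k = k \<and> v (Suc k) = Suc k" by (simp add: permutes_not_in)
      qed (use Suc.prems Phi_swap_vars in auto)
      then show ?thesis using Suc True by simp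
    qed
  qed
qed simp

section \<open>Removing the first row\<close>

lemma cf_var_power_mult [simp]: "cf (var k ^ a * f) (m + Poly_Mapping.single k a) = cf f m"
proof (induction a)
  case (Suc a)
  have "m + Poly_Mapping.single k (Suc a) - unit_exp k = m + Poly_Mapping.single k a"
    by (rule poly_mapping_eqI) (auto simp: lookup_add lookup_minus lookup_single when_def)
  then show ?case using Suc by (simp add: cf_var_mult mult.assoc lookup_add)
qed simp

definition nonneg :: "ipoly \<Rightarrow> bool" where
  "nonneg f \<longleftrightarrow> (\<forall>m. 0 \<le> cf f m)"

lemma nonneg_zero: "nonneg 0"
  by (simp add: nonneg_def)

lemma nonneg_add: "nonneg f \<Longrightarrow> nonneg g \<Longrightarrow> nonneg (f + g)"
  by (simp add: nonneg_def lookup_add)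

lemma nonneg_var_mult: "nonneg f \<Longrightarrow> nonneg (var k * f)"
  by (simp add: nonneg_def cf_var_mult)

lemma nonneg_var_power_mult: "nonneg f \<Longrightarrow> nonneg (var k ^ a * f)"
  by (induction a) (simp_all add: nonneg_var_mult mult.assoc)

lemma nonneg_lmul: "(\<And>w. nonneg (F w)) \<Longrightarrow> nonneg (lmul e F w)"
  by (simp add: lmul_def nonneg_zero)

lemma nonneg_row: "(\<And>w. nonneg (F w)) \<Longrightarrow> nonneg (row (var j) k t F w)"
  by (induction t arbitrary: w) (simp_all add: hfac_def nonneg_add nonneg_var_mult nonneg_lmul)

lemma nonneg_Phi: "nonneg (Phi k t w)"
proof (induction t arbitrary: k w)
  case 0
  then show ?case by (simp add: nonneg_def lookup_one when_def)
qed (simp add: nonneg_row del: row.simps)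

text \<open>Expand the factors with index at least \<open>k + a\<close> and keep the constant term
  and the linear terms with \<open>e\<close> in \<open>E\<close>; all discarded terms are
  nonnegative. The condition on \<open>inv w\<close> says that the generator \<open>e\<close> really
  contributes at \<open>w\<close>.\<close>

lemma row_ge_swaps:
  assumes F: "\<And>w. nonneg (F w)"
    and E: "\<And>e. e \<in> E \<Longrightarrow> k + a \<le> e \<and> e < k + t \<and> inv w (Suc e) < inv w e" and "a \<le> t"
  shows "nonneg (row (var j) k t F w -
    (row (var j) k a F w + var j * (\<Sum>e\<in>E. row (var j) k a F (adj e \<circ> w))))"
  using E \<open>a \<le> t\<close>
proof (induction t arbitrary: E w)
  case 0
  then have "a = 0" "E = {}" by fastforce+
  then show ?case by (simp add: nonneg_zero)
next
  case (Suc t)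
  have fin: "finite E" by (rule finite_subset[of _ "{..<k + Suc t}"]) (use Suc.prems in auto)
  show ?case
  proof (cases "a = Suc t")
    case True
    then have "E = {}" using Suc.prems by fastforce
    then show ?thesis using True by (simp add: nonneg_zero)
  next
    case False
    then have le: "a \<le> t" using Suc.prems by simp
    let ?R = "row (var j) k"
    \<comment> \<open>The case of an empty set: more factors can only increase the
      coefficients.\<close>
    have D: "nonneg (?R t F v - ?R a F v)" for v
      using Suc.IH[of "{}" v] le by simp
    show ?thesis
    proof (cases "k + t \<in> E")
      case True
      let ?E = "E - {k + t}"
      have "nonneg (?R t F w - (?R a F w + var j * (\<Sum>e\<in>?E. ?R a F (adj e \<circ> w))))"
        using Suc.prems le by (intro Suc.IH) force+
      moreover have "nonneg (var j * (?R t F (adj (k + t) \<circ> w) - ?R a F (adj (k + t) \<circ> w)))"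
        by (rule nonneg_var_mult[OF D])
      ultimately have "nonneg ((?R t F w - (?R a F w + var j * (\<Sum>e\<in>?E. ?R a F (adj e \<circ> w))))
         + var j * (?R t F (adj (k + t) \<circ> w) - ?R a F (adj (k + t) \<circ> w)))"
        by (rule nonneg_add)
      moreover have S: "(\<Sum>e\<in>E. ?R a F (adj e \<circ> w)) =
          ?R a F (adj (k + t) \<circ> w) + (\<Sum>e\<in>?E. ?R a F (adj e \<circ> w))"
        using fin True by (rule sum.remove)
      moreover have L: "lmul (k + t) (?R t F) w = ?R t F (adj (k + t) \<circ> w)"
        using Suc.prems(1)[OF True] by (simp add: lmul_def)
      ultimately show ?thesis unfolding row.simps hfac_def S L by (simp add: algebra_simps)
    next
      case False
      have "e < k + t" if "e \<in> E" for e
        using Suc.prems(1)[OF that] that False by (cases "e = k + t") auto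
      then have "nonneg (?R t F w - (?R a F w + var j * (\<Sum>e\<in>E. ?R a F (adj e \<circ> w))))"
        using Suc.prems le by (intro Suc.IH) auto
      moreover have "nonneg (var j * lmul (k + t) (?R t F) w)"
        by (intro nonneg_var_mult nonneg_lmul nonneg_row F)
      ultimately have "nonneg ((?R t F w - (?R a F w + var j * (\<Sum>e\<in>E. ?R a F (adj e \<circ> w))))
         + var j * lmul (k + t) (?R t F) w)"
        by (rule nonneg_add)
      then show ?thesis unfolding row.simps hfac_def
        by (simp only: diff_add_eq)
    qed
  qed
qed

lemma permutes_eq_iff: "w permutes A \<Longrightarrow> w i = w j \<longleftrightarrow> i = j"
  by (metis permutes_inverses(2))

lemma permutes_mem_iff: "w permutes A \<Longrightarrow> i \<in> A \<Longrightarrow> w i \<in> A"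
  by (simp add: permutes_in_image)

text \<open>The product of the generators \<open>k, ..., k + a - 1\<close> applied to the values:
  \<open>k + a\<close> is cycled down to \<open>k\<close>, and the values passed on the way move up
  by one, so the other letters keep their relative order.\<close>

primrec cyc :: "nat \<Rightarrow> nat \<Rightarrow> (nat \<Rightarrow> nat) \<Rightarrow> (nat \<Rightarrow> nat)" where
  "cyc k 0 w = w"
| "cyc k (Suc a) w = cyc k a (adj (k + a) \<circ> w)"

lemma cyc_apply:
  "cyc k a w i = (if w i = k + a then k else if k \<le> w i \<and> w i < k + a then Suc (w i) else w i)"
  by (induction a arbitrary: w) (auto simp: transpose_def)

lemma row_zero:
  assumes "\<And>v. F v \<noteq> 0 \<Longrightarrow> v k = k" "k + a < w k"
  shows "row x k a F w = 0"
  using assms(2)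
proof (induction a arbitrary: w)
  case 0
  then show ?case using assms(1)[of w] by auto
next
  case (Suc a)
  then have "row x k a F w = 0" "row x k a F (adj (k + a) \<circ> w) = 0"
    by (auto simp: transpose_def)
  then show ?case by (simp add: hfac_def lmul_def)
qed

text \<open>The forced part of a row: omitting the generator of the last factor would leave the
  first letter too large to be brought down to \<open>k\<close> by the remaining factors
  (\<open>row_zero\<close>), so every one of the \<open>a\<close> factors must contribute its
  generator.\<close>

lemma row_cyc:
  assumes F: "\<And>v. F v \<noteq> 0 \<Longrightarrow> v k = k"
    and "w permutes {k..n}" "w k = k + a"
  shows "row x k a F w = x ^ a * F (cyc k a w)"
  using assms(2,3)
proof (induction a arbitrary: w)
  case (Suc a)
  have "k \<in> {k..n}"
    using Suc.prems by (metis add_Suc_right add_eq_self_zero nat.distinct(1) permutes_not_in)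
  then have "w k \<in> {k..n}" using permutes_in_image[OF Suc.prems(1)] by blast
  then have n: "k + a \<in> {k..n}" "Suc (k + a) \<in> {k..n}" using Suc.prems by auto
  have 0: "row x k a F w = 0"
    by (rule row_zero) (use F Suc.prems in auto)
  have "inv w (Suc (k + a)) = k"
    using Suc.prems by (metis add_Suc_right permutes_inverses(2))
  moreover have "inv w (k + a) \<in> {k..n}"
    using permutes_in_image[OF permutes_inv[OF Suc.prems(1)]] n by blast
  moreover have "inv w (k + a) \<noteq> k"
    using Suc.prems by (metis add_Suc_right n_not_Suc_n permutes_inverses(1))
  ultimately have "inv w (Suc (k + a)) < inv w (k + a)" by auto
  moreover have "row x k a F (adj (k + a) \<circ> w) = x ^ a * F (cyc k a (adj (k + a) \<circ> w))"
  proof (rule Suc.IH)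
    show "(adj (k + a) \<circ> w) permutes {k..n}"
      using Suc.prems(1) n by (intro permutes_compose permutes_swap_id) auto
  qed (use Suc.prems in simp)
  ultimately show ?case by (simp add: hfac_def lmul_def 0 mult.assoc)
qed simp

lemma cyc_permutes:
  assumes "w permutes {k..n}" "w k = k + a" "k < n"
  shows "cyc k a w permutes {Suc k..n}"
proof -
  have "w k \<in> {k..n}" using permutes_in_image[OF assms(1), of k] assms(3) by auto
  then have a: "k + a \<le> n" using assms by simp
  have "cyc k a w permutes {k..n}"
    using assms(1) a
  proof (induction a arbitrary: w)
    case (Suc a)
    have "(adj (k + a) \<circ> w) permutes {k..n}"
      using Suc.prems by (intro permutes_compose permutes_swap_id) auto
    then show ?case using Suc by simp
  qed simp
  moreover have "cyc k a w k = k" using assms by (simp add: cyc_apply)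
  moreover have "x = k" if "x \<in> {k..n} - {Suc k..n}" for x
    using that by auto
  ultimately show ?thesis
    using permutes_superset[of "cyc k a w" "{k..n}" "{Suc k..n}"] by metis
qed

text \<open>Two functions are compared through the relative order of their values at the
  positions \<open>k, \<dots>, n\<close>; in this way the first position of a word can be dropped
  without renumbering the remaining values.\<close>

definition order_iso :: "nat \<Rightarrow> nat \<Rightarrow> (nat \<Rightarrow> nat) \<Rightarrow> (nat \<Rightarrow> nat) \<Rightarrow> bool" where
  "order_iso n k w g \<longleftrightarrow> (\<forall>i\<in>{k..n}. \<forall>j\<in>{k..n}. w i < w j \<longleftrightarrow> g i < g j)"

text \<open>Standardization of the word on positions \<open>k, ..., n\<close>: for \<open>g\<close>
  injective there, the permutation of \<open>{k..n}\<close> with the same relative order.\<close>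

definition std :: "nat \<Rightarrow> nat \<Rightarrow> (nat \<Rightarrow> nat) \<Rightarrow> (nat \<Rightarrow> nat)" where
  "std n k g = (\<lambda>i. if i \<in> {k..n} then k + card {l \<in> {k..n}. g l < g i} else i)"

lemma std_eq:
  assumes "w permutes {k..n}" "order_iso n k w g"
  shows "std n k g = w"
proof
  fix i
  show "std n k g i = w i"
  proof (cases "i \<in> {k..n}")
    case True
    then have wi: "w i \<in> {k..n}" using permutes_in_image[OF assms(1)] by blast
    have "card {l \<in> {k..n}. g l < g i} = card {l \<in> {k..n}. w l < w i}"
      using assms(2) True by (intro arg_cong[where f = card]) (auto simp: order_iso_def)
    also have "\<dots> = card (w ` {l \<in> {k..n}. w l < w i})"
      by (rule card_image[symmetric]) (meson assms(1) permutes_inj_on)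
    also have "w ` {l \<in> {k..n}. w l < w i} = {v \<in> {k..n}. v < w i}"
      by (subst (2) permutes_image[OF assms(1), symmetric]) auto
    also have "\<dots> = {k..<w i}" using wi by auto
    finally show ?thesis using True wi by (simp add: std_def)
  qed (use assms(1) in \<open>auto simp: std_def permutes_def\<close>)
qed

lemma std_order_iso:
  assumes "inj_on g {k..n}" shows "order_iso n k (std n k g) g"
proof -
  have "card {l \<in> {k..n}. g l < g i} < card {l \<in> {k..n}. g l < g j}"
    if "i \<in> {k..n}" "g i < g j" for i j
    by (rule psubset_card_mono) (use that in auto)
  then have "std n k g i < std n k g j" if "i \<in> {k..n}" "j \<in> {k..n}" "g i < g j" for i j
    using that by (simp add: std_def)
  moreover have "g i < g j" if "i \<in> {k..n}" "j \<in> {k..n}" "std n k g i < std n k g j" for i j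
  proof (rule ccontr)
    assume "\<not> g i < g j"
    then consider "g i = g j" | "g j < g i" by linarith
    then show False
    proof cases
      case 1
      then have "i = j" using assms that by (auto dest: inj_onD)
      then show ?thesis using that by simp
    next
      case 2
      then show ?thesis using calculation[of j i] that by simp
    qed
  qed
  ultimately show ?thesis unfolding order_iso_def by blast
qed

lemma std_permutes:
  assumes "inj_on g {k..n}" shows "std n k g permutes {k..n}"
proof (rule inj_imp_permutes)
  have iso: "order_iso n k (std n k g) g" by (rule std_order_iso[OF assms])
  show inj: "inj_on (std n k g) {k..n}"
  proof (rule inj_onI)
    fix i j assume ij: "i \<in> {k..n}" "j \<in> {k..n}" "std n k g i = std n k g j"
    have "std n k g i < std n k g j \<longleftrightarrow> g i < g j" "std n k g j < std n k g i \<longleftrightarrow> g j < g i"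
      using iso ij(1,2) unfolding order_iso_def by blast+
    then have "\<not> g i < g j" "\<not> g j < g i" using ij(3) by auto
    then show "i = j" using ij assms by (metis inj_onD linorder_neqE_nat)
  qed
  show "std n k g i \<in> {k..n}" if "i \<in> {k..n}" for i
  proof -
    have "{l \<in> {k..n}. g l < g i} \<subseteq> {k..n} - {i}" by auto
    then have "card {l \<in> {k..n}. g l < g i} \<le> card ({k..n} - {i})"
      by (intro card_mono) auto
    then have "card {l \<in> {k..n}. g l < g i} \<le> n - k"
      using that by (simp add: card_Diff_singleton)
    then show ?thesis using that by (auto simp: std_def)
  qed
qed (auto simp: std_def)

lemma std_cong: "order_iso n k g h \<Longrightarrow> std n k g = std n k h"
  unfolding std_def order_iso_def by (intro ext if_cong refl arg_cong[where f = "\<lambda>x. k + card x"]) auto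

text \<open>The Schubert polynomial of the standardized suffix from position \<open>k\<close>, in
  the variables from \<open>x_k\<close> on. It depends on \<open>g\<close> only through relative
  order, so passing from \<open>k\<close> to \<open>Suc k\<close> keeps the same
  \<open>g\<close>.\<close>

definition Q :: "nat \<Rightarrow> nat \<Rightarrow> (nat \<Rightarrow> nat) \<Rightarrow> ipoly" where
  "Q n k g = Phi k (n - k) (std n k g)"

lemma Q_cong: "order_iso n k g h \<Longrightarrow> Q n k g = Q n k h"
  unfolding Q_def by (simp add: std_cong)

lemma Q_permutes: "w permutes {k..n} \<Longrightarrow> Q n k w = Phi k (n - k) w"
  unfolding Q_def by (subst std_eq) (auto simp: order_iso_def)

lemma nonneg_Q: "nonneg (Q n k g)"
  unfolding Q_def by (rule nonneg_Phi)

lemma Q_last: "Q n n g = 1"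
proof -
  have "std n n g = id" by (auto simp: std_def fun_eq_iff)
  then show ?thesis by (simp add: Q_def)
qed

text \<open>The Lehmer code; its entry at \<open>k\<close> counts the forced factors of row
  \<open>k\<close>.\<close>

definition code :: "nat \<Rightarrow> (nat \<Rightarrow> nat) \<Rightarrow> nat \<Rightarrow> nat" where
  "code n g i = card {l \<in> {Suc i..n}. g l < g i}"

text \<open>The exchanges that row \<open>k\<close> can perform beyond its forced part: after
  standardization the two values are consecutive, so the exchange is a single generator, and being
  above \<open>g k\<close> its index lies beyond the forced factors.\<close>

definition adj_inv :: "nat \<Rightarrow> nat \<Rightarrow> (nat \<Rightarrow> nat) \<Rightarrow> nat \<Rightarrow> nat \<Rightarrow> bool" where
  "adj_inv n k g i j \<longleftrightarrow> k < i \<and> i < j \<and> j \<le> n \<and> g k < g j \<and> g j < g i \<and>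
     (\<forall>l\<in>{Suc k..n}. \<not> (g j < g l \<and> g l < g i))"

lemma Phi_Suc_fixes: "Phi (Suc k) t v \<noteq> 0 \<Longrightarrow> v k = k"
  using Phi_support[of "Suc k" t v] by (simp add: permutes_not_in)

lemma row_Q:
  assumes inj: "inj_on g {k..n}" and "k < n" and w: "w permutes {k..n}" "order_iso n k w g"
    and t: "t = n - Suc k"
  shows "row x k (code n g k) (Phi (Suc k) t) w = x ^ code n g k * Q n (Suc k) g"
    "w k = k + code n g k"
proof -
  have kn: "k \<in> {k..n}" using \<open>k < n\<close> by simp
  have "w k = std n k g k" using std_eq[OF w] by simp
  also have "\<dots> = k + card {l \<in> {k..n}. g l < g k}" using kn by (simp add: std_def)
  also have "{l \<in> {k..n}. g l < g k} = {l \<in> {Suc k..n}. g l < g k}"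
  proof -
    have "l \<noteq> k" if "g l < g k" for l using that by auto
    then show ?thesis by (auto simp: Suc_le_eq le_less)
  qed
  finally show wk: "w k = k + code n g k" by (simp add: code_def)
  have "row x k (code n g k) (Phi (Suc k) t) w = x ^ code n g k * Phi (Suc k) t (cyc k (code n g k) w)"
    by (rule row_cyc[OF _ w(1) wk]) (rule Phi_Suc_fixes)
  moreover have "std n (Suc k) g = cyc k (code n g k) w"
  proof (rule std_eq)
    show "cyc k (code n g k) w permutes {Suc k..n}"
      by (rule cyc_permutes) (use w wk \<open>k < n\<close> in auto)
    have *: "w i \<noteq> k + code n g k \<and> k \<le> w i" if "i \<in> {Suc k..n}" for i
    proof -
      have "i \<noteq> k" "i \<in> {k..n}" using that by auto
      then have "w i \<noteq> w k" "w i \<in> {k..n}"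
        using permutes_eq_iff[OF w(1)] permutes_mem_iff[OF w(1)] by blast+
      then show ?thesis using wk by auto
    qed
    have "cyc k (code n g k) w i < cyc k (code n g k) w j \<longleftrightarrow> w i < w j"
      if "i \<in> {Suc k..n}" "j \<in> {Suc k..n}" for i j
      using *[OF that(1)] *[OF that(2)] by (auto simp: cyc_apply)
    then show "order_iso n (Suc k) (cyc k (code n g k) w) g"
      using w(2) by (auto simp: order_iso_def)
  qed
  ultimately show "row x k (code n g k) (Phi (Suc k) t) w = x ^ code n g k * Q n (Suc k) g"
    by (simp add: Q_def t)
qed

text \<open>Each pair in \<open>P\<close> corresponds to the generator with index
  \<open>w j\<close>, because \<open>w i = w j + 1\<close>; injectivity of \<open>snd\<close> keeps
  these generators distinct. One such generator and the forced factors together give the power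
  \<open>Suc (code n g k)\<close>.\<close>

lemma Q_ge_swaps:
  assumes inj: "inj_on g {k..n}" and "k < n"
    and P: "finite P" "\<And>i j. (i, j) \<in> P \<Longrightarrow> adj_inv n k g i j" "inj_on snd P"
  shows "nonneg (Q n k g - (var k ^ code n g k * Q n (Suc k) g +
    (\<Sum>(i, j)\<in>P. var k ^ Suc (code n g k) * Q n (Suc k) (g \<circ> transpose i j))))"
proof -
  define w where "w = std n k g"
  define a where "a = code n g k"
  define t where "t = n - Suc k"
  have w: "w permutes {k..n}" "order_iso n k w g"
    unfolding w_def by (rule std_permutes[OF inj], rule std_order_iso[OF inj])
  have wk: "w k = k + a" unfolding a_def by (rule row_Q(2)[OF inj \<open>k < n\<close> w refl])
  have nk: "n - k = Suc t" using \<open>k < n\<close> by (simp add: t_def)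
  have Qk: "Q n k g = row (var k) k (Suc t) (Phi (Suc k) t) w"
    by (simp add: Q_def nk w_def del: row.simps)
  have winj: "w i = w j \<longleftrightarrow> i = j" for i j
    by (rule permutes_eq_iff[OF w(1)])
  have iso: "w i < w j \<longleftrightarrow> g i < g j" if "i \<in> {k..n}" "j \<in> {k..n}" for i j
    using w(2) that by (auto simp: order_iso_def)
  have step: "Suc (w j) = w i" if "(i, j) \<in> P" for i j
  proof (rule ccontr)
    assume "Suc (w j) \<noteq> w i"
    have ij: "adj_inv n k g i j" using P(2)[OF that] .
    then have "w j < w i" using iso[of j i] by (auto simp: adj_inv_def)
    with \<open>Suc (w j) \<noteq> w i\<close> have lt: "Suc (w j) < w i" by simp
    have "w i \<in> {k..n}" "w j \<in> {k..n}"
      using ij permutes_in_image[OF w(1), of i] permutes_in_image[OF w(1), of j]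
      by (auto simp: adj_inv_def)
    then have "Suc (w j) \<in> w ` {k..n}" using lt permutes_image[OF w(1)] by auto
    then obtain l where l: "l \<in> {k..n}" "w l = Suc (w j)" by auto
    then have "w j < w l" "w l < w i" using lt by auto
    then have g: "g j < g l" "g l < g i" using iso[of j l] iso[of l i] l ij by (auto simp: adj_inv_def)
    have "l \<noteq> k" using g(1) ij by (auto simp: adj_inv_def)
    then show False using g ij l(1) by (auto simp: adj_inv_def)
  qed
  have swap: "adj (w j) \<circ> w = w \<circ> transpose i j" if "(i, j) \<in> P" for i j
  proof
    fix x show "(adj (w j) \<circ> w) x = (w \<circ> transpose i j) x"
      using step[OF that] winj[of x i] winj[of x j] by (auto simp: transpose_def)
  qed
  define E where "E = (\<lambda>p. w (snd p)) ` P"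
  have inv: "inv w (w i) = i" for i by (rule permutes_inverses(2)[OF w(1)])
  have E: "k + a \<le> e \<and> e < k + Suc t \<and> inv w (Suc e) < inv w e" if "e \<in> E" for e
  proof -
    from that obtain i j where ij: "(i, j) \<in> P" "e = w j" by (auto simp: E_def)
    have a: "adj_inv n k g i j" using P(2)[OF ij(1)] .
    then have "w k < w j" using iso[of k j] by (auto simp: adj_inv_def)
    moreover have "w i \<in> {k..n}"
      using a permutes_in_image[OF w(1), of i] by (auto simp: adj_inv_def)
    ultimately show ?thesis
      using ij a step[OF ij(1)] wk inv[of i] inv[of j] nk by (auto simp: adj_inv_def)
  qed
  have "w k \<in> {k..n}" using permutes_in_image[OF w(1), of k] \<open>k < n\<close> by auto
  then have at: "a \<le> Suc t" using wk nk by auto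
  have "(\<Sum>e\<in>E. row (var k) k a (Phi (Suc k) t) (adj e \<circ> w)) =
     (\<Sum>p\<in>P. row (var k) k a (Phi (Suc k) t) (adj (w (snd p)) \<circ> w))"
    unfolding E_def by (rule sum.reindex_cong[OF _ refl refl]) (use P(3) winj in \<open>auto simp: inj_on_def\<close>)
  also have "\<dots> = (\<Sum>(i, j)\<in>P. var k ^ a * Q n (Suc k) (g \<circ> transpose i j))"
  proof (rule sum.cong[OF refl], clarsimp)
    fix i j assume ij: "(i, j) \<in> P"
    have A: "adj_inv n k g i j" using P(2)[OF ij] .
    then have range: "i \<in> {Suc k..n}" "j \<in> {Suc k..n}" by (auto simp: adj_inv_def)
    then have tr: "transpose i j ` {k..n} = {k..n}" "transpose i j ` {Suc k..n} = {Suc k..n}"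
      by auto
    let ?g = "g \<circ> transpose i j"
    have inj': "inj_on ?g {k..n}" using inj by (intro comp_inj_on) (simp_all add: tr)
    have trp: "transpose i j permutes {k..n}" using range by (intro permutes_swap_id) auto
    have w': "(w \<circ> transpose i j) permutes {k..n}"
      by (rule permutes_compose[OF trp w(1)])
    have trin: "transpose i j l \<in> {k..n}" if "l \<in> {k..n}" for l
      using that permutes_in_image[OF trp] by blast
    have iso': "order_iso n k (w \<circ> transpose i j) ?g"
      using w(2) trin by (auto simp: order_iso_def)
    have code: "code n ?g k = a"
    proof -
      have "(w \<circ> transpose i j) k = k + code n ?g k" by (rule row_Q(2)[OF inj' \<open>k < n\<close> w' iso' refl])
      moreover have "(w \<circ> transpose i j) k = w k" using range by (simp add: transpose_def)
      ultimately show ?thesis using wk by simp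
    qed
    have "row (var k) k (code n ?g k) (Phi (Suc k) t) (w \<circ> transpose i j) = var k ^ code n ?g k * Q n (Suc k) ?g"
      by (rule row_Q(1)[OF inj' \<open>k < n\<close> w' iso' t_def])
    then show "row (var k) k a (Phi (Suc k) t) (adj (w j) \<circ> w) = var k ^ a * Q n (Suc k) ?g"
      unfolding code swap[OF ij] .
  qed
  finally have S: "var k * (\<Sum>e\<in>E. row (var k) k a (Phi (Suc k) t) (adj e \<circ> w)) =
     (\<Sum>(i, j)\<in>P. var k ^ Suc a * Q n (Suc k) (g \<circ> transpose i j))"
    by (simp add: sum_distrib_left split_def mult.assoc)
  have R: "row (var k) k a (Phi (Suc k) t) w = var k ^ a * Q n (Suc k) g"
    unfolding a_def by (rule row_Q(1)[OF inj \<open>k < n\<close> w t_def])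
  have "nonneg (row (var k) k (Suc t) (Phi (Suc k) t) w -
    (row (var k) k a (Phi (Suc k) t) w +
       var k * (\<Sum>e\<in>E. row (var k) k a (Phi (Suc k) t) (adj e \<circ> w))))"
    by (rule row_ge_swaps[OF nonneg_Phi E at])
  then show ?thesis unfolding Qk S R a_def[symmetric] .
qed

lemma Q_swaps_cf:
  assumes "inj_on g {k..n}" "k < n"
    and "finite P" "\<And>i j. (i, j) \<in> P \<Longrightarrow> adj_inv n k g i j" "inj_on snd P"
  shows "(\<Sum>(i, j)\<in>P. cf (Q n (Suc k) (g \<circ> transpose i j)) m)
    \<le> cf (Q n k g) (m + Poly_Mapping.single k (Suc (code n g k)))"
proof -
  let ?m = "m + Poly_Mapping.single k (Suc (code n g k))"
  have "0 \<le> cf (var k ^ code n g k * Q n (Suc k) g) ?m"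
    using nonneg_var_power_mult[OF nonneg_Q] by (simp add: nonneg_def)
  moreover have "0 \<le> cf (Q n k g - (var k ^ code n g k * Q n (Suc k) g +
    (\<Sum>(i, j)\<in>P. var k ^ Suc (code n g k) * Q n (Suc k) (g \<circ> transpose i j)))) ?m"
    using Q_ge_swaps[OF assms] unfolding nonneg_def by blast
  moreover have "cf (\<Sum>(i, j)\<in>P. var k ^ Suc (code n g k) * Q n (Suc k) (g \<circ> transpose i j)) ?m
      = (\<Sum>(i, j)\<in>P. cf (Q n (Suc k) (g \<circ> transpose i j)) m)"
    by (simp add: lookup_sum split_def del: power_Suc)
  ultimately show ?thesis by (simp add: lookup_add lookup_minus del: power_Suc)
qed

lemma Q_swap_cf:
  assumes "inj_on g {k..n}" "adj_inv n k g i j"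
  shows "cf (Q n (Suc k) (g \<circ> transpose i j)) m
    \<le> cf (Q n k g) (m + Poly_Mapping.single k (Suc (code n g k)))"
  using Q_swaps_cf[of g k n "{(i, j)}" m] assms by (auto simp: adj_inv_def)

lemma Q_two_swaps_cf:
  assumes "inj_on g {k..n}" "adj_inv n k g i j" "adj_inv n k g i' j'" "j \<noteq> j'"
  shows "cf (Q n (Suc k) (g \<circ> transpose i j)) m + cf (Q n (Suc k) (g \<circ> transpose i' j')) m
    \<le> cf (Q n k g) (m + Poly_Mapping.single k (Suc (code n g k)))"
  using Q_swaps_cf[of g k n "{(i, j), (i', j')}" m] assms by (auto simp: adj_inv_def)

lemma Q_drop_cf:
  assumes "inj_on g {k..n}" "k < n"
  shows "cf (Q n (Suc k) g) m \<le> cf (Q n k g) (m + Poly_Mapping.single k (code n g k))"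
proof -
  have "0 \<le> cf (Q n k g - var k ^ code n g k * Q n (Suc k) g) (m + Poly_Mapping.single k (code n g k))"
    using Q_ge_swaps[OF assms, of "{}"] by (simp add: nonneg_def)
  then show ?thesis by (simp add: lookup_minus)
qed

text \<open>The exponents collected by the rows \<open>k, ..., q - 1\<close> if each performs only
  its forced part.\<close>

definition codes :: "nat \<Rightarrow> nat \<Rightarrow> nat \<Rightarrow> (nat \<Rightarrow> nat) \<Rightarrow> (nat \<Rightarrow>\<^sub>0 nat)" where
  "codes n k q g = (\<Sum>l\<in>{k..<q}. Poly_Mapping.single l (code n g l))"

lemma codes_same [simp]: "codes n k k g = 0"
  by (simp add: codes_def)

lemma codes_first: "k < q \<Longrightarrow> codes n k q g = Poly_Mapping.single k (code n g k) + codes n (Suc k) q g"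
  by (simp add: codes_def sum.atLeast_Suc_lessThan)

lemma codes_last: "k \<le> q \<Longrightarrow> codes n k (Suc q) g = codes n k q g + Poly_Mapping.single q (code n g q)"
  by (simp add: codes_def)

lemma codes_cong:
  "(\<And>l. k \<le> l \<Longrightarrow> l < q \<Longrightarrow> code n g l = code n h l) \<Longrightarrow> codes n k q g = codes n k q h"
  unfolding codes_def by (rule sum.cong) auto

lemma Q_drop_many_cf:
  assumes "inj_on g {k..n}" "k \<le> q" "q \<le> n"
  shows "cf (Q n q g) m \<le> cf (Q n k g) (m + codes n k q g)"
  using assms
proof (induction "q - k" arbitrary: k m)
  case (Suc d)
  have inj: "inj_on g {Suc k..n}" by (rule inj_on_subset[OF Suc.prems(1)]) auto
  have "cf (Q n q g) m \<le> cf (Q n (Suc k) g) (m + codes n (Suc k) q g)"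
    using Suc inj by (intro Suc.hyps(1)) auto
  also have "\<dots> \<le> cf (Q n k g) (m + codes n (Suc k) q g + Poly_Mapping.single k (code n g k))"
    using Suc by (intro Q_drop_cf) auto
  also have "m + codes n (Suc k) q g + Poly_Mapping.single k (code n g k) = m + codes n k q g"
    using Suc by (simp add: codes_first[of k] add_ac)
  finally show ?case .
qed simp

definition multiple :: "ipoly \<Rightarrow> bool" where
  "multiple f \<longleftrightarrow> (\<exists>m. 2 \<le> cf f m)"

lemma multiple_Q_drop_many:
  assumes "multiple (Q n q g)" "inj_on g {k..n}" "k \<le> q" "q \<le> n"
  shows "multiple (Q n k g)"
  using assms(1) Q_drop_many_cf[OF assms(2-4)] unfolding multiple_def by (meson order_trans)

lemma Q_pos:
  assumes "inj_on g {k..n}" "k \<le> n"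
  shows "\<exists>m. 1 \<le> cf (Q n k g) m"
  using Q_drop_many_cf[OF assms(1) assms(2) order_refl, of 0] by (auto simp: Q_last)

lemma inj_on_swap:
  assumes "inj_on g {k..n}" "i \<in> {k..n}" "j \<in> {k..n}"
  shows "inj_on (g \<circ> transpose i j) {k..n}"
  using assms by (intro comp_inj_on) simp_all

lemma card_permutes_filter:
  assumes "p permutes S"
  shows "card {x \<in> S. P (p x)} = card {x \<in> S. P x}"
proof -
  have "p ` {x \<in> S. P (p x)} = {x \<in> p ` S. P x}" by auto
  then have "p ` {x \<in> S. P (p x)} = {x \<in> S. P x}" by (simp add: permutes_image[OF assms])
  then show ?thesis by (metis card_image permutes_inj_on[OF assms])
qed

lemma code_swap:
  assumes "l < i" "l < j" "i \<le> n" "j \<le> n"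
  shows "code n (g \<circ> transpose i j) l = code n g l"
proof -
  have "transpose i j permutes {Suc l..n}" using assms by (intro permutes_swap_id) auto
  moreover have "transpose i j l = l" using assms by (intro transpose_apply_other) auto
  ultimately show ?thesis
    unfolding code_def using card_permutes_filter[of "transpose i j" "{Suc l..n}" "\<lambda>x. g x < g l"]
    by simp
qed

text \<open>The loss of one in the code at \<open>i\<close> is what a later extra exchange in row
  \<open>i\<close> can make up for; equal weights of different exchange sequences arise in this
  way.\<close>

lemma code_swap_adjacent:
  assumes "i < j" "j \<le> n" "g j < g i" "\<And>l. l \<in> {Suc i..n} \<Longrightarrow> \<not> (g j < g l \<and> g l < g i)"
    "inj_on g {i..n}"
  shows "code n g i = Suc (code n (g \<circ> transpose i j) i)"
proof -
  have "{l \<in> {Suc i..n}. g l < g i} = insert j {l \<in> {Suc i..n}. (g \<circ> transpose i j) l < g j}"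
    (is "?A = insert j ?B")
  proof -
    have "g l < g j \<longleftrightarrow> g l < g i" if "l \<in> {Suc i..n}" "l \<noteq> j" for l
    proof -
      have "g l \<noteq> g j" using that assms inj_onD[OF assms(5), of l j] by auto
      then show ?thesis using assms(4)[OF that(1)] assms(3) by linarith
    qed
    then show ?thesis using assms(1-3) by (auto simp: transpose_def)
  qed
  moreover have "j \<notin> ?B" using assms(1,3) by (simp add: transpose_def)
  ultimately show ?thesis unfolding code_def by simp
qed

text \<open>\<open>adj_inv\<close> without the comparison with \<open>g k\<close>, which the
  intermediate rows in \<open>chain_swap\<close> need not satisfy.\<close>

definition adj_pair :: "nat \<Rightarrow> nat \<Rightarrow> (nat \<Rightarrow> nat) \<Rightarrow> nat \<Rightarrow> nat \<Rightarrow> bool" where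
  "adj_pair n k g i j \<longleftrightarrow> k < i \<and> i < j \<and> j \<le> n \<and> g j < g i \<and>
     (\<forall>l\<in>{Suc k..n}. \<not> (g j < g l \<and> g l < g i))"

lemma adj_inv_iff: "adj_inv n k g i j \<longleftrightarrow> adj_pair n k g i j \<and> g k < g j"
  by (auto simp: adj_inv_def adj_pair_def)

text \<open>If the values between \<open>g j\<close> and \<open>g i\<close> all sit at positions up to \<open>q\<close>, then the swap of
  positions \<open>i\<close> and \<open>j\<close>, which is available only once the rows up to \<open>q\<close> have been
  removed, can be distributed over these rows without changing their contribution.\<close>

lemma chain_swap:
  assumes "inj_on g {k..n}" "k \<le> q" "q < i" "i < j" "j \<le> n" "g j < g i"
    and "\<And>l. l \<in> {Suc k..n} \<Longrightarrow> g j < g l \<Longrightarrow> g l < g i \<Longrightarrow> l \<le> q"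
  shows "\<exists>i0. adj_pair n k g i0 j \<and> (\<forall>m. cf (Q n (Suc q) (g \<circ> transpose i j)) m
    \<le> cf (Q n (Suc k) (g \<circ> transpose i0 j)) (m + codes n (Suc k) (Suc q) g))"
  using assms
proof (induction "q - k" arbitrary: k)
  case 0
  then have "k = q" by simp
  have "\<not> (g j < g l \<and> g l < g i)" if "l \<in> {Suc k..n}" for l
    using 0(8)[OF that] that \<open>k = q\<close> by fastforce
  then have "adj_pair n k g i j" using 0 \<open>k = q\<close> by (simp add: adj_pair_def)
  then show ?case using \<open>k = q\<close> by (intro exI[of _ i]) simp
next
  case (Suc d)
  have kq: "Suc k \<le> q" using Suc.hyps(2) by simp
  have inj: "inj_on g {Suc k..n}" by (rule inj_on_subset[OF Suc.prems(1)]) auto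
  have "\<exists>i0. adj_pair n (Suc k) g i0 j \<and> (\<forall>m. cf (Q n (Suc q) (g \<circ> transpose i j)) m
    \<le> cf (Q n (Suc (Suc k)) (g \<circ> transpose i0 j)) (m + codes n (Suc (Suc k)) (Suc q) g))"
    using Suc.hyps(2) Suc.prems kq inj by (intro Suc.hyps(1)) auto
  then obtain i1 where i1: "adj_pair n (Suc k) g i1 j" and
    le: "\<And>m. cf (Q n (Suc q) (g \<circ> transpose i j)) m
    \<le> cf (Q n (Suc (Suc k)) (g \<circ> transpose i1 j)) (m + codes n (Suc (Suc k)) (Suc q) g)" by blast
  have cs: "codes n (Suc k) (Suc q) g =
      Poly_Mapping.single (Suc k) (code n g (Suc k)) + codes n (Suc (Suc k)) (Suc q) g"
    using kq by (intro codes_first) simp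
  show ?case
  proof (cases "g j < g (Suc k) \<and> g (Suc k) < g i1")
    case False
    have "l = Suc k \<or> l \<in> {Suc (Suc k)..n}" if "l \<in> {Suc k..n}" for l using that by auto
    then have a: "adj_pair n k g i1 j" using i1 False by (fastforce simp: adj_pair_def)
    have r: "Suc k < i1" "i1 < j" "j \<le> n" using i1 by (auto simp: adj_pair_def)
    have c: "code n (g \<circ> transpose i1 j) (Suc k) = code n g (Suc k)"
      using r by (intro code_swap) auto
    have h: "cf (Q n (Suc (Suc k)) (g \<circ> transpose i1 j)) m
      \<le> cf (Q n (Suc k) (g \<circ> transpose i1 j)) (m + Poly_Mapping.single (Suc k) (code n g (Suc k)))" for m
      unfolding c[symmetric] using r inj by (intro Q_drop_cf inj_on_swap) auto
    then have "cf (Q n (Suc q) (g \<circ> transpose i j)) m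
      \<le> cf (Q n (Suc k) (g \<circ> transpose i1 j)) (m + codes n (Suc k) (Suc q) g)" for m
      unfolding cs using order_trans[OF le[of m] h[of "m + codes n (Suc (Suc k)) (Suc q) g"]]
      by (simp add: add_ac)
    then show ?thesis using a by blast
  next
    case True
    \<comment> \<open>The letter at \<open>k + 1\<close> has a value inside the gap and takes over
      the role of \<open>i1\<close>: row \<open>k\<close> exchanges \<open>k + 1\<close> with
      \<open>j\<close>, which lowers the code at \<open>k + 1\<close> by one, and row
      \<open>k + 1\<close> then exchanges \<open>i1\<close> with \<open>j\<close>, which restores
      the weight.\<close>
    have r: "Suc k < i1" "i1 < j" "j \<le> n" "g j < g i1"
      and btw: "\<And>l. l \<in> {Suc (Suc k)..n} \<Longrightarrow> \<not> (g j < g l \<and> g l < g i1)"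
      using i1 by (auto simp: adj_pair_def)
    have btw': "\<not> (g j < g l \<and> g l < g (Suc k))" if "l \<in> {Suc k..n}" for l
      using that btw[of l] True by (cases "l = Suc k") auto
    then have a: "adj_pair n k g (Suc k) j" using r True by (auto simp: adj_pair_def)
    let ?g = "g \<circ> transpose (Suc k) j"
    have "adj_inv n (Suc k) ?g i1 j"
      unfolding adj_inv_def
    proof (intro conjI ballI)
      fix l assume l: "l \<in> {Suc (Suc k)..n}"
      show "\<not> (?g j < ?g l \<and> ?g l < ?g i1)"
        using btw[OF l] l r True by (cases "l = j") auto
    qed (use r True in auto)
    then have "cf (Q n (Suc (Suc k)) (?g \<circ> transpose i1 j)) m
      \<le> cf (Q n (Suc k) ?g) (m + Poly_Mapping.single (Suc k) (Suc (code n ?g (Suc k))))" for m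
      using r inj by (intro Q_swap_cf inj_on_swap) auto
    moreover have "Suc (code n ?g (Suc k)) = code n g (Suc k)"
      using r True btw' inj by (intro code_swap_adjacent[symmetric]) auto
    \<comment> \<open>The words differ only at \<open>i1\<close>, with value
      \<open>g (Suc k)\<close> instead of \<open>g j\<close>; no later letter lies between these two
      values.\<close>
    moreover have "Q n (Suc (Suc k)) (?g \<circ> transpose i1 j) = Q n (Suc (Suc k)) (g \<circ> transpose i1 j)"
    proof (rule Q_cong, unfold order_iso_def, intro ballI)
      let ?h = "?g \<circ> transpose i1 j" and ?f = "g \<circ> transpose i1 j"
      have h: "?h x = (if x = i1 then g (Suc k) else ?f x)" if "x \<in> {Suc (Suc k)..n}" for x
        using that r by (auto simp: transpose_def)
      have cmp: "(g (Suc k) < ?f x \<longleftrightarrow> g j < ?f x) \<and> (?f x < g (Suc k) \<longleftrightarrow> ?f x < g j)"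
        if x: "x \<in> {Suc (Suc k)..n}" "x \<noteq> i1" for x
      proof -
        have y: "transpose i1 j x \<in> {Suc (Suc k)..n}" "transpose i1 j x \<noteq> j"
          using x r by (auto simp: transpose_def)
        then have "g (transpose i1 j x) \<noteq> g j" using inj_onD[OF inj, of "transpose i1 j x" j] r by auto
        then show ?thesis using btw[OF y(1)] True by auto
      qed
      fix x y assume "x \<in> {Suc (Suc k)..n}" "y \<in> {Suc (Suc k)..n}"
      then show "?h x < ?h y \<longleftrightarrow> ?f x < ?f y"
        using h cmp r by (cases "x = i1"; cases "y = i1") auto
    qed
    ultimately have h: "cf (Q n (Suc (Suc k)) (g \<circ> transpose i1 j)) m
      \<le> cf (Q n (Suc k) ?g) (m + Poly_Mapping.single (Suc k) (code n g (Suc k)))" for m by metis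
    then have "cf (Q n (Suc q) (g \<circ> transpose i j)) m
      \<le> cf (Q n (Suc k) ?g) (m + codes n (Suc k) (Suc q) g)" for m
      unfolding cs using order_trans[OF le[of m] h[of "m + codes n (Suc (Suc k)) (Suc q) g"]]
      by (simp add: add_ac)
    then show ?thesis using a by blast
  qed
qed

section \<open>Configurations forcing a coefficient of at least two\<close>

text \<open>\<open>cfgI\<close> unites 13254, 13524 and 13542, where the place of the letter 2 relative to 5 and 4 is
  irrelevant; \<open>cfgD\<close> unites 12543 and 21543. \<open>cfgA\<close> covers the patterns of length six: the order of
  the two values at \<open>p\<close> and \<open>q\<close> and the place of \<open>c\<close> are left open as far as possible, and the
  additional cases contain a pattern of length five.\<close>

definition cfgI :: "nat \<Rightarrow> (nat \<Rightarrow> nat) \<Rightarrow> nat \<Rightarrow> nat \<Rightarrow> nat \<Rightarrow> nat \<Rightarrow> nat \<Rightarrow> bool" where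
  "cfgI n g p b a d c \<longleftrightarrow> p < b \<and> b < a \<and> a \<le> n \<and> b < d \<and> d < c \<and> c \<le> n \<and>
     g p < g a \<and> g a < g b \<and> g b < g c \<and> g c < g d"

definition cfgD :: "nat \<Rightarrow> (nat \<Rightarrow> nat) \<Rightarrow> nat \<Rightarrow> nat \<Rightarrow> nat \<Rightarrow> nat \<Rightarrow> nat \<Rightarrow> bool" where
  "cfgD n g p q r s t \<longleftrightarrow> p < q \<and> q < r \<and> r < s \<and> s < t \<and> t \<le> n \<and>
     g p < g t \<and> g q < g t \<and> g t < g s \<and> g s < g r"

definition cfgA :: "nat \<Rightarrow> (nat \<Rightarrow> nat) \<Rightarrow> nat \<Rightarrow> nat \<Rightarrow> nat \<Rightarrow> nat \<Rightarrow> nat \<Rightarrow> nat \<Rightarrow> bool" where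
  "cfgA n g p q r s d c \<longleftrightarrow> p < q \<and> q < r \<and> r < s \<and> s < d \<and> d \<le> n \<and> r < c \<and> c \<le> n \<and>
     g p < g d \<and> g q < g c \<and> g c < g d \<and> g d < g r \<and> g r < g s"

text \<open>A letter with value inside the gap forms a narrower inversion with \<open>c\<close> or
  with \<open>d\<close>, depending on its position, and its value still exceeds
  \<open>v\<close>.\<close>

lemma adjacent_inversion:
  fixes g :: "nat \<Rightarrow> nat"
  assumes "b < d" "d < c" "c \<le> n" "v < g c" "g c < g d"
  shows "\<exists>d c. b < d \<and> d < c \<and> c \<le> n \<and> v < g c \<and> g c < g d \<and>
    (\<forall>l\<in>{Suc b..n}. \<not> (g c < g l \<and> g l < g d))"
  using assms
proof (induction "g d - g c" arbitrary: c d rule: less_induct)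
  case less
  show ?case
  proof (cases "\<exists>l\<in>{Suc b..n}. g c < g l \<and> g l < g d")
    case False
    then show ?thesis using less.prems by blast
  next
    case True
    then obtain l where l: "b < l" "l \<le> n" "g c < g l" "g l < g d" by (auto simp: Suc_le_eq)
    show ?thesis
    proof (cases "l < c")
      case True
      then show ?thesis using less.hyps[of l c] less.prems l by simp
    next
      case False
      then show ?thesis using less.hyps[of d l] less.prems l by simp
    qed
  qed
qed

lemma max_below:
  fixes g :: "nat \<Rightarrow> nat"
  assumes "b < a" "a \<le> n" "g a < u"
  shows "\<exists>a'. b < a' \<and> a' \<le> n \<and> g a \<le> g a' \<and> g a' < u \<and> (\<forall>l\<in>{Suc b..n}. \<not> (g a' < g l \<and> g l < u))"
proof -
  let ?S = "{l \<in> {Suc b..n}. g l < u}"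
  have "a \<in> ?S" using assms by simp
  moreover have "finite (g ` ?S)" by simp
  ultimately have "Max (g ` ?S) \<in> g ` ?S" by (intro Max_in) blast+
  then obtain a' where a': "Max (g ` ?S) = g a'" "a' \<in> ?S" by (rule imageE)
  moreover have "g l \<le> Max (g ` ?S)" if "l \<in> ?S" for l using that by simp
  ultimately show ?thesis
    using \<open>a \<in> ?S\<close> by (intro exI[of _ a']) (auto simp: Suc_le_eq not_less)
qed

text \<open>The two ways to reach the same weight: exchange \<open>b\<close> with the next smaller letter in row \<open>k\<close> and
  \<open>d\<close> with \<open>c\<close> in row \<open>b\<close>, or start the exchange of \<open>d\<close> and \<open>c\<close> already in row \<open>k\<close>.\<close>

lemma cfgI_multiple_aux:
  assumes inj: "inj_on g {k..n}" and "cfgI n g k b0 a0 d0 c0"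
  shows "multiple (Q n k g)"
proof -
  \<comment> \<open>With \<open>b\<close> leftmost, no letter between \<open>k\<close> and
    \<open>b\<close> has a value between \<open>g a\<close> and \<open>g b\<close>, since it could
    replace \<open>b\<close>. This makes the exchange of \<open>b\<close> and \<open>a\<close>
    available in row \<open>k\<close>.\<close>
  define b where "b = (LEAST b. \<exists>a d c. cfgI n g k b a d c)"
  have "\<exists>a d c. cfgI n g k b a d c"
    unfolding b_def by (rule LeastI) (use assms(2) in blast)
  then obtain a1 d1 c1 where 1: "cfgI n g k b a1 d1 c1" by blast
  have least: "b \<le> b'" if "cfgI n g k b' a d c" for b' a d c
    unfolding b_def using that by (blast intro: Least_le)
  from 1 obtain a where a: "b < a" "a \<le> n" "g a1 \<le> g a" "g a < g b"
    and a_max: "\<And>l. l \<in> {Suc b..n} \<Longrightarrow> \<not> (g a < g l \<and> g l < g b)"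
    using max_below[of b a1 n g "g b"] unfolding cfgI_def by blast
  from 1 obtain d c where dc: "b < d" "d < c" "c \<le> n" "g b < g c" "g c < g d"
    and dc_adj: "\<And>l. l \<in> {Suc b..n} \<Longrightarrow> \<not> (g c < g l \<and> g l < g d)"
    using adjacent_inversion[of b d1 c1 n "g b" g] unfolding cfgI_def by blast
  have kb: "k < b" "g k < g a" using 1 a unfolding cfgI_def by auto
  have ba: "adj_inv n k g b a"
    unfolding adj_inv_def
  proof (intro conjI ballI notI; (elim conjE)?)
    fix l assume l: "l \<in> {Suc k..n}" "g a < g l" "g l < g b"
    show False
    proof (cases "b < l")
      case True
      then show ?thesis using a_max[of l] l by auto
    next
      case False
      moreover have "l \<noteq> b" using l by auto
      ultimately have "l < b" by simp
      then have "cfgI n g k l a d c" using l a dc kb by (simp add: cfgI_def)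
      from least[OF this] \<open>l < b\<close> show ?thesis by simp
    qed
  qed (use kb a in auto)
  have dist: "d \<noteq> a" "c \<noteq> a" using dc a by auto
  let ?M = "\<lambda>m. m + codes n (Suc k) (Suc b) g"
  have inj': "inj_on g {Suc k..n}" "inj_on g {b..n}" by (rule inj_on_subset[OF inj]; use kb in auto)+
  obtain i0 where i0: "adj_pair n k g i0 c" and
    path2: "\<And>m. cf (Q n (Suc b) (g \<circ> transpose d c)) m \<le> cf (Q n (Suc k) (g \<circ> transpose i0 c)) (?M m)"
  proof -
    have "\<exists>i0. adj_pair n k g i0 c \<and> (\<forall>m. cf (Q n (Suc b) (g \<circ> transpose d c)) m
      \<le> cf (Q n (Suc k) (g \<circ> transpose i0 c)) (m + codes n (Suc k) (Suc b) g))"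
      using inj kb dc dc_adj by (intro chain_swap) (auto simp: not_le Suc_le_eq intro: leI)
    then show ?thesis using that by blast
  qed
  let ?g = "g \<circ> transpose b a"
  have path1: "cf (Q n (Suc b) (g \<circ> transpose d c)) m \<le> cf (Q n (Suc k) ?g) (?M m)" for m
  proof -
    have "Q n (Suc b) (?g \<circ> transpose d c) = Q n (Suc b) (g \<circ> transpose d c)"
    proof (rule Q_cong, unfold order_iso_def, intro ballI)
      let ?h = "?g \<circ> transpose d c" and ?f = "g \<circ> transpose d c"
      have h: "?h x = (if x = a then g b else ?f x)" if "x \<in> {Suc b..n}" for x
        using that dist dc by (auto simp: transpose_def)
      have cmp: "(g b < ?f x \<longleftrightarrow> ?f a < ?f x) \<and> (?f x < g b \<longleftrightarrow> ?f x < ?f a)"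
        if x: "x \<in> {Suc b..n}" "x \<noteq> a" for x
      proof -
        have y: "transpose d c x \<in> {Suc b..n}" "transpose d c x \<noteq> a" "?f a = g a"
          using x dc dist by (auto simp: transpose_def)
        then have "g (transpose d c x) \<noteq> g a" "g (transpose d c x) \<noteq> g b"
          using inj_onD[OF inj'(2), of "transpose d c x"] a by auto
        then show ?thesis using a_max[OF y(1)] y(3) a by auto
      qed
      fix x y assume "x \<in> {Suc b..n}" "y \<in> {Suc b..n}"
      then show "?h x < ?h y \<longleftrightarrow> ?f x < ?f y"
        using h cmp by (cases "x = a"; cases "y = a") auto
    qed
    moreover have "adj_inv n b ?g d c"
      unfolding adj_inv_def
    proof (intro conjI ballI)
      fix l assume l: "l \<in> {Suc b..n}"
      show "\<not> (?g c < ?g l \<and> ?g l < ?g d)"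
        using dc_adj[OF l] l dist dc by (cases "l = a") auto
    qed (use dc dist a in auto)
    then have "cf (Q n (Suc b) (?g \<circ> transpose d c)) m
      \<le> cf (Q n b ?g) (m + Poly_Mapping.single b (Suc (code n ?g b)))"
      using inj'(2) a by (intro Q_swap_cf inj_on_swap) auto
    \<comment> \<open>The exchange of \<open>b\<close> and \<open>a\<close> costs one exponent at
      \<open>b\<close>, which the exchange of \<open>d\<close> and \<open>c\<close> in row
      \<open>b\<close> returns; both paths thus end with the same monomial.\<close>
    moreover have "Suc (code n ?g b) = code n g b"
      using a a_max inj'(2) by (intro code_swap_adjacent[symmetric]) auto
    moreover have "cf (Q n b ?g) m \<le> cf (Q n (Suc k) ?g) (m + codes n (Suc k) b ?g)" for m
      using inj'(1) kb a by (intro Q_drop_many_cf inj_on_swap) auto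
    moreover have "codes n (Suc k) b ?g = codes n (Suc k) b g"
      using a by (intro codes_cong code_swap) auto
    moreover have "m + codes n (Suc k) (Suc b) g
       = m + Poly_Mapping.single b (code n g b) + codes n (Suc k) b g"
      using kb by (simp add: codes_last add_ac)
    ultimately have "cf (Q n (Suc b) (g \<circ> transpose d c)) m
        \<le> cf (Q n b ?g) (m + Poly_Mapping.single b (code n g b))"
      and "cf (Q n b ?g) (m + Poly_Mapping.single b (code n g b)) \<le> cf (Q n (Suc k) ?g) (?M m)"
      by metis+
    then show ?thesis by (rule order_trans)
  qed
  obtain m where m: "1 \<le> cf (Q n (Suc b) (g \<circ> transpose d c)) m"
    using Q_pos[of "g \<circ> transpose d c" "Suc b" n] inj_on_swap[of g "Suc b" n d c]
      inj_on_subset[OF inj'(2), of "{Suc b..n}"] dc by fastforce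
  have "adj_inv n k g i0 c" using i0 kb a dc by (simp add: adj_inv_iff)
  then have "cf (Q n (Suc k) ?g) (?M m) + cf (Q n (Suc k) (g \<circ> transpose i0 c)) (?M m)
      \<le> cf (Q n k g) (?M m + Poly_Mapping.single k (Suc (code n g k)))"
    using dist by (intro Q_two_swaps_cf inj ba) auto
  then show ?thesis using m path1[of m] path2[of m] unfolding multiple_def
    by (intro exI[of _ "?M m + Poly_Mapping.single k (Suc (code n g k))"]) linarith
qed

lemma cfgI_multiple:
  assumes inj: "inj_on g {k..n}" and "cfgI n g p b a d c" "k \<le> p"
  shows "multiple (Q n k g)"
proof (rule multiple_Q_drop_many[OF _ inj])
  have "inj_on g {p..n}" by (rule inj_on_subset[OF inj]) (use assms in auto)
  then show "multiple (Q n p g)" by (rule cfgI_multiple_aux) (rule assms(2))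
qed (use assms in \<open>auto simp: cfgI_def\<close>)

text \<open>Two exchanges are performed in the rows \<open>k\<close> and \<open>q\<close>. If they involve disjoint pairs of
  letters, they can be performed in either order; otherwise three consecutive values are
  sorted by the two sides of a braid relation.\<close>

lemma cfgD_multiple_aux:
  assumes inj: "inj_on g {k..n}" and "cfgD n g k q r0 s0 t0"
    and noI: "\<And>p b a d c. k \<le> p \<Longrightarrow> \<not> cfgI n g p b a d c"
  shows "multiple (Q n k g)"
proof -
  \<comment> \<open>\<open>r\<close> and then \<open>s\<close> are leftmost, \<open>t\<close> and
    \<open>y\<close> have the largest possible values below \<open>g s\<close> and
    \<open>g r\<close>. From position \<open>q\<close> on, the pairs \<open>(s, t)\<close> and
    \<open>(r, y)\<close> are then consecutive in value: a letter in between would give an earlier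
    \<open>r\<close> or \<open>s\<close>, or a \<open>cfgI\<close>.\<close>
  let ?P = "\<lambda>r. \<exists>s t. cfgD n g k q r s t"
  define r where "r = (LEAST r. ?P r)"
  have "?P r" unfolding r_def by (rule LeastI[of ?P r0]) (use assms(2) in blast)
  have r_least: "r \<le> r'" if "cfgD n g k q r' s t" for r' s t
    unfolding r_def using that by (blast intro: Least_le)
  let ?P' = "\<lambda>s. \<exists>t. cfgD n g k q r s t"
  define s where "s = (LEAST s. ?P' s)"
  have "?P' s" unfolding s_def by (rule LeastI_ex) (rule \<open>?P r\<close>)
  have s_least: "s \<le> s'" if "cfgD n g k q r s' t" for s' t
    unfolding s_def using that by (blast intro: Least_le)
  from \<open>?P' s\<close> obtain t1 where t1: "cfgD n g k q r s t1" by blast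
  obtain t where t: "s < t" "t \<le> n" "g t1 \<le> g t" "g t < g s"
    and t_max: "\<And>l. l \<in> {Suc s..n} \<Longrightarrow> \<not> (g t < g l \<and> g l < g s)"
    using max_below[of s t1 n g "g s"] t1 unfolding cfgD_def by blast
  have o: "k < q" "q < r" "r < s" "g k < g t" "g q < g t" "g s < g r"
    using t1 t unfolding cfgD_def by auto
  obtain y where y: "r < y" "y \<le> n" "g s \<le> g y" "g y < g r"
    and y_max: "\<And>l. l \<in> {Suc r..n} \<Longrightarrow> \<not> (g y < g l \<and> g l < g r)"
    using max_below[of r s n g "g r"] o t by auto
  have st: False if h: "l \<in> {q..n}" "g t < g l" "g l < g s" for l
  proof -
    consider "l = q" | "q < l" "l < r" | "l = r" | "r < l" "l < s" | "l = s" | "l \<in> {Suc s..n}"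
      using h(1) by fastforce
    then show False
    proof cases
      case 2
      then have "cfgI n g k l t r s" using o t h by (simp add: cfgI_def)
      then show ?thesis using noI by blast
    next
      case 4
      then have "cfgD n g k q r l t" using o t h by (simp add: cfgD_def)
      from s_least[OF this] 4 show ?thesis by simp
    qed (use o h t_max in auto)
  qed
  have ry: False if h: "l \<in> {q..n}" "g y < g l" "g l < g r" for l
  proof -
    consider "l = q" | "q < l" "l < r" | "l = r" | "l \<in> {Suc r..n}"
      using h(1) by fastforce
    then show False
    proof cases
      case 2
      then have "cfgD n g k q l s t" using o t y h by (simp add: cfgD_def)
      from r_least[OF this] 2 show ?thesis by simp
    qed (use o t y h y_max in auto)
  qed
  \<comment> \<open>\<open>chain_swap\<close> passes the rows up to and including its parameter,
    while row \<open>q\<close> must still be available for the second exchange.\<close>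
  define q' where "q' = q - 1"
  have q': "k \<le> q'" "Suc q' = q" using o by (auto simp: q'_def)
  let ?M = "\<lambda>m. m + codes n (Suc k) q g"
  have st': "l \<le> q'" if h: "l \<in> {Suc k..n}" "g t < g l" "g l < g s" for l
  proof (rule ccontr)
    assume "\<not> l \<le> q'"
    then have "l \<in> {q..n}" using h(1) q' by auto
    then show False by (rule st[OF _ h(2,3)])
  qed
  have "\<exists>i0. adj_pair n k g i0 t \<and> (\<forall>m. cf (Q n (Suc q') (g \<circ> transpose s t)) m
      \<le> cf (Q n (Suc k) (g \<circ> transpose i0 t)) (m + codes n (Suc k) (Suc q') g))"
    using inj o t q' st' by (intro chain_swap) auto
  then obtain i1 where i1: "adj_pair n k g i1 t" and
    path1: "\<And>m. cf (Q n q (g \<circ> transpose s t)) m \<le> cf (Q n (Suc k) (g \<circ> transpose i1 t)) (?M m)"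
    unfolding q' by blast
  have ry': "l \<le> q'" if h: "l \<in> {Suc k..n}" "g y < g l" "g l < g r" for l
  proof (rule ccontr)
    assume "\<not> l \<le> q'"
    then have "l \<in> {q..n}" using h(1) q' by auto
    then show False by (rule ry[OF _ h(2,3)])
  qed
  have "\<exists>i0. adj_pair n k g i0 y \<and> (\<forall>m. cf (Q n (Suc q') (g \<circ> transpose r y)) m
      \<le> cf (Q n (Suc k) (g \<circ> transpose i0 y)) (m + codes n (Suc k) (Suc q') g))"
    using inj o y q' ry' by (intro chain_swap) auto
  then obtain i2 where i2: "adj_pair n k g i2 y" and
    path2: "\<And>m. cf (Q n q (g \<circ> transpose r y)) m \<le> cf (Q n (Suc k) (g \<circ> transpose i2 y)) (?M m)"
    unfolding q' by blast
  have ai: "adj_inv n k g i1 t" "adj_inv n k g i2 y" "t \<noteq> y"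
    using i1 i2 o t y by (auto simp: adj_inv_iff)
  have injq: "inj_on g {q..n}" by (rule inj_on_subset[OF inj]) (use o in auto)
  have inj_sw: "inj_on (g \<circ> transpose i j) {q..n}" if "i \<in> {q..n}" "j \<in> {q..n}" for i j
    by (rule inj_on_swap[OF injq that])
  have code_q: "code n (g \<circ> transpose i j) q = code n g q" if "q < i" "q < j" "i \<le> n" "j \<le> n" for i j
    using that by (intro code_swap) auto
  have neq: "r \<noteq> y" "s \<noteq> t" "r \<noteq> s" "r \<noteq> t" using o t y by auto
  have common: "\<exists>m. 1 \<le> cf (Q n q (g \<circ> transpose s t)) m \<and> 1 \<le> cf (Q n q (g \<circ> transpose r y)) m"
  proof (cases "y = s")
    case False
    \<comment> \<open>Disjoint pairs: row \<open>q\<close> performs whichever exchange row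
      \<open>k\<close> did not start, and the results coincide.\<close>
    have dist: "y \<noteq> s" "y \<noteq> t" using False ai by auto
    let ?g1 = "g \<circ> transpose s t" and ?g2 = "g \<circ> transpose r y"
    let ?g12 = "?g1 \<circ> transpose r y"
    have eq: "?g2 \<circ> transpose s t = ?g12"
      using dist neq by (auto simp: fun_eq_iff transpose_def)
    have 1: "adj_inv n q ?g1 r y"
      unfolding adj_inv_def
    proof (intro conjI ballI)
      fix l assume "l \<in> {Suc q..n}"
      then have "transpose s t l \<in> {q..n}" using o t by (auto simp: transpose_def)
      then show "\<not> (?g1 y < ?g1 l \<and> ?g1 l < ?g1 r)"
        using ry[of "transpose s t l"] dist neq by auto
    qed (use o t y dist neq in auto)
    have 2: "adj_inv n q ?g2 s t"
      unfolding adj_inv_def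
    proof (intro conjI ballI)
      fix l assume "l \<in> {Suc q..n}"
      then have "transpose r y l \<in> {q..n}" using o y by (auto simp: transpose_def)
      then show "\<not> (?g2 t < ?g2 l \<and> ?g2 l < ?g2 s)"
        using st[of "transpose r y l"] dist neq by auto
    qed (use o t y dist neq in auto)
    have inj1: "inj_on ?g1 {q..n}" "inj_on ?g2 {q..n}" using o t y by (auto intro!: inj_sw)
    have "inj_on ?g12 {Suc q..n}"
      by (rule inj_on_subset[OF inj_on_swap[OF inj1(1)]]) (use o y in auto)
    then obtain m where m: "1 \<le> cf (Q n (Suc q) ?g12) m"
      using Q_pos[of ?g12 "Suc q" n] o t by fastforce
    have "cf (Q n (Suc q) ?g12) m \<le> cf (Q n q ?g1) (m + Poly_Mapping.single q (Suc (code n g q)))"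
      using Q_swap_cf[OF inj1(1) 1, of m] code_q[of s t] o t by simp
    moreover have "cf (Q n (Suc q) ?g12) m \<le> cf (Q n q ?g2) (m + Poly_Mapping.single q (Suc (code n g q)))"
      using Q_swap_cf[OF inj1(2) 2, of m] code_q[of r y] o y eq by simp
    ultimately show ?thesis using m by (meson order_trans)
  next
    case True
    \<comment> \<open>The values at \<open>r, s, t\<close> are consecutive and decreasing. Row
      \<open>q\<close> exchanges \<open>r\<close> and \<open>t\<close> in both words. Then
      \<open>h2\<close> has a code smaller by one at \<open>r\<close>, and the exchange of
      \<open>s\<close> and \<open>t\<close> in row \<open>r\<close> restores the weight and, after
      position \<open>r\<close>, the relative order of \<open>h1\<close>.\<close>
    define g1 g2 where g12: "g1 = g \<circ> transpose s t" "g2 = g \<circ> transpose r s"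
    define h1 h2 where h12: "h1 = g1 \<circ> transpose r t" "h2 = g2 \<circ> transpose r t"
    define f where f: "f = h2 \<circ> transpose s t"
    have rs: False if "l \<in> {q..n}" "g s < g l" "g l < g r" for l using ry that True by simp
    have mid: "l = s" if "l \<in> {q..n}" "g t < g l" "g l < g r" for l
    proof -
      have "g l = g s" using st[OF that(1,2)] rs[OF that(1) _ that(3)] by (metis linorder_less_linear)
      then show ?thesis using inj_onD[OF injq _ that(1), of s] o t by auto
    qed
    have v: "g1 r = g r" "g1 s = g t" "g1 t = g s" "g2 r = g s" "g2 s = g r" "g2 t = g t"
      "h1 r = g s" "h1 s = g t" "h1 t = g r" "h2 r = g t" "h2 s = g r" "h2 t = g s"
      "f r = g t" "f s = g s" "f t = g r"
      using neq by (auto simp: g12 h12 f transpose_def)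
    have v': "g1 l = g l" "g2 l = g l" "h1 l = g l" "h2 l = g l" "f l = g l"
      if "l \<noteq> r" "l \<noteq> s" "l \<noteq> t" for l
      using that by (auto simp: g12 h12 f transpose_def)
    have 1: "adj_inv n q g1 r t"
      unfolding adj_inv_def
    proof (intro conjI ballI)
      fix l assume l: "l \<in> {Suc q..n}"
      show "\<not> (g1 t < g1 l \<and> g1 l < g1 r)"
      proof (cases "l = r \<or> l = s \<or> l = t")
        case True
        then show ?thesis using v o t by auto
      next
        case False
        then have "g1 l = g l" using v' by blast
        then show ?thesis using rs[of l] l v o by auto
      qed
    qed (use o t v in \<open>auto simp: v'\<close>)
    have 2: "adj_inv n q g2 r t"
      unfolding adj_inv_def
    proof (intro conjI ballI)
      fix l assume l: "l \<in> {Suc q..n}"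
      show "\<not> (g2 t < g2 l \<and> g2 l < g2 r)"
      proof (cases "l = r \<or> l = s \<or> l = t")
        case True
        then show ?thesis using v o t by auto
      next
        case False
        then have "g2 l = g l" using v' by blast
        then show ?thesis using st[of l] l v o by auto
      qed
    qed (use o t v in \<open>auto simp: v'\<close>)
    have 3: "adj_inv n r h2 s t"
      unfolding adj_inv_def
    proof (intro conjI ballI)
      fix l assume l: "l \<in> {Suc r..n}"
      show "\<not> (h2 t < h2 l \<and> h2 l < h2 s)"
      proof (cases "l = r \<or> l = s \<or> l = t")
        case True
        then show ?thesis using v o t by auto
      next
        case False
        then have "h2 l = g l" using v' by blast
        then show ?thesis using rs[of l] l v o by auto
      qed
    qed (use o t v in auto)
    have in_q: "r \<in> {q..n}" "s \<in> {q..n}" "t \<in> {q..n}" using o t by auto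
    have inj1: "inj_on g1 {q..n}" "inj_on g2 {q..n}" unfolding g12 by (intro inj_sw in_q)+
    have inj2: "inj_on h1 {q..n}" "inj_on h2 {q..n}" unfolding h12 by (intro inj_on_swap inj1 in_q)+
    have code_le: "code n h1 l = code n g l" "code n h2 l = code n g l" if "l < r" for l
      using that o t by (auto simp: g12 h12 code_swap)
    have code_r: "code n h1 r = Suc (code n h2 r)"
    proof -
      have *: "\<not> (g t < g l \<and> g l < g s)" "g l \<noteq> g t" if "l \<in> {Suc r..n}" "l \<noteq> t" for l
        using that st[of l] inj_onD[OF injq, of l t] o t by auto
      have "h1 l < g s \<longleftrightarrow> l = s \<or> h2 l < g t" if l: "l \<in> {Suc r..n}" for l
      proof (cases "l = s \<or> l = t")
        case True
        then show ?thesis using v o t by auto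
      next
        case False
        then have "h1 l = g l" "h2 l = g l" using v' l by auto
        then show ?thesis using *[OF l] False t by auto
      qed
      then have "{l \<in> {Suc r..n}. h1 l < h1 r} = insert s {l \<in> {Suc r..n}. h2 l < h2 r}"
        unfolding v using o t by auto
      moreover have "s \<notin> {l \<in> {Suc r..n}. h2 l < h2 r}" unfolding v using o t v by auto
      ultimately show ?thesis unfolding code_def by simp
    qed
    have same: "Q n (Suc r) h1 = Q n (Suc r) f"
    proof (rule Q_cong, unfold order_iso_def, intro ballI)
      have h: "h1 x = (if x = s then g t else f x)" if "x \<in> {Suc r..n}" for x
      proof (cases "x = s \<or> x = t")
        case True
        then show ?thesis using v t by auto
      next
        case False
        then show ?thesis using v'[of x] that by auto
      qed
      have cmp: "(g t < f x \<longleftrightarrow> f s < f x) \<and> (f x < g t \<longleftrightarrow> f x < f s)"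
        if x: "x \<in> {Suc r..n}" "x \<noteq> s" for x
      proof (cases "x = t")
        case True
        then show ?thesis using v o t by auto
      next
        case False
        have "x \<in> {q..n}" "s \<in> {q..n}" "t \<in> {q..n}" using x o t by auto
        then have "g x \<noteq> g s" "g x \<noteq> g t" "\<not> (g t < g x \<and> g x < g s)"
          using st[of x] x(2) False inj_onD[OF injq] by blast+
        moreover have "f x = g x" using v'(5)[of x] x False by auto
        ultimately show ?thesis using t v by auto
      qed
      fix x z assume "x \<in> {Suc r..n}" "z \<in> {Suc r..n}"
      then show "h1 x < h1 z \<longleftrightarrow> f x < f z"
        using h cmp by (cases "x = s"; cases "z = s") auto
    qed
    have "inj_on h1 {Suc r..n}"
      by (rule inj_on_subset[OF inj2(1)]) (use o in auto)
    then obtain m where m: "1 \<le> cf (Q n (Suc r) h1) m"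
      using Q_pos[of h1 "Suc r" n] o t by fastforce
    let ?m1 = "m + Poly_Mapping.single r (code n h1 r)"
    let ?m2 = "?m1 + codes n (Suc q) r g"
    let ?m3 = "?m2 + Poly_Mapping.single q (Suc (code n g q))"
    have sub: "inj_on h1 {Suc q..n}" "inj_on h2 {Suc q..n}" "inj_on h1 {r..n}" "inj_on h2 {r..n}"
      by (rule inj_on_subset[OF inj2(1)] inj_on_subset[OF inj2(2)]; use o in auto)+
    have cs: "codes n (Suc q) r h1 = codes n (Suc q) r g" "codes n (Suc q) r h2 = codes n (Suc q) r g"
      by (intro codes_cong; use code_le in auto)+
    have "1 \<le> cf (Q n r h1) ?m1"
      using Q_drop_cf[OF sub(3), of m] m o t by simp
    then have "1 \<le> cf (Q n (Suc q) h1) ?m2"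
      using Q_drop_many_cf[OF sub(1), of r ?m1] o t unfolding cs by simp
    then have A: "1 \<le> cf (Q n q g1) ?m3"
      using Q_swap_cf[OF inj1(1) 1, of ?m2] code_q[of s t] o t by (simp add: g12 h12)
    have "1 \<le> cf (Q n r h2) ?m1"
      using Q_swap_cf[OF sub(4) 3, of m] m unfolding same code_r f by simp
    then have "1 \<le> cf (Q n (Suc q) h2) ?m2"
      using Q_drop_many_cf[OF sub(2), of r ?m1] o t unfolding cs by simp
    then have "1 \<le> cf (Q n q g2) ?m3"
      using Q_swap_cf[OF inj1(2) 2, of ?m2] code_q[of r s] o t by (simp add: g12 h12)
    with A show ?thesis using True unfolding g12 by blast
  qed
  then obtain m where "1 \<le> cf (Q n q (g \<circ> transpose s t)) m" "1 \<le> cf (Q n q (g \<circ> transpose r y)) m"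
    by blast
  then have "1 \<le> cf (Q n (Suc k) (g \<circ> transpose i1 t)) (?M m)"
    "1 \<le> cf (Q n (Suc k) (g \<circ> transpose i2 y)) (?M m)"
    using path1[of m] path2[of m] by linarith+
  then show ?thesis using Q_two_swaps_cf[OF inj ai, of "?M m"] unfolding multiple_def
    by (intro exI[of _ "?M m + Poly_Mapping.single k (Suc (code n g k))"]) linarith
qed

text \<open>If some \<open>cfgI\<close> occurs, it already forces multiplicity; otherwise the
  extremal argument applies.\<close>

lemma cfgD_multiple:
  assumes inj: "inj_on g {k..n}" and D: "cfgD n g p q r s t" "k \<le> p"
  shows "multiple (Q n k g)"
proof (cases "\<exists>p b a d c. k \<le> p \<and> cfgI n g p b a d c")
  case True
  then show ?thesis using cfgI_multiple[OF inj] by blast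
next
  case False
  have "inj_on g {p..n}" by (rule inj_on_subset[OF inj]) (use assms in auto)
  then have "multiple (Q n p g)"
    by (rule cfgD_multiple_aux[OF _ D(1)]) (use False D(2) in \<open>meson order_trans\<close>)
  then show ?thesis by (rule multiple_Q_drop_many[OF _ inj]) (use D in \<open>auto simp: cfgD_def\<close>)
qed

text \<open>Exchanging \<open>r\<close> and \<open>d\<close> in row \<open>k\<close> creates a \<open>cfgI\<close> that starts at \<open>q\<close>.\<close>

lemma cfgA_multiple_aux:
  assumes inj: "inj_on g {k..n}" and "cfgA n g k q r0 s0 d0 c0"
    and noD: "\<And>p q r s t. k \<le> p \<Longrightarrow> \<not> cfgD n g p q r s t"
  shows "multiple (Q n k g)"
proof -
  let ?P = "\<lambda>r. \<exists>s d c. cfgA n g k q r s d c"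
  define r where "r = (LEAST r. ?P r)"
  have "?P r" unfolding r_def by (rule LeastI[of ?P r0]) (use assms(2) in blast)
  have r_least: "r \<le> r'" if "cfgA n g k q r' s d c" for r' s d c
    unfolding r_def using that by (blast intro: Least_le)
  from \<open>?P r\<close> obtain s d1 c where 1: "cfgA n g k q r s d1 c" by blast
  obtain d where d: "r < d" "d \<le> n" "g d1 \<le> g d" "g d < g r"
    and d_max: "\<And>l. l \<in> {Suc r..n} \<Longrightarrow> \<not> (g d < g l \<and> g l < g r)"
    using max_below[of r d1 n g "g r"] 1 unfolding cfgA_def by auto
  have o: "k < q" "q < r" "r < s" "r < c" "c \<le> n" "g q < g c" "g k < g d" "g c < g d" "g r < g s"
    using 1 d unfolding cfgA_def by auto
  \<comment> \<open>Raising \<open>d1\<close> to the largest value below \<open>g r\<close> could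
    move it to the left of \<open>s\<close>, but then \<open>k, q, r, d, d1\<close> would be a
    \<open>cfgD\<close>.\<close>
  have "s < d"
  proof (rule ccontr)
    assume "\<not> s < d"
    moreover have "d \<noteq> s" using d o by auto
    moreover have "s < d1" using 1 by (simp add: cfgA_def)
    ultimately have "d < d1" "g d \<noteq> g d1"
      using inj_onD[OF inj, of d d1] 1 d by (auto simp: cfgA_def)
    then have "cfgD n g k q r d d1" using 1 d by (simp add: cfgA_def cfgD_def)
    then show False using noD by blast
  qed
  have rd: False if h: "l \<in> {q..n}" "g d < g l" "g l < g r" for l
  proof -
    consider "l = q" | "q < l" "l < r" | "l = r" | "l \<in> {Suc r..n}"
      using h(1) by fastforce
    then show False
    proof cases
      case 2
      then have "cfgA n g k q l s d c" using o d h \<open>s < d\<close> by (simp add: cfgA_def)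
      from r_least[OF this] 2 show ?thesis by simp
    qed (use o h d_max in auto)
  qed
  define q' where "q' = q - 1"
  have q': "k \<le> q'" "Suc q' = q" using o by (auto simp: q'_def)
  have rd': "l \<le> q'" if h: "l \<in> {Suc k..n}" "g d < g l" "g l < g r" for l
  proof (rule ccontr)
    assume "\<not> l \<le> q'"
    then have "l \<in> {q..n}" using h(1) q' by auto
    then show False by (rule rd[OF _ h(2,3)])
  qed
  have "\<exists>i0. adj_pair n k g i0 d \<and> (\<forall>m. cf (Q n (Suc q') (g \<circ> transpose r d)) m
      \<le> cf (Q n (Suc k) (g \<circ> transpose i0 d)) (m + codes n (Suc k) (Suc q') g))"
    using inj o d q' rd' by (intro chain_swap) auto
  then obtain i0 where i0: "adj_pair n k g i0 d" and
    path: "\<And>m. cf (Q n q (g \<circ> transpose r d)) m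
      \<le> cf (Q n (Suc k) (g \<circ> transpose i0 d)) (m + codes n (Suc k) q g)"
    unfolding q' by blast
  have injq: "inj_on g {q..n}" by (rule inj_on_subset[OF inj]) (use o in auto)
  \<comment> \<open>After the exchange, \<open>g d\<close> at position \<open>r\<close> is the 3,
    \<open>g s\<close> the 5, \<open>g r\<close> at position \<open>d\<close> the 4, and
    \<open>g c\<close> the 2.\<close>
  have "cfgI n (g \<circ> transpose r d) q r c s d"
    unfolding cfgI_def using o d \<open>s < d\<close> by (auto simp: transpose_def)
  moreover have "inj_on (g \<circ> transpose r d) {q..n}" using o d by (intro inj_on_swap injq) auto
  ultimately have "multiple (Q n q (g \<circ> transpose r d))" by (intro cfgI_multiple_aux)
  then obtain m where "2 \<le> cf (Q n q (g \<circ> transpose r d)) m" unfolding multiple_def by blast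
  also note path
  also have "cf (Q n (Suc k) (g \<circ> transpose i0 d)) (m + codes n (Suc k) q g)
    \<le> cf (Q n k g) (m + codes n (Suc k) q g + Poly_Mapping.single k (Suc (code n g k)))"
    using i0 o by (intro Q_swap_cf inj) (simp add: adj_inv_iff)
  finally show ?thesis unfolding multiple_def by blast
qed

lemma cfgA_multiple:
  assumes inj: "inj_on g {k..n}" and A: "cfgA n g p q r s d c" "k \<le> p"
  shows "multiple (Q n k g)"
proof (cases "\<exists>p q r s t. k \<le> p \<and> cfgD n g p q r s t")
  case True
  then show ?thesis using cfgD_multiple[OF inj] by blast
next
  case False
  have "inj_on g {p..n}" by (rule inj_on_subset[OF inj]) (use assms in auto)
  then have "multiple (Q n p g)"
    by (rule cfgA_multiple_aux[OF _ A(1)]) (use False A(2) in \<open>meson order_trans\<close>)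
  then show ?thesis by (rule multiple_Q_drop_many[OF _ inj]) (use A in \<open>auto simp: cfgA_def\<close>)
qed

section \<open>Divided differences on coefficients\<close>

lemma is_divdiff_sym:
  assumes "is_divdiff h f g" shows "swap_vars h g = g"
proof -
  let ?d = "var h - var (Suc h)"
  have swap: "swap_vars h (?d * p) = - ?d * swap_vars h p" for p
    by (simp add: left_diff_distrib swap_vars_var_mult)
  have invol: "swap_vars h (swap_vars h p) = p" for p
    by (rule poly_mapping_eqI) simp
  have "- ?d * swap_vars h g = swap_vars h (f - swap_vars h f)"
    using assms unfolding is_divdiff_def by (metis swap)
  also have "\<dots> = - (?d * g)"
    using assms by (simp add: is_divdiff_def invol)
  finally have "?d * swap_vars h g = ?d * g" by (simp only: minus_mult_left[symmetric] neg_equal_iff_equal)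
  moreover have "?d \<noteq> 0" using var_neq[of h "Suc h"] by simp
  ultimately show ?thesis by simp
qed

definition with_exps :: "(nat \<Rightarrow>\<^sub>0 nat) \<Rightarrow> nat \<Rightarrow> nat \<Rightarrow> nat \<Rightarrow> (nat \<Rightarrow>\<^sub>0 nat)" where
  "with_exps m h p q = Poly_Mapping.update h p (Poly_Mapping.update (Suc h) q m)"

lemma expo_with_exps [simp]:
  "expo (with_exps m h p q) j = (if j = h then p else if j = Suc h then q else expo m j)"
  by (simp add: with_exps_def lookup_update)

lemma swap_exp_with_exps: "swap_exp h (with_exps m h p q) = with_exps m h q p"
  by (rule poly_mapping_eqI) (auto simp: transpose_def)

lemma is_divdiff_recurrence:
  assumes "is_divdiff h f g"
  shows "(if a = 0 then 0 else cf g (with_exps m h (a - 1) b))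
      - (if b = 0 then 0 else cf g (with_exps m h a (b - 1)))
      = cf f (with_exps m h a b) - cf f (with_exps m h b a)"
proof -
  have "with_exps m h a b - unit_exp h = with_exps m h (a - 1) b"
    "with_exps m h a b - unit_exp (Suc h) = with_exps m h a (b - 1)"
    by (rule poly_mapping_eqI; auto simp: lookup_minus lookup_single when_def)+
  moreover have "cf ((var h - var (Suc h)) * g) (with_exps m h a b) =
      cf (f - swap_vars h f) (with_exps m h a b)"
    using assms by (simp add: is_divdiff_def)
  ultimately show ?thesis
    by (cases "a = 0"; cases "b = 0")
      (simp_all add: left_diff_distrib lookup_minus cf_var_mult swap_exp_with_exps)
qed

text \<open>Telescoping \<open>is_divdiff_recurrence\<close> along the string, from
  \<open>(p, q)\<close> to the end where the exponent of \<open>x_{h+1}\<close> is zero.\<close>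

lemma is_divdiff_cf_aux:
  assumes "is_divdiff h f g"
  shows "cf g (with_exps m h p q) = (\<Sum>a\<in>{Suc p..Suc (p + q)}.
    cf f (with_exps m h a (Suc (p + q) - a)) - cf f (with_exps m h (Suc (p + q) - a) a))"
proof (induction q arbitrary: p)
  case 0
  then show ?case using is_divdiff_recurrence[OF assms, of "Suc p" m 0] by simp
next
  case (Suc q)
  have "cf g (with_exps m h p (Suc q)) = cf g (with_exps m h (Suc p) q)
      + (cf f (with_exps m h (Suc p) (Suc q)) - cf f (with_exps m h (Suc q) (Suc p)))"
    using is_divdiff_recurrence[OF assms, of "Suc p" m "Suc q"] by simp
  then show ?case
    unfolding Suc by (subst sum.atLeast_Suc_atMost) auto
qed

text \<open>By symmetry of \<open>g\<close> the sum can start at the larger exponent. Then each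
  positive term lies in the half \<open>x_h > x_{h+1}\<close> and each negative term in the other
  half.\<close>

lemma is_divdiff_cf:
  assumes "is_divdiff h f g"
  shows "cf g (with_exps m h p q) = (\<Sum>a\<in>{Suc (max p q)..Suc (p + q)}.
    cf f (with_exps m h a (Suc (p + q) - a)) - cf f (with_exps m h (Suc (p + q) - a) a))"
proof (cases "q \<le> p")
  case True
  then show ?thesis using is_divdiff_cf_aux[OF assms, of m p q] by (simp add: max_def)
next
  case False
  have "cf g (with_exps m h p q) = cf (swap_vars h g) (with_exps m h q p)"
    by (simp add: swap_exp_with_exps)
  also have "\<dots> = cf g (with_exps m h q p)"
    by (simp add: is_divdiff_sym[OF assms])
  finally show ?thesis using is_divdiff_cf_aux[OF assms, of m q p] False
    by (simp add: max_def add.commute)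
qed

lemma with_exps_self: "with_exps m h (expo m h) (expo m (Suc h)) = m"
  by (rule poly_mapping_eqI) simp

text \<open>A nonzero term in \<open>is_divdiff_cf\<close> supplies the monomial. The strict growth
  of the maximum is what carries both the upper and the lower exponent bounds through the
  induction.\<close>

lemma is_divdiff_support:
  assumes "is_divdiff h f g" "cf g m \<noteq> 0"
  shows "\<exists>m'. cf f m' \<noteq> 0 \<and> (\<forall>j. j \<noteq> h \<longrightarrow> j \<noteq> Suc h \<longrightarrow> expo m' j = expo m j) \<and>
    expo m' h + expo m' (Suc h) = Suc (expo m h + expo m (Suc h)) \<and>
    max (expo m h) (expo m (Suc h)) < max (expo m' h) (expo m' (Suc h))"
proof -
  define p q where "p = expo m h" and "q = expo m (Suc h)"
  have "cf g (with_exps m h p q) \<noteq> 0" using assms(2) by (simp add: p_def q_def with_exps_self)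
  then obtain a where a: "a \<in> {Suc (max p q)..Suc (p + q)}" and
    "cf f (with_exps m h a (Suc (p + q) - a)) - cf f (with_exps m h (Suc (p + q) - a) a) \<noteq> 0"
    unfolding is_divdiff_cf[OF assms(1)] by (meson sum.neutral)
  then have "cf f (with_exps m h a (Suc (p + q) - a)) \<noteq> 0 \<or> cf f (with_exps m h (Suc (p + q) - a) a) \<noteq> 0"
    by auto
  then show ?thesis
  proof
    assume "cf f (with_exps m h a (Suc (p + q) - a)) \<noteq> 0"
    then show ?thesis using a
      by (intro exI[of _ "with_exps m h a (Suc (p + q) - a)"]) (auto simp: p_def q_def)
  next
    assume "cf f (with_exps m h (Suc (p + q) - a) a) \<noteq> 0"
    then show ?thesis using a
      by (intro exI[of _ "with_exps m h (Suc (p + q) - a) a"]) (auto simp: p_def q_def)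
  qed
qed

text \<open>The \<open>h\<close>-string of a monomial consists of the monomials with the same total exponent of
  \<open>x_h\<close> and \<open>x_{h+1}\<close>. A divided difference stays zero-one if
  each string meets the half \<open>x_h > x_{h+1}\<close> at most once.\<close>

lemma zero_one_divdiff:
  assumes "is_divdiff h f g" "zero_one f" "nonneg g"
    and unique: "\<And>m m'. cf f m \<noteq> 0 \<Longrightarrow> cf f m' \<noteq> 0 \<Longrightarrow>
      (\<And>j. j \<noteq> h \<Longrightarrow> j \<noteq> Suc h \<Longrightarrow> expo m j = expo m' j) \<Longrightarrow>
      expo m h + expo m (Suc h) = expo m' h + expo m' (Suc h) \<Longrightarrow>
      expo m (Suc h) < expo m h \<Longrightarrow> expo m' (Suc h) < expo m' h \<Longrightarrow> expo m h = expo m' h"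
  shows "zero_one g"
  unfolding zero_one_def
proof
  fix m
  define p q where "p = expo m h" and "q = expo m (Suc h)"
  define F where "F a = cf f (with_exps m h a (Suc (p + q) - a))" for a
  let ?A = "{Suc (max p q)..Suc (p + q)}"
  have F01: "F a \<in> {0, 1}" and f0: "0 \<le> cf f m'" for a m'
    using assms(2) unfolding zero_one_def F_def by (blast, metis insertE order_refl singletonD zero_le_one)
  have "cf g m = cf g (with_exps m h p q)" by (simp add: p_def q_def with_exps_self)
  \<comment> \<open>The subtracted coefficients are nonnegative and may be discarded for an upper
    bound.\<close>
  also have "\<dots> \<le> sum F ?A"
    unfolding is_divdiff_cf[OF assms(1)] F_def by (rule sum_mono) (use f0 in auto)
  also have "sum F ?A \<le> 1"
  proof (cases "\<exists>a\<in>?A. F a \<noteq> 0")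
    case True
    then obtain a where a: "a \<in> ?A" "F a \<noteq> 0" by blast
    have "F b = 0" if b: "b \<in> ?A - {a}" for b
    proof (rule ccontr)
      assume "F b \<noteq> 0"
      then have "expo (with_exps m h a (Suc (p + q) - a)) h = expo (with_exps m h b (Suc (p + q) - b)) h"
        using a b unfolding F_def by (intro unique) auto
      then show False using b by simp
    qed
    then have "sum F ?A = F a"
      using a by (subst sum.remove[of _ a]) auto
    then show ?thesis using F01[of a] by auto
  next
    case False
    then show ?thesis by (simp add: sum.neutral)
  qed
  finally have "cf g m \<le> 1" .
  moreover have "0 \<le> cf g m" using assms(3) by (simp add: nonneg_def)
  ultimately show "cf g m \<in> {0, 1}" by (simp add: le_less) linarith
qed

section \<open>The Schubert polynomials\<close>

lemma longest_permutes: "longest n permutes {1..n}"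
  by (rule inj_imp_permutes) (auto simp: longest_def inj_on_def)

lemma Phi_decreasing:
  assumes "w permutes {k..k+t}" "\<And>i. i \<in> {k..k+t} \<Longrightarrow> w i = 2 * k + t - i"
  shows "Phi k t w = (\<Prod>i\<in>{k..k+t}. var i ^ (k + t - i))"
  using assms
proof (induction t arbitrary: k w)
  case 0
  then have "w = id" by (auto simp: permutes_def fun_eq_iff)
  then show ?case by (simp add: id_def[symmetric])
next
  case (Suc t)
  have wk: "w k = k + Suc t" using Suc.prems(2)[of k] by simp
  have "Phi k (Suc t) w = var k ^ Suc t * Phi (Suc k) t (cyc k (Suc t) w)"
    unfolding Phi.simps by (rule row_cyc[OF _ Suc.prems(1) wk]) (rule Phi_Suc_fixes)
  also have "Phi (Suc k) t (cyc k (Suc t) w) = (\<Prod>i\<in>{Suc k..Suc k+t}. var i ^ (Suc k + t - i))"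
  proof (rule Suc.IH)
    show "cyc k (Suc t) w permutes {Suc k..Suc k + t}"
      using cyc_permutes[OF Suc.prems(1) wk] by simp
    fix i assume "i \<in> {Suc k..Suc k + t}"
    then show "cyc k (Suc t) w i = 2 * Suc k + t - i"
      using Suc.prems(2)[of i] by (auto simp: cyc_apply simp del: cyc.simps)
  qed
  also have "var k ^ Suc t * \<dots> = (\<Prod>i\<in>{k..k + Suc t}. var i ^ (k + Suc t - i))"
    by (subst (2) prod.atLeast_Suc_atMost) auto
  finally show ?case .
qed

lemma schubert_family_Phi:
  assumes "n \<ge> 1" shows "schubert_family n (Phi 1 (n - 1))"
  unfolding schubert_family_def
proof (intro conjI allI impI)
  have "Phi 1 (n - 1) (longest n) = (\<Prod>i\<in>{1..1 + (n - 1)}. var i ^ (1 + (n - 1) - i))"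
    using assms longest_permutes[of n] by (intro Phi_decreasing) (auto simp: longest_def)
  then show "Phi 1 (n - 1) (longest n) = (\<Prod>i\<in>{1..n}. var i ^ (n - i))"
    using assms by simp
next
  fix w i
  assume w: "w permutes {1..n}" "1 \<le> i" "i < n" "w i < w (Suc i)"
  let ?u = "w \<circ> adj i"
  have "bij ?u" using permutes_bij[OF w(1)] by (intro bij_comp) simp_all
  then have "is_divdiff i (Phi 1 (n - 1) ?u) (rmul i (Phi 1 (n - 1)) ?u)"
    using w by (intro Phi_divdiff) auto
  moreover have "rmul i (Phi 1 (n - 1)) ?u = Phi 1 (n - 1) w"
    using w by (simp add: rmul_def comp_assoc)
  ultimately show "Phi 1 (n - 1) w = divdiff i (Phi 1 (n - 1) ?u)"
    by (simp add: divdiff_eqI)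
qed

lemma no_ascent_longest:
  assumes w: "w permutes {1..n}" and "\<And>i. 1 \<le> i \<Longrightarrow> i < n \<Longrightarrow> \<not> w i < w (Suc i)"
  shows "w = longest n"
proof -
  have desc: "w j < w i" if "1 \<le> i" "i < j" "j \<le> n" for i j
    using that(2,3)
  proof (induction j)
    case (Suc j)
    have "w (Suc j) < w j"
      using assms(2)[of j] Suc.prems that(1) permutes_eq_iff[OF w, of j "Suc j"]
      by (cases "j = 0") force+
    then show ?case using Suc by (cases "i = j") auto
  qed simp
  have "w i < w j \<longleftrightarrow> longest n i < longest n j" if "i \<in> {1..n}" "j \<in> {1..n}" for i j
    using that desc[of i j] desc[of j i] by (cases i j rule: linorder_cases) (auto simp: longest_def)
  then have "order_iso n 1 w (longest n)" by (simp add: order_iso_def)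
  then have "std n 1 (longest n) = w" by (rule std_eq[OF w])
  moreover have "std n 1 (longest n) = longest n"
    by (rule std_eq[OF longest_permutes]) (simp add: order_iso_def)
  ultimately show ?thesis by simp
qed

lemma swap_permutes:
  assumes "w permutes {1..n}" "1 \<le> i" "i < n" shows "(w \<circ> adj i) permutes {1..n}"
  using assms by (intro permutes_compose permutes_swap_id) auto

text \<open>An exchange at an ascent lowers the sum of \<open>j * w j\<close> by
  \<open>w (Suc i) - w i\<close>. The hypothesis is provided for every ascent, since different
  arguments choose different ones.\<close>

lemma ascent_induct [consumes 1, case_names longest step]:
  assumes "w permutes {1..n}" and "P (longest n)"
    and step: "\<And>w. w permutes {1..n} \<Longrightarrow> \<exists>i. 1 \<le> i \<and> i < n \<and> w i < w (Suc i) \<Longrightarrow>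
      (\<And>i. 1 \<le> i \<Longrightarrow> i < n \<Longrightarrow> w i < w (Suc i) \<Longrightarrow> P (w \<circ> adj i)) \<Longrightarrow> P w"
  shows "P w"
  using assms(1)
proof (induction "\<Sum>j\<in>{1..n}. j * w j" arbitrary: w rule: less_induct)
  case less
  show ?case
  proof (cases "\<exists>i. 1 \<le> i \<and> i < n \<and> w i < w (Suc i)")
    case False
    then have "w = longest n" by (intro no_ascent_longest[OF less.prems]) blast
    then show ?thesis using assms(2) by simp
  next
    case True
    show ?thesis
    proof (rule step[OF less.prems True])
      fix i assume i: "1 \<le> i" "i < n" "w i < w (Suc i)"
      let ?u = "w \<circ> adj i"
      let ?R = "{1..n} - {i} - {Suc i}"
      have split: "(\<Sum>j\<in>{1..n}. j * f j) = i * f i + (Suc i * f (Suc i) + (\<Sum>j\<in>?R. j * f j))"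
        for f :: "nat \<Rightarrow> nat"
        using i by (subst sum.remove[of _ i], simp, simp, subst sum.remove[of _ "Suc i"]) auto
      have "(\<Sum>j\<in>?R. j * ?u j) = (\<Sum>j\<in>?R. j * w j)"
        by (rule sum.cong) auto
      then have "(\<Sum>j\<in>{1..n}. j * ?u j) < (\<Sum>j\<in>{1..n}. j * w j)"
        unfolding split using i by simp
      then show "P ?u" using swap_permutes[OF less.prems i(1,2)] by (rule less.hyps)
    qed
  qed
qed

text \<open>\<open>Phi\<close> shows that some family exists, so the chosen one obeys the recursion;
  the recursion determines the values on all permutations by induction from the longest one.\<close>

lemma schubert_eq_Phi:
  assumes "n \<ge> 1" "w permutes {1..n}"
  shows "schubert n w = Phi 1 (n - 1) w"
proof -
  have S: "schubert_family n (schubert n)"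
    unfolding schubert_def
    by (rule someI[of "schubert_family n" "Phi 1 (n - 1)"]) (rule schubert_family_Phi[OF assms(1)])
  note P = schubert_family_Phi[OF assms(1)]
  show ?thesis using assms(2)
  proof (induction rule: ascent_induct)
    case longest
    then show ?case using S P by (simp add: schubert_family_def)
  next
    case (step w)
    then obtain i where i: "1 \<le> i" "i < n" "w i < w (Suc i)" by blast
    then have "schubert n w = divdiff i (schubert n (w \<circ> adj i))"
      "Phi 1 (n - 1) w = divdiff i (Phi 1 (n - 1) (w \<circ> adj i))"
      using S P step.hyps by (simp_all add: schubert_family_def)
    then show ?case using step(3)[OF i] by (simp only:)
  qed
qed

lemma schubert_eq_Q:
  assumes "n \<ge> 1" "w permutes {1..n}" shows "schubert n w = Q n 1 w"
  using assms by (simp add: schubert_eq_Phi Q_permutes)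

lemma schubert_divdiff:
  assumes "w permutes {1..n}" "1 \<le> i" "i < n" "w i < w (Suc i)"
  shows "is_divdiff i (schubert n (w \<circ> adj i)) (schubert n w)"
proof -
  let ?u = "w \<circ> adj i"
  have "bij ?u" using permutes_bij[OF assms(1)] by (intro bij_comp) simp_all
  then have "is_divdiff i (Phi 1 (n - 1) ?u) (rmul i (Phi 1 (n - 1)) ?u)"
    using assms by (intro Phi_divdiff) auto
  moreover have "rmul i (Phi 1 (n - 1)) ?u = Phi 1 (n - 1) w"
    using assms by (simp add: rmul_def comp_assoc)
  ultimately show ?thesis
    using assms swap_permutes[OF assms(1-3)] by (simp add: schubert_eq_Phi)
qed

lemma nonneg_schubert:
  assumes "n \<ge> 1" "w permutes {1..n}" shows "nonneg (schubert n w)"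
  using assms by (simp add: schubert_eq_Phi nonneg_Phi)

lemma var_power: "var i ^ a = Poly_Mapping.single (Poly_Mapping.single i a) 1"
  by (induction a) (simp_all add: var_def mult_single single_add[symmetric] single_one)

lemma prod_var_power:
  "finite A \<Longrightarrow> (\<Prod>i\<in>A. var i ^ f i) = Poly_Mapping.single (\<Sum>i\<in>A. Poly_Mapping.single i (f i)) 1"
  by (induction rule: finite_induct) (simp_all add: var_power mult_single single_one)

lemma schubert_longest:
  assumes "n \<ge> 1"
  shows "schubert n (longest n) = Poly_Mapping.single (\<Sum>i\<in>{1..n}. Poly_Mapping.single i (n - i)) 1"
proof -
  have "schubert n (longest n) = Phi 1 (n - 1) (longest n)"
    using assms longest_permutes by (rule schubert_eq_Phi)
  also have "\<dots> = (\<Prod>i\<in>{1..n}. var i ^ (n - i))"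
    using schubert_family_Phi[OF assms] by (simp add: schubert_family_def)
  finally show ?thesis by (simp add: prod_var_power)
qed

lemma schubert_longest_support:
  assumes "n \<ge> 1" "cf (schubert n (longest n)) m \<noteq> 0"
  shows "m = (\<Sum>i\<in>{1..n}. Poly_Mapping.single i (n - i))"
  using assms by (auto simp: schubert_longest lookup_single when_def split: if_splits)

lemma schubert_longest_expo:
  assumes "n \<ge> 1" "cf (schubert n (longest n)) m \<noteq> 0" "j \<in> {1..n}"
  shows "expo m j = n - j"
proof -
  have "expo m j = (\<Sum>i\<in>{1..n}. if i = j then n - i else 0)"
    unfolding schubert_longest_support[OF assms(1,2)] lookup_sum
    by (rule sum.cong) (auto simp: lookup_single when_def)
  also have "\<dots> = n - j" using assms(3) by simp
  finally show ?thesis .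
qed

lemma zero_one_longest: "n \<ge> 1 \<Longrightarrow> zero_one (schubert n (longest n))"
  by (simp add: schubert_longest zero_one_def lookup_single when_def)

section \<open>Bounds on the support of a Schubert polynomial\<close>

lemma schubert_support_step:
  assumes "w permutes {1..n}" "1 \<le> h" "h < n" "w h < w (Suc h)" "cf (schubert n w) m \<noteq> 0"
  obtains m' where "cf (schubert n (w \<circ> adj h)) m' \<noteq> 0"
    "\<And>j. j \<noteq> h \<Longrightarrow> j \<noteq> Suc h \<Longrightarrow> expo m' j = expo m j"
    "expo m' h + expo m' (Suc h) = Suc (expo m h + expo m (Suc h))"
    "max (expo m h) (expo m (Suc h)) < max (expo m' h) (expo m' (Suc h))"
  using is_divdiff_support[OF schubert_divdiff[OF assms(1-4)] assms(5)] that by blast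

definition first_ascent :: "nat \<Rightarrow> (nat \<Rightarrow> nat) \<Rightarrow> nat \<Rightarrow> bool" where
  "first_ascent n w h \<longleftrightarrow> 1 \<le> h \<and> h < n \<and> w h < w (Suc h) \<and>
    (\<forall>i j. 1 \<le> i \<longrightarrow> i < j \<longrightarrow> j \<le> h \<longrightarrow> w j < w i)"

lemma first_ascent_exists:
  assumes "w permutes {1..n}" "\<exists>i. 1 \<le> i \<and> i < n \<and> w i < w (Suc i)"
  obtains h where "first_ascent n w h"
proof -
  define h where "h = (LEAST i. 1 \<le> i \<and> i < n \<and> w i < w (Suc i))"
  have h: "1 \<le> h \<and> h < n \<and> w h < w (Suc h)"
    unfolding h_def by (rule LeastI_ex[OF assms(2)])
  have least: "\<not> w i < w (Suc i)" if "1 \<le> i" "i < h" for i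
    using not_less_Least[of i "\<lambda>i. 1 \<le> i \<and> i < n \<and> w i < w (Suc i)"] that h
    unfolding h_def[symmetric] by auto
  have "w j < w i" if "1 \<le> i" "i < j" "j \<le> h" for i j
    using that(2,3)
  proof (induction j)
    case (Suc j)
    have "w (Suc j) < w j"
      using least[of j] Suc.prems that(1) permutes_eq_iff[OF assms(1), of j "Suc j"] by force
    then show ?case using Suc by (cases "i = j") auto
  qed simp
  then have "first_ascent n w h" using h by (simp add: first_ascent_def)
  then show ?thesis by (rule that)
qed

text \<open>The columns of the Rothe diagram with a box in row \<open>i\<close> or below, each
  recorded by the position \<open>z\<close> of its letter.\<close>

definition overhang :: "nat \<Rightarrow> (nat \<Rightarrow> nat) \<Rightarrow> nat \<Rightarrow> nat set" where
  "overhang n w i = {z \<in> {1..n}. \<exists>y. i \<le> y \<and> y < z \<and> w z < w y}"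

lemma finite_overhang [simp]: "finite (overhang n w i)"
  by (simp add: overhang_def)

lemma overhang_antimono: "i \<le> j \<Longrightarrow> overhang n w j \<subseteq> overhang n w i"
  unfolding overhang_def by (blast intro: order_trans)

lemma overhang_swap:
  assumes "w h < w (Suc h)"
  shows "overhang n (w \<circ> adj h) h \<subseteq> insert (Suc h) (overhang n w (Suc h))"
proof
  fix z assume "z \<in> overhang n (w \<circ> adj h) h"
  then obtain y where z: "z \<in> {1..n}" and y: "h \<le> y" "y < z" "w (adj h z) < w (adj h y)"
    by (auto simp: overhang_def)
  show "z \<in> insert (Suc h) (overhang n w (Suc h))"
  proof (cases "z = Suc h")
    case False
    then have "Suc h < z" using y by auto
    then have zz: "adj h z = z" by simp
    consider "y = h" | "y = Suc h" | "Suc h < y" using y(1) by linarith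
    then have "\<exists>y. Suc h \<le> y \<and> y < z \<and> w z < w y"
    proof cases
      case 1
      then show ?thesis using y zz \<open>Suc h < z\<close> by (intro exI[of _ "Suc h"]) simp
    next
      case 2
      then show ?thesis using y zz assms \<open>Suc h < z\<close> by (intro exI[of _ "Suc h"]) simp
    next
      case 3
      then show ?thesis using y zz by (intro exI[of _ y]) simp
    qed
    then show ?thesis using z by (simp add: overhang_def)
  qed simp
qed

lemma card_overhang_swap:
  assumes "w h < w (Suc h)"
  shows "card (overhang n (w \<circ> adj h) h) \<le> Suc (card (overhang n w (Suc h)))"
proof -
  have "card (overhang n (w \<circ> adj h) h) \<le> card (insert (Suc h) (overhang n w (Suc h)))"
    using overhang_swap[where n = n, OF assms] by (intro card_mono) auto
  also have "\<dots> \<le> Suc (card (overhang n w (Suc h)))" by (simp add: card_insert_if)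
  finally show ?thesis .
qed

lemma overhang_swap_before:
  assumes "first_ascent n w h" "1 \<le> i" "i < h"
  shows "card (overhang n (w \<circ> adj h) i) \<le> card (overhang n w i)"
proof (rule card_inj_on_le)
  show "adj h ` overhang n (w \<circ> adj h) i \<subseteq> overhang n w i"
  proof
    fix z' assume "z' \<in> adj h ` overhang n (w \<circ> adj h) i"
    then obtain z y where z': "z' = adj h z" and z: "z \<in> {1..n}" and
      y: "i \<le> y" "y < z" "w (adj h z) < w (adj h y)"
      by (auto simp: overhang_def)
    have h: "1 \<le> h" "h < n" "w h < w i" using assms by (auto simp: first_ascent_def)
    have "z' \<in> {1..n}" using z h unfolding z' by (auto simp: transpose_def)
    moreover have "\<exists>y. i \<le> y \<and> y < z' \<and> w z' < w y"
    \<comment> \<open>For \<open>z = Suc h\<close> the image is \<open>h\<close>, and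
      \<open>i\<close> itself is the witness, as the word decreases up to \<open>h\<close>. All
      other comparisons with a later \<open>z\<close> survive the exchange.\<close>
    proof (cases "z = Suc h")
      case True
      then show ?thesis using h assms(3) unfolding z' by (intro exI[of _ i]) simp
    next
      case False
      have "i \<le> adj h y" using y(1) assms(3) by (auto simp: transpose_def)
      moreover have "adj h y < adj h z"
        using y(2) False by (auto simp: transpose_def)
      ultimately show ?thesis using y(3) unfolding z' by blast
    qed
    ultimately show "z' \<in> overhang n w i" by (simp add: overhang_def)
  qed
qed simp_all

text \<open>Undoing the first ascent \<open>h\<close> raises the maximum of the exponents at
  \<open>h\<close> and \<open>h + 1\<close> by at least one, while the column count of
  \<open>overhang_swap\<close> grows by at most one. Before \<open>h\<close> the first-ascent
  property keeps the count under control.\<close>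

lemma schubert_expo_le:
  assumes n: "n \<ge> 1" and "w permutes {1..n}" "cf (schubert n w) m \<noteq> 0" "i \<in> {1..n}"
  shows "expo m i \<le> card (overhang n w i)"
  using assms(2-4)
proof (induction arbitrary: m i rule: ascent_induct)
  case longest
  have "{Suc i..n} \<subseteq> overhang n (longest n) i"
    using longest.prems(2) by (auto simp: overhang_def longest_def intro!: exI[of _ i])
  then have "card {Suc i..n} \<le> card (overhang n (longest n) i)"
    by (intro card_mono) simp_all
  then show ?case using schubert_longest_expo[OF n longest.prems] by simp
next
  case (step w)
  obtain h where h: "first_ascent n w h" using first_ascent_exists[OF step.hyps(1,2)] .
  then have h': "1 \<le> h" "h < n" "w h < w (Suc h)" by (auto simp: first_ascent_def)
  from schubert_support_step[OF step.hyps(1) h' step.prems(1)]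
  obtain m' where m': "cf (schubert n (w \<circ> adj h)) m' \<noteq> 0"
    "\<And>j. j \<noteq> h \<Longrightarrow> j \<noteq> Suc h \<Longrightarrow> expo m' j = expo m j"
    "expo m' h + expo m' (Suc h) = Suc (expo m h + expo m (Suc h))"
    "max (expo m h) (expo m (Suc h)) < max (expo m' h) (expo m' (Suc h))" by blast
  let ?u = "w \<circ> adj h"
  have IH: "expo m' j \<le> card (overhang n ?u j)" if "j \<in> {1..n}" for j
    by (rule step.IH[OF h' m'(1) that])
  show ?case
  proof (cases "i = h \<or> i = Suc h")
    case True
    have "expo m' (Suc h) \<le> card (overhang n ?u (Suc h))" using IH h' by simp
    also have "\<dots> \<le> card (overhang n ?u h)"
      by (intro card_mono finite_overhang overhang_antimono) simp
    finally have "max (expo m' h) (expo m' (Suc h)) \<le> card (overhang n ?u h)"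
      using IH[of h] h' by simp
    also have "\<dots> \<le> Suc (card (overhang n w (Suc h)))"
      using h'(3) by (rule card_overhang_swap)
    finally have "max (expo m h) (expo m (Suc h)) \<le> card (overhang n w (Suc h))" using m'(4) by linarith
    moreover have "card (overhang n w (Suc h)) \<le> card (overhang n w h)"
      by (intro card_mono finite_overhang overhang_antimono) simp
    ultimately show ?thesis using True by auto
  next
    case False
    have "card (overhang n ?u i) \<le> card (overhang n w i)"
    proof (cases "i < h")
      case True
      then show ?thesis using overhang_swap_before[OF h] step.prems by simp
    next
      case i: False
      then have "Suc h < i" using False by auto
      then have "overhang n ?u i = overhang n w i"
        unfolding overhang_def by (intro Collect_cong conj_cong refl ex_cong1) (auto simp: transpose_def)
      then show ?thesis by simp
    qed
    then show ?thesis using IH[of i] m'(2)[of i] step.prems False by simp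
  qed
qed

text \<open>In the Rothe diagram the first \<open>v\<close> columns are filled in the rows
  \<open>1, ..., i\<close>; divided differences do not reduce this common part of the
  exponents.\<close>

lemma schubert_expo_ge:
  assumes n: "n \<ge> 1" and "w permutes {1..n}" "cf (schubert n w) m \<noteq> 0" "i \<in> {1..n}"
    and "\<And>j. j \<in> {1..i} \<Longrightarrow> v < w j"
  shows "v \<le> expo m i"
  using assms(2-5)
proof (induction arbitrary: m i rule: ascent_induct)
  case longest
  have "v < longest n i" using longest.prems(2,3) by simp
  then show ?case using schubert_longest_expo[OF n longest.prems(1,2)] longest.prems(2)
    by (auto simp: longest_def)
next
  case (step w)
  obtain h where h': "1 \<le> h" "h < n" "w h < w (Suc h)" using step.hyps(2) by blast
  from schubert_support_step[OF step.hyps(1) h' step.prems(1)]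
  obtain m' where m': "cf (schubert n (w \<circ> adj h)) m' \<noteq> 0"
    "\<And>j. j \<noteq> h \<Longrightarrow> j \<noteq> Suc h \<Longrightarrow> expo m' j = expo m j"
    "expo m' h + expo m' (Suc h) = Suc (expo m h + expo m (Suc h))"
    "max (expo m h) (expo m (Suc h)) < max (expo m' h) (expo m' (Suc h))" by blast
  let ?u = "w \<circ> adj h"
  have IH: "v \<le> expo m' j" if "j \<in> {1..n}" "\<And>l. l \<in> {1..j} \<Longrightarrow> v < ?u l" for j
    by (rule step.IH[OF h' m'(1) that])
  show ?case
  proof (cases "i = h \<or> i = Suc h")
    case True
    have wh: "v < w h" using step.prems(3)[of h] h' True by auto
    have lt: "v < w l" if "l \<in> {1..Suc h}" for l
      using that True step.prems(3)[of l] wh h'(3) by (cases "l = Suc h") auto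
    have "v < ?u l" if "l \<in> {1..Suc h}" for l
      using lt[of "adj h l"] that h' by (auto simp: transpose_def)
    then have "v \<le> expo m' h" "v \<le> expo m' (Suc h)"
      using IH[of h] IH[of "Suc h"] h' by auto
    \<comment> \<open>The sum drops by one and the maximum by at least one, so the minimum does not
      drop.\<close>
    moreover have "v \<le> a \<and> v \<le> b"
      if "v \<le> c" "v \<le> d" "c + d = Suc (a + b)" "max a b < max c d" for a b c d :: nat
      using that by (auto simp: max_def split: if_splits)
    ultimately show ?thesis using True m'(3,4) by blast
  next
    case False
    have "v < ?u l" if "l \<in> {1..i}" for l
    proof -
      have "adj h l \<in> {1..i}" using that False h' by (auto simp: transpose_def)
      then show ?thesis using step.prems(3)[of "adj h l"] by simp
    qed
    then have "v \<le> expo m' i" using IH[of i] step.prems(2) by blast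
    then show ?thesis using m'(2)[of i] False by simp
  qed
qed

section \<open>Constant degree in the first variables\<close>

definition no132_across :: "nat \<Rightarrow> (nat \<Rightarrow> nat) \<Rightarrow> nat \<Rightarrow> bool" where
  "no132_across n w i \<longleftrightarrow>
    (\<forall>x y z. 1 \<le> x \<longrightarrow> x \<le> i \<longrightarrow> i < y \<longrightarrow> y < z \<longrightarrow> z \<le> n \<longrightarrow> \<not> (w x < w z \<and> w z < w y))"

lemma no132_across_swap:
  assumes "first_ascent n w h" "h \<noteq> i" "no132_across n w i"
  shows "no132_across n (w \<circ> adj h) i"
  unfolding no132_across_def
proof (intro allI impI notI; elim conjE)
  fix x y z
  assume xyz: "1 \<le> x" "x \<le> i" "i < y" "y < z" "z \<le> n"
    and c: "(w \<circ> adj h) x < (w \<circ> adj h) z" "(w \<circ> adj h) z < (w \<circ> adj h) y"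
  have h: "1 \<le> h" "h < n" "w h < w (Suc h)"
    and dec: "\<And>i. 1 \<le> i \<Longrightarrow> i < h \<Longrightarrow> w h < w i"
    using assms(1) by (auto simp: first_ascent_def)
  show False
  \<comment> \<open>Only in this case does the exchange reverse the positions of the 3 and the 2;
    but then the 2 is \<open>w h\<close>, which is smaller than every earlier letter.\<close>
  proof (cases "y = h \<and> z = Suc h")
    case True
    then have "x < h" using xyz by simp
    then show False using c dec[of x] xyz True by simp
  next
    case False
    have "adj h x \<le> i" "i < adj h y" "1 \<le> adj h x" "adj h z \<le> n"
      using xyz assms(2) h by (auto simp: transpose_def)
    moreover have "adj h y < adj h z" using False xyz by (auto simp: transpose_def)
    ultimately show False using assms(3) c unfolding no132_across_def by (metis comp_apply)
  qed
qed

lemma card_smaller_values: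
  assumes "w permutes {1..n}" "j \<in> {1..n}"
  shows "card {z \<in> {1..n}. w z < w j} = w j - 1"
proof -
  have "w j \<in> {1..n}" by (rule permutes_mem_iff[OF assms])
  have "card {z \<in> {1..n}. w z < w j} = card {z \<in> {1..n}. z < w j}"
    using card_permutes_filter[OF assms(1), of "\<lambda>z. z < w j"] .
  also have "{z \<in> {1..n}. z < w j} = {1..<w j}" using \<open>w j \<in> {1..n}\<close> by auto
  finally show ?thesis by simp
qed

text \<open>At the first ascent \<open>i\<close> the lower and the upper bound for the exponents coincide.\<close>

lemma no132_across_first_ascent_expo:
  assumes n: "n \<ge> 1" and w: "w permutes {1..n}" and i: "first_ascent n w i" "no132_across n w i"
    and m: "cf (schubert n w) m \<noteq> 0" and j: "j \<in> {1..i}"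
  shows "expo m j = w j - 1"
proof (rule antisym)
  have i': "1 \<le> i" "i < n" using i(1) by (auto simp: first_ascent_def)
  have dec: "w b < w a" if "1 \<le> a" "a < b" "b \<le> i" for a b
    using i(1) that by (auto simp: first_ascent_def)
  have "overhang n w j \<subseteq> {z \<in> {1..n}. w z < w j}"
  proof
    fix z assume "z \<in> overhang n w j"
    then obtain y where z: "z \<in> {1..n}" and y: "j \<le> y" "y < z" "w z < w y"
      by (auto simp: overhang_def)
    have "w z < w j"
    proof (rule ccontr)
      assume "\<not> w z < w j"
      then have gt: "w j < w z" using permutes_eq_iff[OF w, of z j] y by auto
      then have "i < z" using dec[of j z] j y by force
      show False
      proof (cases "i < y")
        case True
        have "w i \<le> w j" using dec[of j i] j by (cases "j = i") auto
        then have "w i < w z" using gt by simp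
        then show False using i(2) i' True y z unfolding no132_across_def by auto
      next
        case False
        then have "w y \<le> w j" using dec[of j y] j y by (cases "j = y") auto
        then show False using gt y by simp
      qed
    qed
    then show "z \<in> {z \<in> {1..n}. w z < w j}" using z by simp
  qed
  then have "card (overhang n w j) \<le> card {z \<in> {1..n}. w z < w j}" by (intro card_mono) auto
  also have "\<dots> = w j - 1" by (rule card_smaller_values[OF w]) (use i' j in auto)
  finally show "expo m j \<le> w j - 1"
    using schubert_expo_le[OF n w m, of j] i' j by simp
  have "w j \<in> {1..n}" using j i' by (intro permutes_mem_iff[OF w]) auto
  then have "w j - 1 < w l" if "l \<in> {1..j}" for l
    using that dec[of l j] j by (cases "l = j") auto
  then show "w j - 1 \<le> expo m j" using j i' by (intro schubert_expo_ge[OF n w m]) auto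
qed

text \<open>A divided difference at \<open>h < i\<close> lowers the prefix degree by exactly one,
  and at \<open>h > i\<close> it leaves it unchanged. At \<open>h = i\<close> the induction
  hypothesis is replaced by \<open>no132_across_first_ascent_expo\<close>, which determines all
  exponents in the prefix.\<close>

lemma prefix_degree_const:
  assumes n: "n \<ge> 1" and "w permutes {1..n}" "no132_across n w i" "i < n"
  shows "\<exists>c. \<forall>m. cf (schubert n w) m \<noteq> 0 \<longrightarrow> (\<Sum>j\<in>{1..i}. expo m j) = c"
  using assms(2-4)
proof (induction rule: ascent_induct)
  case longest
  have "(\<Sum>j\<in>{1..i}. expo m j) = (\<Sum>j\<in>{1..i}. n - j)" if "cf (schubert n (longest n)) m \<noteq> 0" for m
    using schubert_longest_expo[OF n that] longest.prems by (intro sum.cong) auto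
  then show ?case by blast
next
  case (step w)
  obtain h where h: "first_ascent n w h" using first_ascent_exists[OF step.hyps(1,2)] .
  then have h': "1 \<le> h" "h < n" "w h < w (Suc h)" by (auto simp: first_ascent_def)
  show ?case
  proof (cases "h = i")
    case True
    have "(\<Sum>j\<in>{1..i}. expo m j) = (\<Sum>j\<in>{1..i}. w j - 1)" if "cf (schubert n w) m \<noteq> 0" for m
      using no132_across_first_ascent_expo[OF n step.hyps(1) _ _ that] h step.prems True
      by (intro sum.cong) auto
    then show ?thesis by blast
  next
    case False
    have "no132_across n (w \<circ> adj h) i" by (rule no132_across_swap[OF h False step.prems(1)])
    from step.IH[OF h' this step.prems(2)] obtain c where
      c: "\<And>m. cf (schubert n (w \<circ> adj h)) m \<noteq> 0 \<Longrightarrow> (\<Sum>j\<in>{1..i}. expo m j) = c" by blast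
    have "(\<Sum>j\<in>{1..i}. expo m j) = (if h < i then c - 1 else c)" if m: "cf (schubert n w) m \<noteq> 0" for m
    proof -
      from schubert_support_step[OF step.hyps(1) h' m]
      obtain m' where m': "cf (schubert n (w \<circ> adj h)) m' \<noteq> 0"
        "\<And>j. j \<noteq> h \<Longrightarrow> j \<noteq> Suc h \<Longrightarrow> expo m' j = expo m j"
        "expo m' h + expo m' (Suc h) = Suc (expo m h + expo m (Suc h))" by blast
      show ?thesis
      proof (cases "h < i")
        case True
        let ?R = "{1..i} - {h} - {Suc h}"
        have split: "(\<Sum>j\<in>{1..i}. f j) = f h + (f (Suc h) + (\<Sum>j\<in>?R. f j))" for f :: "nat \<Rightarrow> nat"
          using True h' by (subst sum.remove[of _ h], simp, simp, subst sum.remove[of _ "Suc h"]) auto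
        have "(\<Sum>j\<in>?R. expo m' j) = (\<Sum>j\<in>?R. expo m j)"
          by (rule sum.cong) (use m'(2) in auto)
        then show ?thesis using c[OF m'(1)] m'(3) True unfolding split by simp
      next
        case hi: False
        have "(\<Sum>j\<in>{1..i}. expo m' j) = (\<Sum>j\<in>{1..i}. expo m j)"
          by (rule sum.cong) (use m'(2) hi False in auto)
        then show ?thesis using c[OF m'(1)] hi by simp
      qed
    qed
    then show ?thesis by blast
  qed
qed

section \<open>Two criteria for preserving zero-one coefficients\<close>

lemma zero_one_step_prefix:
  assumes n: "n \<ge> 1" and w: "w permutes {1..n}" and h: "1 \<le> h" "h < n" "w h < w (Suc h)"
    and u: "zero_one (schubert n (w \<circ> adj h))" "no132_across n (w \<circ> adj h) h"
  shows "zero_one (schubert n w)"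
proof (rule zero_one_divdiff[OF schubert_divdiff[OF w h] u(1) nonneg_schubert[OF n w]])
  fix m m' assume m: "cf (schubert n (w \<circ> adj h)) m \<noteq> 0" "cf (schubert n (w \<circ> adj h)) m' \<noteq> 0"
    and eq: "\<And>j. j \<noteq> h \<Longrightarrow> j \<noteq> Suc h \<Longrightarrow> expo m j = expo m' j"
  obtain c where c: "\<And>m. cf (schubert n (w \<circ> adj h)) m \<noteq> 0 \<Longrightarrow> (\<Sum>j\<in>{1..h}. expo m j) = c"
    using prefix_degree_const[OF n swap_permutes[OF w h(1,2)] u(2) h(2)] by blast
  have split: "(\<Sum>j\<in>{1..h}. f j) = f h + (\<Sum>j\<in>{1..h} - {h}. f j)" for f :: "nat \<Rightarrow> nat"
    using h by (subst sum.remove[of _ h]) auto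
  have "(\<Sum>j\<in>{1..h} - {h}. expo m j) = (\<Sum>j\<in>{1..h} - {h}. expo m' j)"
    by (rule sum.cong) (use eq in auto)
  then show "expo m h = expo m' h"
    using c[OF m(1)] c[OF m(2)] unfolding split by simp
qed

lemma zero_one_step_window:
  assumes n: "n \<ge> 1" and w: "w permutes {1..n}" and h: "1 \<le> h" "h < n" "w h < w (Suc h)"
    and u: "zero_one (schubert n (w \<circ> adj h))"
    and low: "\<And>j. j \<in> {1..Suc h} \<Longrightarrow> v < w j" and up: "card (overhang n (w \<circ> adj h) h) \<le> v + 2"
  shows "zero_one (schubert n w)"
proof (rule zero_one_divdiff[OF schubert_divdiff[OF w h] u nonneg_schubert[OF n w]])
  have u: "(w \<circ> adj h) permutes {1..n}" by (rule swap_permutes[OF w h(1,2)])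
  have bound: "v \<le> expo m (Suc h) \<and> expo m h \<le> v + 2"
    if m: "cf (schubert n (w \<circ> adj h)) m \<noteq> 0" for m
  proof
    have "v < (w \<circ> adj h) j" if "j \<in> {1..Suc h}" for j
      using low[of "adj h j"] that h by (auto simp: transpose_def)
    then show "v \<le> expo m (Suc h)"
      using h by (intro schubert_expo_ge[OF n u m]) auto
    show "expo m h \<le> v + 2"
      using schubert_expo_le[OF n u m, of h] h up by simp
  qed
  fix m m' assume m: "cf (schubert n (w \<circ> adj h)) m \<noteq> 0" "cf (schubert n (w \<circ> adj h)) m' \<noteq> 0"
    and "expo m h + expo m (Suc h) = expo m' h + expo m' (Suc h)"
    and "expo m (Suc h) < expo m h" "expo m' (Suc h) < expo m' h"
  then have sum: "expo m h + expo m (Suc h) = expo m' h + expo m' (Suc h)"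
    and m1: "expo m h = expo m (Suc h) + 1 \<or> expo m h = expo m (Suc h) + 2"
    and m2: "expo m' h = expo m' (Suc h) + 1 \<or> expo m' h = expo m' (Suc h) + 2"
    using bound[OF m(1)] bound[OF m(2)] by linarith+
  \<comment> \<open>Parity: the sum is fixed, so the difference of the exponents is either 1 for
    both monomials or 2 for both.\<close>
  have "a = a'" if "a + b = a' + b'" "a = b + 1 \<or> a = b + 2" "a' = b' + 1 \<or> a' = b' + 2"
    for a b a' b' :: nat using that by arith
  from this[OF sum m1 m2] show "expo m h = expo m' h" .
qed

section \<open>Permutations without bad configurations\<close>

definition config_free :: "nat \<Rightarrow> (nat \<Rightarrow> nat) \<Rightarrow> bool" where
  "config_free n w \<longleftrightarrow>
    (\<forall>p b a d c. 1 \<le> p \<longrightarrow> \<not> cfgI n w p b a d c) \<and>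
    (\<forall>p q r s t. 1 \<le> p \<longrightarrow> \<not> cfgD n w p q r s t) \<and>
    (\<forall>p q r s d c. 1 \<le> p \<longrightarrow> \<not> cfgA n w p q r s d c)"

lemma config_free_cfgI:
  "config_free n w \<Longrightarrow> 1 \<le> p \<Longrightarrow> p < b \<Longrightarrow> b < a \<Longrightarrow> a \<le> n \<Longrightarrow> b < d \<Longrightarrow> d < c \<Longrightarrow> c \<le> n \<Longrightarrow>
    w p < w a \<Longrightarrow> w a < w b \<Longrightarrow> w b < w c \<Longrightarrow> w c < w d \<Longrightarrow> False"
  unfolding config_free_def cfgI_def by blast

lemma config_free_cfgD:
  "config_free n w \<Longrightarrow> 1 \<le> p \<Longrightarrow> p < q \<Longrightarrow> q < r \<Longrightarrow> r < s \<Longrightarrow> s < t \<Longrightarrow> t \<le> n \<Longrightarrow>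
    w p < w t \<Longrightarrow> w q < w t \<Longrightarrow> w t < w s \<Longrightarrow> w s < w r \<Longrightarrow> False"
  unfolding config_free_def cfgD_def by blast

lemma config_free_cfgA:
  "config_free n w \<Longrightarrow> 1 \<le> p \<Longrightarrow> p < q \<Longrightarrow> q < r \<Longrightarrow> r < s \<Longrightarrow> s < d \<Longrightarrow> d \<le> n \<Longrightarrow> r < c \<Longrightarrow> c \<le> n \<Longrightarrow>
    w p < w d \<Longrightarrow> w q < w c \<Longrightarrow> w c < w d \<Longrightarrow> w d < w r \<Longrightarrow> w r < w s \<Longrightarrow> False"
  unfolding config_free_def cfgA_def by blast

lemma adj_mono: "x < y \<Longrightarrow> \<not> (x = h \<and> y = Suc h) \<Longrightarrow> adj h x < adj h y"
  by (auto simp: transpose_def)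

lemma adj_ge_one: "1 \<le> h \<Longrightarrow> 1 \<le> x \<Longrightarrow> 1 \<le> adj h x"
  by (auto simp: transpose_def)

lemma adj_le: "h < n \<Longrightarrow> x \<le> n \<Longrightarrow> adj h x \<le> n"
  by (auto simp: transpose_def)

text \<open>A configuration of \<open>w s_h\<close> is one of \<open>w\<close>, unless \<open>h\<close> and \<open>h + 1\<close> play two roles whose
  order matters.\<close>

lemma config_free_swapI:
  assumes w: "config_free n w" and h: "1 \<le> h" "h < n"
  defines "u \<equiv> w \<circ> adj h"
  assumes I: "\<And>p b a d c. 1 \<le> p \<Longrightarrow> cfgI n u p b a d c \<Longrightarrow>
      (b = h \<and> a = Suc h) \<or> (b = h \<and> d = Suc h) \<or> (d = h \<and> c = Suc h) \<or> (p = h \<and> b = Suc h) \<Longrightarrow> False"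
    and D: "\<And>p q r s t. 1 \<le> p \<Longrightarrow> cfgD n u p q r s t \<Longrightarrow>
      (p = h \<and> q = Suc h) \<or> (q = h \<and> r = Suc h) \<or> (r = h \<and> s = Suc h) \<or> (s = h \<and> t = Suc h) \<Longrightarrow> False"
    and A: "\<And>p q r s d c. 1 \<le> p \<Longrightarrow> cfgA n u p q r s d c \<Longrightarrow>
      (p = h \<and> q = Suc h) \<or> (q = h \<and> r = Suc h) \<or> (r = h \<and> s = Suc h) \<or> (s = h \<and> d = Suc h) \<or>
      (r = h \<and> c = Suc h) \<Longrightarrow> False"
  shows "config_free n u"
proof -
  have uw: "u x = w (adj h x)" for x by (simp add: u_def)
  have "\<not> cfgI n u p b a d c" if p: "1 \<le> p" for p b a d c
  proof
    assume c: "cfgI n u p b a d c"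
    then have "cfgI n w (adj h p) (adj h b) (adj h a) (adj h d) (adj h c)"
      using I[OF p c] h(2) unfolding cfgI_def uw by (blast intro: adj_mono adj_le)
    then show False using w adj_ge_one[OF h(1) p] by (auto simp: config_free_def)
  qed
  moreover have "\<not> cfgD n u p q r s t" if p: "1 \<le> p" for p q r s t
  proof
    assume c: "cfgD n u p q r s t"
    then have "cfgD n w (adj h p) (adj h q) (adj h r) (adj h s) (adj h t)"
      using D[OF p c] h(2) unfolding cfgD_def uw by (blast intro: adj_mono adj_le)
    then show False using w adj_ge_one[OF h(1) p] by (auto simp: config_free_def)
  qed
  moreover have "\<not> cfgA n u p q r s d c" if p: "1 \<le> p" for p q r s d c
  proof
    assume c: "cfgA n u p q r s d c"
    then have "cfgA n w (adj h p) (adj h q) (adj h r) (adj h s) (adj h d) (adj h c)"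
      using A[OF p c] h(2) unfolding cfgA_def uw by (blast intro: adj_mono adj_le)
    then show False using w adj_ge_one[OF h(1) p] by (auto simp: config_free_def)
  qed
  ultimately show ?thesis unfolding config_free_def by blast
qed

lemma first_ascent_min:
  assumes "first_ascent n w h" "1 \<le> j" "j \<le> Suc h"
  shows "w h \<le> w j"
proof -
  consider "j < h" | "j = h" | "j = Suc h" using assms(3) by linarith
  then show ?thesis
  proof cases
    case 1
    then have "w h < w j" using assms(1,2) unfolding first_ascent_def by blast
    then show ?thesis by simp
  qed (use assms(1) in \<open>auto simp: first_ascent_def\<close>)
qed

text \<open>After the exchange, position \<open>h + 1\<close> holds the smallest of the first
  \<open>h + 1\<close> letters. An exceptional role pair would require a smaller letter before it,
  except when \<open>h\<close> and \<open>h + 1\<close> are the first two letters of a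
  \<open>cfgD\<close> or \<open>cfgA\<close>, whose order is essentially free.\<close>

lemma config_free_swap_first_ascent:
  assumes w: "w permutes {1..n}" "config_free n w" and h: "first_ascent n w h"
  shows "config_free n (w \<circ> adj h)"
proof -
  let ?u = "w \<circ> adj h"
  have h': "1 \<le> h" "h < n" "w h < w (Suc h)" and dec: "\<And>j. 1 \<le> j \<Longrightarrow> j < h \<Longrightarrow> w h < w j"
    using h by (auto simp: first_ascent_def)
  have low: "?u (Suc h) < ?u x" if "1 \<le> x" "x \<le> h" for x
    using that h' dec[of x] by (cases "x = h") auto
  have later: "?u x = w x" if "Suc h < x" for x using that by simp
  show ?thesis
  proof (rule config_free_swapI[OF w(2) h'(1,2)])
    fix p b a d c assume p: "1 \<le> p" and c: "cfgI n ?u p b a d c"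
      and "(b = h \<and> a = Suc h) \<or> (b = h \<and> d = Suc h) \<or> (d = h \<and> c = Suc h) \<or> (p = h \<and> b = Suc h)"
    then show False using low[OF p] c unfolding cfgI_def by fastforce
  next
    fix p q r s t assume p: "1 \<le> p" and c: "cfgD n ?u p q r s t"
      and "(p = h \<and> q = Suc h) \<or> (q = h \<and> r = Suc h) \<or> (r = h \<and> s = Suc h) \<or> (s = h \<and> t = Suc h)"
    then consider "p = h" "q = Suc h" | "p \<le> h" "?u p < ?u (Suc h)"
      unfolding cfgD_def by fastforce
    then show False
    proof cases
      case 1
      then show False
        using c h' later[of r] later[of s] later[of t]
        unfolding cfgD_def by (intro config_free_cfgD[OF w(2) h'(1), of "Suc h" r s t]) auto
    next
      case 2
      then show False using low[OF p] by simp
    qed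
  next
    fix p q r s d c assume p: "1 \<le> p" and c: "cfgA n ?u p q r s d c"
      and "(p = h \<and> q = Suc h) \<or> (q = h \<and> r = Suc h) \<or> (r = h \<and> s = Suc h) \<or> (s = h \<and> d = Suc h) \<or>
        (r = h \<and> c = Suc h)"
    then consider "p = h" "q = Suc h" | "p \<le> h" "?u p < ?u (Suc h)" | "1 \<le> q" "q \<le> h" "?u q < ?u (Suc h)"
      unfolding cfgA_def by fastforce
    then show False
    proof cases
      case 1
      then have pos: "Suc h < r" "r < s" "s < d" "d \<le> n" "r < c" "c \<le> n"
        and val: "w (Suc h) < w d" "w h < w c" "w c < w d" "w d < w r" "w r < w s"
        using c unfolding cfgA_def by auto
      have "w (Suc h) \<noteq> w c" using permutes_eq_iff[OF w(1), of "Suc h" c] pos by simp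
      then consider "w (Suc h) < w c" | "w c < w (Suc h)" by linarith
      then show False
      proof cases
        case 1
        show False
          by (rule config_free_cfgA[OF w(2) h'(1), of "Suc h" r s d c]) (use pos val 1 in auto)
      next
        case 2
        show False
          by (rule config_free_cfgI[OF w(2) h'(1), of "Suc h" c s d]) (use pos val 2 in auto)
      qed
    next
      case 2
      then show False using low[OF p] by simp
    next
      case 3
      then show False using low[of q] by simp
    qed
  qed
qed

text \<open>In the Rothe diagram below row \<open>q\<close>, the column of \<open>w d\<close> has boxes in the rows \<open>r\<close> and \<open>s\<close>, and
  the column of \<open>w c\<close> has a box in row \<open>y\<close>.\<close>

lemma two_boxes_upper:
  assumes w: "w permutes {1..n}" "config_free n w"
    and pq: "1 \<le> p" "p < q" "w p < w d" "w q < w c"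
    and cd: "c \<le> n" "d \<le> n" "w c < w d"
    and rs: "q < r" "r < d" "w d < w r" "q < s" "s < d" "w d < w s" "r \<noteq> s"
    and y: "q < y" "y < c" "w c < w y"
  shows False
proof -
  \<comment> \<open>The topmost box of the column of \<open>w d\<close> below row \<open>q\<close>.
    If \<open>c\<close> comes later, the order of \<open>w r1\<close> and \<open>w s1\<close>
    decides between \<open>cfgA\<close> and \<open>cfgD\<close>; if \<open>c\<close> comes earlier,
    then \<open>y\<close> supplies a \<open>cfgI\<close>.\<close>
  define r1 where "r1 = (LEAST r. q < r \<and> r < d \<and> w d < w r)"
  have r1: "q < r1 \<and> r1 < d \<and> w d < w r1"
    unfolding r1_def by (rule LeastI[of _ r]) (use rs in auto)
  have least: "r1 \<le> x" if "q < x" "x < d" "w d < w x" for x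
    unfolding r1_def by (rule Least_le) (use that in auto)
  obtain s1 where s1: "s1 \<in> {r, s}" "s1 \<noteq> r1" using rs(7) by blast
  have s1': "s1 < d" "w d < w s1" "r1 < s1"
    using s1 rs least[of s1] by auto
  have neq: "w a \<noteq> w b" if "a \<noteq> b" for a b using permutes_eq_iff[OF w(1)] that by blast
  have "c \<noteq> r1" using r1 cd by auto
  then consider "r1 < c" "w r1 < w s1" | "r1 < c" "w s1 < w r1" | "c < r1"
    using neq[OF s1(2)] by linarith
  then show False
  proof cases
    case 1
    show False by (rule config_free_cfgA[OF w(2) pq(1,2), of r1 s1 d c]) (use r1 s1' pq cd 1 in auto)
  next
    case 2
    show False by (rule config_free_cfgD[OF w(2) pq(1,2), of r1 s1 d]) (use r1 s1' pq cd 2 in auto)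
  next
    case 3
    have "w y \<noteq> w d" using neq[of y d] y r1 3 by auto
    then consider "w y < w d" | "w d < w y" by linarith
    then show False
    proof cases
      case 1
      show False by (rule config_free_cfgI[OF w(2), of q y c r1 d]) (use r1 y pq cd 1 3 in auto)
    next
      case 2
      then show False using least[of y] y r1 3 by auto
    qed
  qed
qed

text \<open>If \<open>w c\<close> exceeds \<open>w d\<close>, the previous lemma with the two
  columns interchanged leaves only the box in row \<open>y\<close> in the column of
  \<open>w c\<close>. Each arrangement of \<open>y\<close>, \<open>c\<close> and \<open>d\<close>
  then gives a \<open>cfgI\<close> or \<open>cfgD\<close>.\<close>

lemma two_boxes:
  assumes w: "w permutes {1..n}" "config_free n w"
    and pq: "1 \<le> p" "p < q" "w p < w d" "w q < w d" "w q < w c"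
    and cd: "c \<le> n" "d \<le> n" "c \<noteq> d"
    and rs: "q < r" "r < d" "w d < w r" "q < s" "s < d" "w d < w s" "r \<noteq> s"
    and y: "q < y" "y < c" "w c < w y"
  shows False
proof -
  have neq: "w a \<noteq> w b" if "a \<noteq> b" for a b using permutes_eq_iff[OF w(1)] that by blast
  show False
  proof (cases "w c < w d")
    case True
    show False by (rule two_boxes_upper[OF w pq(1,2,3,5) cd(1,2) True rs y])
  next
    case False
    then have dc: "w d < w c" using neq[OF cd(3)] by simp
    have only: "x = y" if "q < x" "x < c" "w c < w x" for x
    proof (rule ccontr)
      assume "x \<noteq> y"
      show False
        by (rule two_boxes_upper[OF w pq(1,2) _ pq(4) cd(2,1) dc that y \<open>x \<noteq> y\<close> rs(1-3)])
          (use pq dc in simp)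
    qed
    have "y \<noteq> d" using y dc by auto
    then consider "d < y" | "y < d" "c < d" | "y < d" "d < c" using cd(3) by linarith
    then show False
    proof cases
      case 1
      have "w r < w c"
      proof (rule ccontr)
        assume "\<not> w r < w c"
        moreover have "r \<noteq> c" using rs 1 y by auto
        ultimately have "w c < w r" using neq[of r c] by simp
        then have "r = y" using only[of r] rs 1 y by simp
        then show False using rs 1 by simp
      qed
      show False by (rule config_free_cfgI[OF w(2), of q r d y c]) (use rs y pq cd dc \<open>w r < w c\<close> 1 in auto)
    next
      case 2
      show False by (rule config_free_cfgD[OF w(2) pq(1,2), of y c d]) (use y pq cd dc 2 in auto)
    next
      case 3
      obtain y1 where y1: "y1 \<in> {r, s}" "y1 \<noteq> y" using rs(7) by blast
      then have y1': "q < y1" "y1 < d" "w d < w y1" using rs by auto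
      have "w y1 < w c"
      proof (rule ccontr)
        assume "\<not> w y1 < w c"
        then have "w c < w y1" using neq[of y1 c] y1' 3 by force
        then show False using only[of y1] y1 y1' 3 by simp
      qed
      consider "y1 < y" | "y < y1" using y1(2) by linarith
      then show False
      proof cases
        case 1
        show False by (rule config_free_cfgI[OF w(2), of q y1 d y c]) (use y1' y pq cd \<open>w y1 < w c\<close> 1 in auto)
      next
        case 2
        show False by (rule config_free_cfgD[OF w(2) pq(1,2), of y y1 d]) (use y1' y pq cd \<open>w y1 < w c\<close> 2 in auto)
      qed
    qed
  qed
qed

text \<open>The columns of the Rothe diagram to the right of \<open>w h\<close> with a box below row
  \<open>h\<close>, recorded by position.\<close>

definition cols :: "nat \<Rightarrow> (nat \<Rightarrow> nat) \<Rightarrow> nat \<Rightarrow> nat set" where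
  "cols n w h = {z \<in> {1..n}. w h < w z \<and> (\<exists>y. h < y \<and> y < z \<and> w z < w y)}"

lemma card_overhang_first_ascent:
  assumes w: "w permutes {1..n}" and h: "first_ascent n w h"
  shows "card (overhang n (w \<circ> adj h) h) \<le> w h + card (cols n w h)"
proof -
  have h': "1 \<le> h" "h < n" "w h < w (Suc h)" using h by (auto simp: first_ascent_def)
  have "overhang n w (Suc h) \<subseteq> {z \<in> {1..n}. w z < w h} \<union> cols n w h"
  proof
    fix z assume "z \<in> overhang n w (Suc h)"
    then obtain y where z: "z \<in> {1..n}" and y: "h < y" "y < z" "w z < w y"
      by (auto simp: overhang_def Suc_le_eq)
    have "w z \<noteq> w h" using permutes_eq_iff[OF w, of z h] y by simp
    then show "z \<in> {z \<in> {1..n}. w z < w h} \<union> cols n w h"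
      using z y unfolding cols_def by (cases "w z < w h") auto
  qed
  then have "card (overhang n w (Suc h)) \<le> card ({z \<in> {1..n}. w z < w h} \<union> cols n w h)"
    by (intro card_mono) (auto simp: cols_def)
  also have "\<dots> \<le> card {z \<in> {1..n}. w z < w h} + card (cols n w h)" by (rule card_Un_le)
  also have "card {z \<in> {1..n}. w z < w h} = w h - 1"
    using h' by (intro card_smaller_values[OF w]) auto
  finally have "card (overhang n w (Suc h)) \<le> w h - 1 + card (cols n w h)" .
  moreover have "w h \<in> {1..n}" using h' by (intro permutes_mem_iff[OF w]) auto
  ultimately show ?thesis using card_overhang_swap[OF h'(3), of n] by auto
qed

text \<open>If neither criterion applies at the first ascent, then all boxes below row \<open>h\<close> in columns beyond
  \<open>w h\<close> lie in one row \<open>r\<close>. In that case the ascent \<open>r - 1\<close> can be used instead.\<close>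

lemma single_row:
  assumes w: "w permutes {1..n}" "config_free n w" and h: "first_ascent n w h"
    and two: "2 \<le> card (cols n w h)" and J: "\<not> no132_across n (w \<circ> adj h) h"
  obtains r c where "Suc h < r" "r < c" "c \<le> n" "w h < w c" "w c < w r"
    "\<And>y z. h < y \<Longrightarrow> y < z \<Longrightarrow> z \<le> n \<Longrightarrow> w h < w z \<Longrightarrow> w z < w y \<Longrightarrow> y = r"
proof -
  let ?u = "w \<circ> adj h"
  have h': "1 \<le> h" "h < n" "w h < w (Suc h)" and dec: "\<And>j. 1 \<le> j \<Longrightarrow> j < h \<Longrightarrow> w h < w j"
    using h by (auto simp: first_ascent_def)
  have neq: "w a \<noteq> w b" if "a \<noteq> b" for a b using permutes_eq_iff[OF w(1)] that by blast
  from J obtain x r d where xrd: "1 \<le> x" "x \<le> h" "h < r" "r < d" "d \<le> n" "?u x < ?u d" "?u d < ?u r"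
    unfolding no132_across_def by blast
  have "r \<noteq> Suc h"
  proof
    assume "r = Suc h"
    then have "?u x < w h" using xrd by simp
    then show False using dec[of x] h' xrd by (cases "x = h") auto
  qed
  then have r: "Suc h < r" using xrd by simp
  then have d: "Suc h < d" using xrd by simp
  then have udr: "?u d = w d" "?u r = w r" using r by auto
  have wd: "w h < w d" using xrd udr dec[of x] h' by (cases "x = h") auto
  have other: "\<exists>c. c \<in> cols n w h \<and> c \<noteq> c'" for c'
  proof (rule ccontr)
    assume "\<not> ?thesis"
    then have "cols n w h \<subseteq> {c'}" by blast
    then have "card (cols n w h) \<le> card {c'}" by (intro card_mono) auto
    then show False using two by simp
  qed
  \<comment> \<open>Otherwise the column of \<open>w d\<close> has boxes in the rows
    \<open>h + 1\<close> and \<open>r\<close>, and \<open>two_boxes\<close> applies with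
    \<open>x\<close> and \<open>h\<close> as the two small letters.\<close>
  have low: "w (Suc h) < w d"
  proof (rule ccontr)
    assume "\<not> w (Suc h) < w d"
    then have gt: "w d < w (Suc h)" using neq[of "Suc h" d] d by simp
    then have "x \<noteq> h" using xrd udr by auto
    then have x: "x < h" "w x < w d" using xrd udr by auto
    obtain c where "c \<in> cols n w h" "c \<noteq> d" using other by blast
    then obtain y where c: "c \<le> n" "w h < w c" "h < y" "y < c" "w c < w y" by (auto simp: cols_def)
    show False
      by (rule two_boxes[OF w xrd(1) x(1) x(2) wd c(2) c(1) xrd(5) \<open>c \<noteq> d\<close> _ _ gt _ _ _ _ c(3-5), of r])
        (use r d xrd udr in auto)
  qed
  have col: "w (Suc h) < w z" if "h < y" "y < z" "z \<le> n" "w h < w z" "w z < w y" for y z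
  proof (rule ccontr)
    assume "\<not> ?thesis"
    then have "w z < w (Suc h)" using neq[of "Suc h" z] that by force
    show False
      by (rule config_free_cfgI[OF w(2) h'(1), of "Suc h" z r d])
        (use that r d xrd udr low \<open>w z < w (Suc h)\<close> in auto)
  qed
  have box: "Suc h < y" if "h < y" "y < z" "z \<le> n" "w h < w z" "w z < w y" for y z
    using col[OF that] that by (cases "y = Suc h") auto
  \<comment> \<open>By \<open>col\<close> and \<open>box\<close> every relevant box lies below row
    \<open>h + 1\<close> and to the right of its letter, so \<open>two_boxes\<close> now applies
    with \<open>h\<close> and \<open>h + 1\<close> as the small letters.\<close>
  have one: "y = y'" if z: "z \<le> n" "w h < w z" and y: "h < y" "y < z" "w z < w y"
    and y': "h < y'" "y' < z" "w z < w y'" for y y' z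
  proof (rule ccontr)
    assume "y \<noteq> y'"
    obtain c where "c \<in> cols n w h" "c \<noteq> z" using other by blast
    then obtain v where c: "c \<le> n" "w h < w c" "h < v" "v < c" "w c < w v" by (auto simp: cols_def)
    show False
      by (rule two_boxes[OF w h'(1) lessI z(2) col[OF y(1,2) z y(3)] col[OF c(3,4,1,2,5)] c(1) z(1)
            \<open>c \<noteq> z\<close> box[OF y(1,2) z y(3)] y(2,3) box[OF y'(1,2) z y'(3)] y'(2,3) \<open>y \<noteq> y'\<close>
            box[OF c(3,4,1,2,5)] c(4,5)])
  qed
  \<comment> \<open>Boxes of two columns in different rows would be shared with one of the columns,
    contradicting \<open>one\<close>, or else give a \<open>cfgI\<close> starting at
    \<open>h + 1\<close>.\<close>
  have share: "a = b"
    if lo: "lo \<le> n" "w h < w lo" "h < a" "a < lo" "w lo < w a"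
      and up: "up \<le> n" "h < b" "b < up" "w up < w b" "w lo < w up" for a b lo up
  proof (rule ccontr)
    assume "a \<noteq> b"
    have "b \<noteq> lo" using up by auto
    moreover have "\<not> b < lo"
      using one[OF lo(1,2,3,4,5) up(2)] \<open>a \<noteq> b\<close> up by auto
    ultimately have "lo < b" by simp
    have "\<not> w up < w a"
      using one[of up a b] up lo \<open>lo < b\<close> \<open>a \<noteq> b\<close> by auto
    then have "w a < w up" using neq[of a up] lo up \<open>lo < b\<close> by force
    show False
      by (rule config_free_cfgI[OF w(2), of "Suc h" a lo b up])
        (use lo up \<open>lo < b\<close> \<open>w a < w up\<close> box[OF lo(3,4,1,2,5)] col[OF lo(3,4,1,2,5)] in auto)
  qed
  have row: "y = r" if "h < y" "y < z" "z \<le> n" "w h < w z" "w z < w y" for y z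
  proof (cases "z = d")
    case True
    then show ?thesis using one[of d y r] that xrd udr r by auto
  next
    case False
    then consider "w z < w d" | "w d < w z" using neq[of z d] by linarith
    then show ?thesis
    proof cases
      case 1
      then show ?thesis using share[of z y d r] that xrd udr by auto
    next
      case 2
      then show ?thesis using share[of d r z y] that xrd udr wd by auto
    qed
  qed
  have "w d < w r" using xrd udr by simp
  show ?thesis by (rule that[OF r xrd(4,5) wd \<open>w d < w r\<close> row])
qed

section \<open>The ascent just above the single row of boxes\<close>

context
  fixes n :: nat and w :: "nat \<Rightarrow> nat" and h k c :: nat
  assumes w: "w permutes {1..n}" "config_free n w" and h: "first_ascent n w h"
    and k: "h < k" "Suc k < c" "c \<le> n" "w h < w c" "w c < w (Suc k)"
    and single: "\<forall>y z. h < y \<longrightarrow> y < z \<longrightarrow> z \<le> n \<longrightarrow> w h < w z \<longrightarrow> w z < w y \<longrightarrow> y = Suc k"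
begin

lemmas single_row_unique = single[rule_format]

lemma single_row_neq: "a \<noteq> b \<Longrightarrow> w a \<noteq> w b"
  using permutes_eq_iff[OF w(1)] by blast

lemma single_row_less: "w k < w c"
proof (rule ccontr)
  assume "\<not> w k < w c"
  moreover have "w k \<noteq> w c" using k by (intro single_row_neq) simp
  ultimately have "w c < w k" by simp
  then show False using single_row_unique[of k c] k by simp
qed

lemma single_row_before_dec: "1 \<le> a \<Longrightarrow> a < b \<Longrightarrow> b \<le> h \<Longrightarrow> w b < w a"
  using h by (auto simp: first_ascent_def)

lemma single_row_h: "1 \<le> h"
  using h by (simp add: first_ascent_def)

text \<open>A 2 above \<open>w h\<close> would have a box in its column in row \<open>k\<close> or
  in a row after \<open>k + 1\<close>, against uniqueness of the row. A 2 below \<open>w h\<close>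
  forms a \<open>cfgI\<close> or \<open>cfgD\<close> with the letters at \<open>k\<close> and
  \<open>k + 1\<close> and one further letter.\<close>

lemma single_row_no132: "no132_across n (w \<circ> adj k) k"
  unfolding no132_across_def
proof (intro allI impI notI; elim conjE)
  let ?u = "w \<circ> adj k"
  fix x y z
  assume xyz: "1 \<le> x" "x \<le> k" "k < y" "y < z" "z \<le> n" and v: "?u x < ?u z" "?u z < ?u y"
  have uz: "?u z = w z" using xyz by simp
  have uy: "?u y = (if y = Suc k then w k else w y)" using xyz by simp
  have "w z \<noteq> w h" using single_row_neq[of z h] xyz k by simp
  then consider "w h < w z" | "w z < w h" by linarith
  then show False
  proof cases
    case 1
    then show False
      using single_row_unique[of k z] single_row_unique[of y z] xyz k v uz uy by (auto split: if_splits)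
  next
    case 2
    have "x \<noteq> k"
    proof
      assume "x = k"
      then show False using v uz 2 k by simp
    qed
    then have x: "x < k" "w x < w z" using xyz v uz by auto
    consider "w z < w k" | "w k < w z" using single_row_neq[of z k] xyz by linarith
    then show False
    proof cases
      case 1
      show False
        by (rule config_free_cfgI[OF w(2) xyz(1), of k z "Suc k" c])
          (use x xyz k 1 single_row_less in auto)
    next
      case kz: 2
      then have y: "Suc k < y" "w z < w y" using xyz v uz uy by (auto split: if_splits)
      consider "w y < w (Suc k)" | "w (Suc k) < w y" using single_row_neq[of y "Suc k"] y by linarith
      then show False
      proof cases
        case 1
        show False
          by (rule config_free_cfgD[OF w(2) xyz(1), of k "Suc k" y z]) (use x xyz y kz 1 in auto)
      next
        case gt: 2
        have "\<not> y < c" using single_row_unique[of y c] y k gt by auto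
        moreover have "y \<noteq> c" using gt k by auto
        ultimately have "c < z" using xyz by simp
        show False
          by (rule config_free_cfgD[OF w(2) xyz(1), of k "Suc k" c z]) (use x xyz kz k 2 \<open>c < z\<close> in auto)
      qed
    qed
  qed
qed

text \<open>A new configuration must use the descent created at \<open>k\<close>. It then needs a
  descent after \<open>k + 1\<close> above \<open>w h\<close>, excluded by the single row, or a rise
  before \<open>k\<close> to a letter above \<open>w c\<close>, excluded by \<open>no_left\<close>,
  or it becomes a configuration of \<open>w\<close> by using \<open>k + 1\<close> and
  \<open>c\<close>.\<close>

lemma single_row_config_free: "config_free n (w \<circ> adj k)"
proof -
  let ?u = "w \<circ> adj k"
  have u: "?u k = w (Suc k)" "?u (Suc k) = w k" by simp_all
  have u_other: "?u x = w x" if "x \<noteq> k" "x \<noteq> Suc k" for x using that by simp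
  have kn: "1 \<le> k" "k < n" using k single_row_h by auto
  have kS: "w k < w (Suc k)" using single_row_less k by simp
  note less = single_row_less
  \<comment> \<open>Up to \<open>h\<close> the word decreases, and between \<open>h\<close> and
    \<open>k\<close> a letter above \<open>w c\<close> would be a second box in the column of
    \<open>w c\<close>.\<close>
  have no_left: False if "1 \<le> q" "q < r" "r < k" "w q < w r" "w c < w r" for q r
  proof (cases "r \<le> h")
    case True
    then show False using single_row_before_dec[of q r] that by simp
  next
    case False
    then show False using single_row_unique[of r c] that k by simp
  qed
  show ?thesis
  proof (rule config_free_swapI[OF w(2) kn])
    fix p b a d e assume p: "1 \<le> p" and c: "cfgI n ?u p b a d e"
      and "(b = k \<and> a = Suc k) \<or> (b = k \<and> d = Suc k) \<or> (d = k \<and> e = Suc k) \<or> (p = k \<and> b = Suc k)"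
    then consider "b = k" "a = Suc k" | "d = k" "e = Suc k"
      using u kS unfolding cfgI_def by fastforce
    then show False
    proof cases
      case 1
      have "d \<noteq> Suc k" using c 1 kS u unfolding cfgI_def by auto
      then have "Suc k < d" "d < e" "e \<le> n" "w e < w d" "w (Suc k) < w e"
        using c 1 unfolding cfgI_def by auto
      then show False using single_row_unique[of d e] k by simp
    next
      case 2
      then have "a \<noteq> k" "a \<noteq> Suc k" "p \<noteq> k" "p \<noteq> Suc k" "b \<noteq> k" "b \<noteq> Suc k"
        using c kS u unfolding cfgI_def by auto
      then have "p < b" "b < a" "a \<le> n" "b < k" "w p < w a" "w a < w b" "w b < w k"
        using c 2 unfolding cfgI_def by auto
      then show False
        by (intro config_free_cfgI[OF w(2) p, of b a "Suc k" c]) (use k less in auto)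
    qed
  next
    fix p q r s t assume p: "1 \<le> p" and c: "cfgD n ?u p q r s t"
      and "(p = k \<and> q = Suc k) \<or> (q = k \<and> r = Suc k) \<or> (r = k \<and> s = Suc k) \<or> (s = k \<and> t = Suc k)"
    then consider "p = k" "q = Suc k" | "r = k" "s = Suc k" | "s = k" "t = Suc k"
      using u kS unfolding cfgD_def by fastforce
    then show False
    proof cases
      case 1
      then have "Suc k < s" "s < t" "t \<le> n" "w t < w s" "w (Suc k) < w t"
        using c unfolding cfgD_def by auto
      then show False using single_row_unique[of s t] k by simp
    next
      case 2
      then have "p < q" "q < k" "Suc k < t" "t \<le> n" "w p < w t" "w t < w k"
        using c unfolding cfgD_def by auto
      then show False
        by (intro config_free_cfgI[OF w(2) p, of k t "Suc k" c]) (use k less in auto)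
    next
      case 3
      then have "p < q" "q < r" "r < k" "w q < w r" "w (Suc k) < w r"
        using c unfolding cfgD_def by auto
      then show False using no_left[of q r] p k by simp
    qed
  next
    fix p q r s d e assume p: "1 \<le> p" and c: "cfgA n ?u p q r s d e"
      and "(p = k \<and> q = Suc k) \<or> (q = k \<and> r = Suc k) \<or> (r = k \<and> s = Suc k) \<or> (s = k \<and> d = Suc k) \<or>
        (r = k \<and> e = Suc k)"
    then consider "p = k" "q = Suc k" | "s = k" "d = Suc k" | "r = k" "e = Suc k"
      using u kS unfolding cfgA_def by fastforce
    then show False
    proof cases
      case 1
      then have "Suc k < s" "s < d" "d \<le> n" "w d < w s" "w (Suc k) < w d"
        using c unfolding cfgA_def by auto
      then show False using single_row_unique[of s d] k by simp
    next
      case 2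
      then have f: "p < q" "q < r" "r < k" "w p < w k" "w k < w r" "r < e" "?u q < ?u e" "?u e < ?u d"
        using c unfolding cfgA_def by auto
      then have "w q < w r" using 2 u by simp
      have "w r < w c"
      proof (rule ccontr)
        assume "\<not> w r < w c"
        then have "w c < w r" using single_row_neq[of r c] f k by force
        then show False using no_left[of q r] f p \<open>w q < w r\<close> by simp
      qed
      then show False
        by (intro config_free_cfgI[OF w(2) p, of r k "Suc k" c]) (use f k in auto)
    next
      case 3
      have "s \<noteq> Suc k" using c 3 kS u unfolding cfgA_def by auto
      then have f: "p < q" "q < k" "Suc k < s" "s < d" "d \<le> n" "w p < w d" "w q < w k" "w k < w d"
        "w d < w (Suc k)" "w (Suc k) < w s"
        using c 3 unfolding cfgA_def by auto
      have "\<not> w h < w d" using single_row_unique[of s d] f k by auto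
      moreover have "w d \<noteq> w h" using single_row_neq[of d h] f k by simp
      ultimately have "w d < w h" by simp
      have "\<not> s < c" using single_row_unique[of s c] f k by auto
      moreover have "s \<noteq> c" using f k by auto
      ultimately have "c < d" using f by simp
      show False
        by (rule config_free_cfgD[OF w(2) p, of q "Suc k" c d]) (use f k \<open>w d < w h\<close> \<open>c < d\<close> in auto)
    qed
  qed
qed

end

lemma config_free_zero_one:
  assumes n: "n \<ge> 1" and "w permutes {1..n}" "config_free n w"
  shows "zero_one (schubert n w)"
  using assms(2,3)
proof (induction rule: ascent_induct)
  case longest
  show ?case by (rule zero_one_longest[OF n])
next
  case (step w)
  note w = step.hyps(1) step.prems
  obtain h where h: "first_ascent n w h" using first_ascent_exists[OF step.hyps(1,2)] .
  then have h': "1 \<le> h" "h < n" "w h < w (Suc h)" by (auto simp: first_ascent_def)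
  have zu: "zero_one (schubert n (w \<circ> adj h))"
    by (rule step.IH[OF h' config_free_swap_first_ascent[OF w h]])
  consider "card (cols n w h) \<le> 1" | "no132_across n (w \<circ> adj h) h"
    | "2 \<le> card (cols n w h)" "\<not> no132_across n (w \<circ> adj h) h" by linarith
  then show ?case
  proof cases
    case 1
    have "w h \<in> {1..n}" using h' by (intro permutes_mem_iff[OF w(1)]) auto
    show ?thesis
    \<comment> \<open>With \<open>v = w h - 1\<close>: all of the first \<open>h + 1\<close> letters
      exceed \<open>v\<close>, and at most one column beyond \<open>w h\<close> keeps the overhang
      within \<open>w h + 1 = v + 2\<close>.\<close>
    proof (rule zero_one_step_window[OF n w(1) h' zu])
      fix j assume j: "j \<in> {1..Suc h}"
      have "w h \<le> w j"
        using j by (intro first_ascent_min[OF h]) auto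
      then show "w h - 1 < w j" using \<open>w h \<in> {1..n}\<close> by auto
    next
      show "card (overhang n (w \<circ> adj h) h) \<le> w h - 1 + 2"
        using card_overhang_first_ascent[OF w(1) h] 1 \<open>w h \<in> {1..n}\<close> by auto
    qed
  next
    case 2
    show ?thesis by (rule zero_one_step_prefix[OF n w(1) h' zu 2])
  next
    case 3
    obtain r c where rc: "Suc h < r" "r < c" "c \<le> n" "w h < w c" "w c < w r"
      and row: "\<And>y z. h < y \<Longrightarrow> y < z \<Longrightarrow> z \<le> n \<Longrightarrow> w h < w z \<Longrightarrow> w z < w y \<Longrightarrow> y = r"
      using single_row[OF w h 3] by blast
    define k where "k = r - 1"
    have r: "r = Suc k" and hk: "h < k" using rc(1) by (auto simp: k_def)
    have "\<forall>y z. h < y \<longrightarrow> y < z \<longrightarrow> z \<le> n \<longrightarrow> w h < w z \<longrightarrow> w z < w y \<longrightarrow> y = Suc k"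
      using row r by blast
    note E = w h hk rc(2-5)[unfolded r] this
    have kn: "1 \<le> k" "k < n" using hk h' rc r by auto
    have asc: "w k < w (Suc k)"
      using single_row_less[OF E] rc(5) unfolding r by simp
    have "zero_one (schubert n (w \<circ> adj k))"
      by (rule step.IH[OF kn asc single_row_config_free[OF E]])
    then show ?thesis
      by (rule zero_one_step_prefix[OF n w(1) kn asc]) (rule single_row_no132[OF E])
  qed
qed

section \<open>Configurations and patterns\<close>

lemma contains_pattern_iff:
  "contains_pattern n w p \<longleftrightarrow> (\<exists>j. (\<forall>b<length p. \<forall>a<b. j a < j b) \<and>
    (\<forall>a<length p. 1 \<le> j a \<and> j a \<le> n) \<and>
    (\<forall>a<length p. \<forall>b<length p. w (j a) < w (j b) \<longleftrightarrow> p ! a < p ! b))"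
proof
  assume "contains_pattern n w p"
  then obtain js where js: "length js = length p" "sorted_wrt (<) js" "set js \<subseteq> {1..n}"
    "\<forall>a<length p. \<forall>b<length p. w (js ! a) < w (js ! b) \<longleftrightarrow> p ! a < p ! b"
    unfolding contains_pattern_def by blast
  have "1 \<le> js ! a \<and> js ! a \<le> n" if "a < length p" for a
  proof -
    have "js ! a \<in> {1..n}" using js(1,3) nth_mem[of a js] that by (metis subsetD)
    then show ?thesis by simp
  qed
  moreover have "js ! a < js ! b" if "b < length p" "a < b" for a b
    using sorted_wrt_nth_less[OF js(2) that(2)] js(1) that(1) by simp
  ultimately show "\<exists>j. (\<forall>b<length p. \<forall>a<b. j a < j b) \<and> (\<forall>a<length p. 1 \<le> j a \<and> j a \<le> n) \<and>
    (\<forall>a<length p. \<forall>b<length p. w (j a) < w (j b) \<longleftrightarrow> p ! a < p ! b)"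
    using js(4) by (intro exI[of _ "\<lambda>a. js ! a"]) blast
next
  assume "\<exists>j. (\<forall>b<length p. \<forall>a<b. j a < j b) \<and> (\<forall>a<length p. 1 \<le> j a \<and> j a \<le> n) \<and>
    (\<forall>a<length p. \<forall>b<length p. w (j a) < w (j b) \<longleftrightarrow> p ! a < p ! b)"
  then obtain j where j: "\<forall>b<length p. \<forall>a<b. j a < j b" "\<forall>a<length p. 1 \<le> j a \<and> j a \<le> n"
    "\<forall>a<length p. \<forall>b<length p. w (j a) < w (j b) \<longleftrightarrow> p ! a < p ! b" by blast
  let ?js = "map j [0..<length p]"
  have "sorted_wrt (<) ?js"
    unfolding sorted_wrt_iff_nth_less using j(1) by simp
  moreover have "set ?js \<subseteq> {1..n}" using j(2) by auto
  ultimately show "contains_pattern n w p"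
    unfolding contains_pattern_def using j(3) by (intro exI[of _ ?js]) simp
qed

lemma contains_patternI:
  assumes "length js = length p"
    and "\<forall>b<length p. \<forall>a<b. js ! a < js ! b" "\<forall>a<length p. 1 \<le> js ! a \<and> js ! a \<le> n"
    and "\<forall>a<length p. \<forall>b<length p. w (js ! a) < w (js ! b) \<longleftrightarrow> p ! a < p ! b"
  shows "contains_pattern n w p"
  unfolding contains_pattern_iff using assms(2-4) by blast

lemma bad_pattern_not_config_free:
  assumes "p \<in> set bad_patterns" "contains_pattern n w p"
  shows "\<not> config_free n w"
proof
  assume "config_free n w"
  from assms(2) obtain j where J: "\<And>a b. a < b \<Longrightarrow> b < length p \<Longrightarrow> j a < j b"
    "\<And>a. a < length p \<Longrightarrow> 1 \<le> j a" "\<And>a. a < length p \<Longrightarrow> j a \<le> n"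
    "\<And>a b. a < length p \<Longrightarrow> b < length p \<Longrightarrow> w (j a) < w (j b) \<longleftrightarrow> p ! a < p ! b"
    unfolding contains_pattern_iff by blast
  have p1: "1 \<le> j 0" using assms(1) by (intro J(2)) (auto simp: bad_patterns_def)
  have len: "length [a, b, c, d, e] = 5" "length [a, b, c, d, e, f] = 6" for a b c d e f :: nat
    by simp_all
  note D = config_free_cfgD[OF \<open>config_free n w\<close> p1, of "j 1" "j 2" "j 3" "j 4"]
  note I = config_free_cfgI[OF \<open>config_free n w\<close> p1]
  note A = config_free_cfgA[OF \<open>config_free n w\<close> p1, of "j 1" "j 2"]
  from assms(1) show False
    unfolding bad_patterns_def
  proof (simp only: set_simps insert_iff empty_iff, elim disjE)
    assume "p = [1, 2, 5, 4, 3]"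
    with J show False by (intro D) (simp_all only: len, simp_all)
  next
    assume "p = [2, 1, 5, 4, 3]"
    with J show False by (intro D) (simp_all only: len, simp_all)
  next
    assume "p = [1, 3, 2, 5, 4]"
    with J show False by (intro I[of "j 1" "j 2" "j 3" "j 4"]) (simp_all only: len, simp_all)
  next
    assume "p = [1, 3, 5, 2, 4]"
    with J show False by (intro I[of "j 1" "j 3" "j 2" "j 4"]) (simp_all only: len, simp_all)
  next
    assume "p = [1, 3, 5, 4, 2]"
    with J show False by (intro I[of "j 1" "j 4" "j 2" "j 3"]) (simp_all only: len, simp_all)
  next
    assume "p = [1, 2, 5, 3, 6, 4]"
    with J show False by (intro A[of "j 4" "j 5" "j 3"]) (simp_all only: len, simp_all)
  next
    assume "p = [1, 2, 5, 6, 3, 4]"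
    with J show False by (intro A[of "j 3" "j 5" "j 4"]) (simp_all only: len, simp_all)
  next
    assume "p = [2, 1, 5, 3, 6, 4]"
    with J show False by (intro A[of "j 4" "j 5" "j 3"]) (simp_all only: len, simp_all)
  next
    assume "p = [2, 1, 5, 6, 3, 4]"
    with J show False by (intro A[of "j 3" "j 5" "j 4"]) (simp_all only: len, simp_all)
  next
    assume "p = [3, 1, 5, 2, 6, 4]"
    with J show False by (intro A[of "j 4" "j 5" "j 3"]) (simp_all only: len, simp_all)
  next
    assume "p = [3, 1, 5, 6, 2, 4]"
    with J show False by (intro A[of "j 3" "j 5" "j 4"]) (simp_all only: len, simp_all)
  next
    assume "p = [3, 1, 5, 6, 4, 2]"
    with J show False by (intro A[of "j 3" "j 4" "j 5"]) (simp_all only: len, simp_all)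
  qed
qed

lemma cfgI_pattern:
  assumes "cfgI n w p b a d c" "1 \<le> p"
  shows "\<exists>\<sigma>\<in>set bad_patterns. contains_pattern n w \<sigma>"
proof -
  have o: "p < b" "b < a" "a \<le> n" "b < d" "d < c" "c \<le> n" "w p < w a" "w a < w b" "w b < w c" "w c < w d"
    using assms by (auto simp: cfgI_def)
  then have "a \<noteq> d" "a \<noteq> c" by auto
  then consider "a < d" | "d < a" "a < c" | "c < a" by linarith
  then show ?thesis
  proof cases
    case 1
    have "contains_pattern n w [1, 3, 2, 5, 4]"
      by (rule contains_patternI[of "[p, b, a, d, c]"])
        (use o 1 assms(2) in \<open>simp_all add: numeral_eq_Suc All_less_Suc\<close>)
    then show ?thesis by (auto simp: bad_patterns_def)
  next
    case 2
    have "contains_pattern n w [1, 3, 5, 2, 4]"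
      by (rule contains_patternI[of "[p, b, d, a, c]"])
        (use o 2 assms(2) in \<open>simp_all add: numeral_eq_Suc All_less_Suc\<close>)
    then show ?thesis by (auto simp: bad_patterns_def)
  next
    case 3
    have "contains_pattern n w [1, 3, 5, 4, 2]"
      by (rule contains_patternI[of "[p, b, d, c, a]"])
        (use o 3 assms(2) in \<open>simp_all add: numeral_eq_Suc All_less_Suc\<close>)
    then show ?thesis by (auto simp: bad_patterns_def)
  qed
qed

lemma cfgD_pattern:
  assumes w: "w permutes {1..n}" and "cfgD n w p q r s t" "1 \<le> p"
  shows "\<exists>\<sigma>\<in>set bad_patterns. contains_pattern n w \<sigma>"
proof -
  have o: "p < q" "q < r" "r < s" "s < t" "t \<le> n" "w p < w t" "w q < w t" "w t < w s" "w s < w r"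
    using assms by (auto simp: cfgD_def)
  have "w p \<noteq> w q" using permutes_eq_iff[OF w, of p q] o by simp
  then consider "w p < w q" | "w q < w p" by linarith
  then show ?thesis
  proof cases
    case 1
    have "contains_pattern n w [1, 2, 5, 4, 3]"
      by (rule contains_patternI[of "[p, q, r, s, t]"])
        (use o 1 assms(3) in \<open>simp_all add: numeral_eq_Suc All_less_Suc\<close>)
    then show ?thesis by (auto simp: bad_patterns_def)
  next
    case 2
    have "contains_pattern n w [2, 1, 5, 4, 3]"
      by (rule contains_patternI[of "[p, q, r, s, t]"])
        (use o 2 assms(3) in \<open>simp_all add: numeral_eq_Suc All_less_Suc\<close>)
    then show ?thesis by (auto simp: bad_patterns_def)
  qed
qed

lemma cfgA_pattern:
  assumes w: "w permutes {1..n}" and "cfgA n w p q r s d c" "1 \<le> p"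
  shows "\<exists>\<sigma>\<in>set bad_patterns. contains_pattern n w \<sigma>"
proof -
  have o: "p < q" "q < r" "r < s" "s < d" "d \<le> n" "r < c" "c \<le> n"
    "w p < w d" "w q < w c" "w c < w d" "w d < w r" "w r < w s"
    using assms by (auto simp: cfgA_def)
  have pos: "c \<noteq> s" "c \<noteq> d" using o by auto
  have val: "w p \<noteq> w q" "w p \<noteq> w c" using permutes_eq_iff[OF w, of p q] permutes_eq_iff[OF w, of p c] o by simp_all
  \<comment> \<open>Three places for \<open>c\<close> and three ranks for \<open>w p\<close> make
    nine cases. Seven are the patterns of length six; the other two, united in the first case,
    contain a \<open>cfgD\<close> on \<open>p, q, r, d, c\<close>.\<close>
  consider "d < c" "w p < w c"
    | "c < s" "w p < w q" | "c < s" "w q < w p" "w p < w c" | "c < s" "w c < w p"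
    | "s < c" "c < d" "w p < w q" | "s < c" "c < d" "w q < w p" "w p < w c" | "s < c" "c < d" "w c < w p"
    | "d < c" "w c < w p"
    using pos val by (metis linorder_neqE_nat)
  then show ?thesis
  proof cases
    case 1
    then have "cfgD n w p q r d c" using o by (simp add: cfgD_def)
    then show ?thesis using cfgD_pattern[OF w] assms(3) by blast
  next
    case 2
    have "contains_pattern n w [1, 2, 5, 3, 6, 4]"
      by (rule contains_patternI[of "[p, q, r, c, s, d]"])
        (use o 2 assms(3) in \<open>simp_all add: numeral_eq_Suc All_less_Suc\<close>)
    then show ?thesis by (auto simp: bad_patterns_def)
  next
    case 3
    have "contains_pattern n w [2, 1, 5, 3, 6, 4]"
      by (rule contains_patternI[of "[p, q, r, c, s, d]"])
        (use o 3 assms(3) in \<open>simp_all add: numeral_eq_Suc All_less_Suc\<close>)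
    then show ?thesis by (auto simp: bad_patterns_def)
  next
    case 4
    have "contains_pattern n w [3, 1, 5, 2, 6, 4]"
      by (rule contains_patternI[of "[p, q, r, c, s, d]"])
        (use o 4 assms(3) in \<open>simp_all add: numeral_eq_Suc All_less_Suc\<close>)
    then show ?thesis by (auto simp: bad_patterns_def)
  next
    case 5
    have "contains_pattern n w [1, 2, 5, 6, 3, 4]"
      by (rule contains_patternI[of "[p, q, r, s, c, d]"])
        (use o 5 assms(3) in \<open>simp_all add: numeral_eq_Suc All_less_Suc\<close>)
    then show ?thesis by (auto simp: bad_patterns_def)
  next
    case 6
    have "contains_pattern n w [2, 1, 5, 6, 3, 4]"
      by (rule contains_patternI[of "[p, q, r, s, c, d]"])
        (use o 6 assms(3) in \<open>simp_all add: numeral_eq_Suc All_less_Suc\<close>)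
    then show ?thesis by (auto simp: bad_patterns_def)
  next
    case 7
    have "contains_pattern n w [3, 1, 5, 6, 2, 4]"
      by (rule contains_patternI[of "[p, q, r, s, c, d]"])
        (use o 7 assms(3) in \<open>simp_all add: numeral_eq_Suc All_less_Suc\<close>)
    then show ?thesis by (auto simp: bad_patterns_def)
  next
    case 8
    have "contains_pattern n w [3, 1, 5, 6, 4, 2]"
      by (rule contains_patternI[of "[p, q, r, s, d, c]"])
        (use o 8 assms(3) in \<open>simp_all add: numeral_eq_Suc All_less_Suc\<close>)
    then show ?thesis by (auto simp: bad_patterns_def)
  qed
qed

lemma config_free_iff_avoids:
  assumes "w permutes {1..n}"
  shows "config_free n w \<longleftrightarrow> (\<forall>p\<in>set bad_patterns. \<not> contains_pattern n w p)"
  using bad_pattern_not_config_free cfgI_pattern cfgD_pattern[OF assms] cfgA_pattern[OF assms]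
  unfolding config_free_def by meson

lemma zero_one_imp_config_free:
  assumes "n \<ge> 1" "w permutes {1..n}" "zero_one (schubert n w)"
  shows "config_free n w"
proof (rule ccontr)
  assume "\<not> config_free n w"
  have inj: "inj_on w {1..n}" by (rule permutes_inj_on[OF assms(2)])
  have "multiple (Q n 1 w)"
    using \<open>\<not> config_free n w\<close> cfgI_multiple[OF inj] cfgD_multiple[OF inj] cfgA_multiple[OF inj]
    unfolding config_free_def by blast
  then obtain m where "2 \<le> cf (schubert n w) m"
    using assms(1,2) by (auto simp: multiple_def schubert_eq_Q)
  moreover have "cf (schubert n w) m \<in> {0, 1}" using assms(3) by (simp add: zero_one_def)
  ultimately show False by auto
qed

theorem theorem1p1:
  fixes n :: nat and w :: "nat \<Rightarrow> nat"
  assumes "n \<ge> 1" and "w permutes {1..n}"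
  shows "zero_one (schubert n w) \<longleftrightarrow> (\<forall>p \<in> set bad_patterns. \<not> contains_pattern n w p)"
  using config_free_iff_avoids[OF assms(2)] config_free_zero_one[OF assms] zero_one_imp_config_free[OF assms] by blast

end
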